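(* Let $\mathcal{L}$ be a language, let $\mathcal{K}$ be a Fraïssé class of finite $\mathcal{L}$-structures and let $\mathbf{K}$ be its Fraïssé limit. For every integer $k \geq 1$, the following are equivalent: (1) The topological group $\mathrm{Aut}(\mathbf{K})$ is amenable. (2) For every $\epsilon > 0$ and any two structures $\mathbf{A},\mathbf{B} \in \mathcal{K}$, there is a structure $\mathbf{C} \in \mathcal{K}$ such that, for every coloring $\phi \colon {}^{\mathbf{A}}\mathbf{C} \to \{0,\ldots,k\}$, there exists a map $\psi \colon F \to {}^{\mathbf{B}}\mathbf{C}$ with a finite non-empty domain $F$ such that $$\forall \alpha,\beta \in {}^{\mathbf{A}}\mathbf{B} \colon \quad \mu(\psi,\alpha,\beta,\phi,\epsilon) \geq (1-\epsilon)|F| .$$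
   Context: Structures: a language $\mathcal{L}$ is a set of relational symbols, each with an arity (positive integer) and a Lipschitz constant (non-negative real). An $\mathcal{L}$-structure $\mathbf{A}$ is a complete metric space $(A,d)$ with, for each $n$-ary $R\in\mathcal{L}$ of Lipschitz constant $l$, an $l$-Lipschitz function $R^{\mathbf{A}}\colon A^n\to\mathbb{R}$ ($A^n$ has the supremum metric). It is Polish if $A$ is separable. A morphism (embedding) $\mathbf{A}\to\mathbf{B}$ is an isometric map $\alpha\colon A\to B$ with $R^{\mathbf{A}}(a_1,\dots,a_n)=R^{\mathbf{B}}(\alpha(a_1),\dots,\alpha(a_n))$ for all $n$-ary $R\in\mathcal{L}$ and all $a_i\in A$. A substructure $\mathbf{B}\le\mathbf{A}$ is a structure with $B\subseteq A$ whose inclusion is a morphism. ${}^{\mathbf{A}}\mathbf{B}$ is the set of all morphisms $\mathbf{A}\to\mathbf{B}$, with metric $\rho_{\mathbf{A}}(\alpha,\beta)=\sup_{a\in A}d(\alpha(a),\beta(a))$. $\mathrm{Aut}(\mathbf{A})$ is the group of automorphisms of $\mathbf{A}$ with the topology of pointwise convergence. Fraïssé classes: $\mathbf{A}$ is homogeneous if for every $\epsilon>0$, every finite substructure $\mathbf{B}\le\mathbf{A}$ and every morphism $\beta\colon\mathbf{B}\to\mathbf{A}$ there is an automorphism $\alpha$ of $\mathbf{A}$ with $d(\alpha(b),\beta(b))<\epsilon$ for all $b\in B$. The age of $\mathbf{A}$ is the class of all finite $\mathcal{L}$-structures admitting a morphism to $\mathbf{A}$. Fraïssé classes of finite $\mathcal{L}$-structures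 are exactly the ages of homogeneous Polish $\mathcal{L}$-structures, and the Fraïssé limit of $\mathcal{K}$ is the (up to isomorphism unique) homogeneous Polish $\mathcal{L}$-structure whose age is $\mathcal{K}$. Matching number: for finite $\mathcal{L}$-structures $\mathbf{A},\mathbf{B},\mathbf{C}$, $\alpha,\beta\in{}^{\mathbf{A}}\mathbf{B}$, a map $\psi\colon F\to{}^{\mathbf{B}}\mathbf{C}$ with $F$ finite, $\phi\colon{}^{\mathbf{A}}\mathbf{C}\to\{0,\dots,k\}$ and $\epsilon>0$, $\mu(\psi,\alpha,\beta,\phi,\epsilon)$ is the maximal cardinality of the domain $D\subseteq F$ of an injective map $m\colon D\to F$ such that for each $\gamma\in D$ there is $i\in\{0,\dots,k\}$ with $\{\psi(\gamma)\circ\alpha,\ \psi(m(\gamma))\circ\beta\}\subseteq B_{\rho_{\mathbf{A}}}(\phi^{-1}(i),\epsilon)$, where $B_{\rho_{\mathbf{A}}}(Y,\epsilon)=\{\xi\in{}^{\mathbf{A}}\mathbf{C}:\exists\eta\in Y,\ \rho_{\mathbf{A}}(\xi,\eta)<\epsilon\}$. Amenability of a topological group $G$: a function $f\colon G\to\mathbb{R}$ is uniformly continuous for the right uniformity ($G_r$) if for every $\epsilon>0$ there is an identity neighborhood $U$ with $|f(x)-f(y)|\le\epsilon$ whenever $xy^{-1}\in U$; ${\rm UC}_b(G_r)$ is the space of bounded such functions. $G$ is amenable if there is a linear map $\nu\colon {\rm UC}_b(G_r)\to\mathbb{R}$ with $\inf_G f\le\nu(f)\le\sup_G f$ and $\nu(f\circ\lambda_G(g))=\nu(f)$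 for all $f\in{\rm UC}_b(G_r)$ and $g\in G$, where $\lambda_G(g)(x)=gx$. *)

theory Defs
  imports "HOL-Analysis.Analysis" "HOL-Algebra.Bij"
begin

section \<open>Languages and metric structures\<close>

record 'r language =
  symbols :: "'r set"
  arity :: "'r \<Rightarrow> nat"
  lipconst :: "'r \<Rightarrow> real"

definition language :: "'r language \<Rightarrow> bool" where
  "language L \<longleftrightarrow> (\<forall>R\<in>symbols L. 0 < arity L R \<and> 0 \<le> lipconst L R)"

text \<open>The \<open>n\<close>-tuples over a set are the lists of length \<open>n\<close> with entries in that set.\<close>

record ('a, 'r) lstructure =
  lmetric :: "'a metric"
  lrel :: "'r \<Rightarrow> 'a list \<Rightarrow> real"

abbreviation univ :: "('a, 'r, 'z) lstructure_scheme \<Rightarrow> 'a set" where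
  "univ A \<equiv> mspace (lmetric A)"

abbreviation ldist :: "('a, 'r, 'z) lstructure_scheme \<Rightarrow> 'a \<Rightarrow> 'a \<Rightarrow> real" where
  "ldist A \<equiv> mdist (lmetric A)"

definition tuples :: "'a set \<Rightarrow> nat \<Rightarrow> 'a list set" where
  "tuples X n = {xs. length xs = n \<and> set xs \<subseteq> X}"

definition sup_dist :: "'a metric \<Rightarrow> 'a list \<Rightarrow> 'a list \<Rightarrow> real" where
  "sup_dist m xs ys = (MAX i\<in>{..<length xs}. mdist m (xs ! i) (ys ! i))"

definition is_structure :: "'r language \<Rightarrow> ('a, 'r) lstructure \<Rightarrow> bool" where
  "is_structure L A \<longleftrightarrow> mcomplete_of (lmetric A) \<and>
     (\<forall>R\<in>symbols L. \<forall>xs\<in>tuples (univ A) (arity L R). \<forall>ys\<in>tuples (univ A) (arity L R).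
        \<bar>lrel A R xs - lrel A R ys\<bar> \<le> lipconst L R * sup_dist (lmetric A) xs ys)"

definition finite_structure :: "'r language \<Rightarrow> ('a, 'r) lstructure \<Rightarrow> bool" where
  "finite_structure L A \<longleftrightarrow> is_structure L A \<and> finite (univ A)"

definition polish_structure :: "'r language \<Rightarrow> ('a, 'r) lstructure \<Rightarrow> bool" where
  "polish_structure L A \<longleftrightarrow> is_structure L A \<and> separable_space (mtopology_of (lmetric A))"

section \<open>Morphisms\<close>

text \<open>Maps are extensional (undefined outside their domain), so that equality of morphisms is
  equality of maps on the domain; accordingly the composite of \<open>\<alpha>\<close> with domain \<open>A\<close> and \<open>\<gamma>\<close>
  is \<open>compose A \<gamma> \<alpha>\<close>.\<close>

definition Mor ::
    "'r language \<Rightarrow> ('a, 'r) lstructure \<Rightarrow> ('b, 'r) lstructure \<Rightarrow> ('a \<Rightarrow> 'b) set" where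
  "Mor L A B = {\<alpha> \<in> univ A \<rightarrow>\<^sub>E univ B.
     (\<forall>x\<in>univ A. \<forall>y\<in>univ A. ldist B (\<alpha> x) (\<alpha> y) = ldist A x y) \<and>
     (\<forall>R\<in>symbols L. \<forall>xs\<in>tuples (univ A) (arity L R). lrel B R (map \<alpha> xs) = lrel A R xs)}"

definition substructure ::
    "'r language \<Rightarrow> ('a, 'r) lstructure \<Rightarrow> ('a, 'r) lstructure \<Rightarrow> bool" where
  "substructure L B A \<longleftrightarrow> is_structure L B \<and> univ B \<subseteq> univ A \<and>
     (\<lambda>x\<in>univ B. x) \<in> Mor L B A"

text \<open>Intended for finite \<open>A\<close>; the supremum over the empty set is \<open>0\<close>.\<close>

definition rho :: "('a, 'r) lstructure \<Rightarrow> ('b, 'r) lstructure \<Rightarrow> ('a \<Rightarrow> 'b) \<Rightarrow> ('a \<Rightarrow> 'b) \<Rightarrow> real" where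
  "rho A B \<alpha> \<beta> = (if univ A = {} then 0 else (SUP a\<in>univ A. ldist B (\<alpha> a) (\<beta> a)))"

section \<open>The automorphism group\<close>

text \<open>Morphisms are isometric and preserve the relations exactly, so the inverse of a
  bijective one is again a morphism.\<close>

definition automorphisms :: "'r language \<Rightarrow> ('a, 'r) lstructure \<Rightarrow> ('a \<Rightarrow> 'a) set" where
  "automorphisms L A = {\<alpha> \<in> Mor L A A. bij_betw \<alpha> (univ A) (univ A)}"

definition Aut :: "'r language \<Rightarrow> ('a, 'r) lstructure \<Rightarrow> ('a \<Rightarrow> 'a) monoid" where
  "Aut L A = (BijGroup (univ A)) \<lparr>carrier := automorphisms L A\<rparr>"

definition Aut_topology :: "'r language \<Rightarrow> ('a, 'r) lstructure \<Rightarrow> ('a \<Rightarrow> 'a) topology" where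
  "Aut_topology L A =
     subtopology (product_topology (\<lambda>_. mtopology_of (lmetric A)) (univ A)) (automorphisms L A)"

section \<open>Homogeneity, age, Fraisse limits\<close>

definition homogeneous :: "'r language \<Rightarrow> ('a, 'r) lstructure \<Rightarrow> bool" where
  "homogeneous L A \<longleftrightarrow> (\<forall>\<epsilon>>0. \<forall>B. substructure L B A \<and> finite (univ B) \<longrightarrow>
     (\<forall>\<beta>\<in>Mor L B A. \<exists>\<alpha>\<in>automorphisms L A. \<forall>b\<in>univ B. ldist A (\<alpha> b) (\<beta> b) < \<epsilon>))"

text \<open>The age is taken among the structures whose elements come from the type \<open>'b\<close>. When
  \<open>'b\<close> is infinite, every finite structure has an isomorphic copy there, so this represents the
  whole (isomorphism-closed) class.\<close>

definition age :: "'r language \<Rightarrow> ('a, 'r) lstructure \<Rightarrow> ('b, 'r) lstructure set" where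
  "age L A = {B. finite_structure L B \<and> Mor L B A \<noteq> {}}"

text \<open>The Fraisse classes are exactly the ages of homogeneous Polish structures; hence the
  existence of \<open>K\<close> below says that \<open>\<K>\<close> is a Fraisse class.\<close>

definition fraisse_limit ::
    "'r language \<Rightarrow> ('b, 'r) lstructure set \<Rightarrow> ('a, 'r) lstructure \<Rightarrow> bool" where
  "fraisse_limit L \<K> K \<longleftrightarrow> polish_structure L K \<and> homogeneous L K \<and> age L K = \<K>"

section \<open>Matching number\<close>

definition rho_nbhd :: "'r language \<Rightarrow> ('a, 'r) lstructure \<Rightarrow> ('b, 'r) lstructure \<Rightarrow>
    ('a \<Rightarrow> 'b) set \<Rightarrow> real \<Rightarrow> ('a \<Rightarrow> 'b) set" where
  "rho_nbhd L A C Y \<epsilon> = {\<xi> \<in> Mor L A C. \<exists>\<eta>\<in>Y. rho A C \<xi> \<eta> < \<epsilon>}"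

definition matching_number :: "'r language \<Rightarrow> ('a, 'r) lstructure \<Rightarrow> ('c, 'r) lstructure \<Rightarrow> nat \<Rightarrow>
    'f set \<Rightarrow> ('f \<Rightarrow> 'b \<Rightarrow> 'c) \<Rightarrow> ('a \<Rightarrow> 'b) \<Rightarrow> ('a \<Rightarrow> 'b) \<Rightarrow> (('a \<Rightarrow> 'c) \<Rightarrow> nat) \<Rightarrow> real \<Rightarrow> nat" where
  "matching_number L A C k F \<psi> \<alpha> \<beta> \<phi> \<epsilon> = Max {card D | D. D \<subseteq> F \<and>
     (\<exists>m. m \<in> D \<rightarrow> F \<and> inj_on m D \<and>
       (\<forall>\<gamma>\<in>D. \<exists>i\<in>{0..k}.
          {compose (univ A) (\<psi> \<gamma>) \<alpha>, compose (univ A) (\<psi> (m \<gamma>)) \<beta>}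
            \<subseteq> rho_nbhd L A C {\<eta> \<in> Mor L A C. \<phi> \<eta> = i} \<epsilon>))}"

section \<open>Amenability\<close>

text \<open>In the following, \<open>T\<close> is a group topology on \<open>G\<close>. Functions on \<open>G\<close> are extensional; \<open>U\<close>
  is an identity neighborhood iff the identity lies in its interior.\<close>

definition UCb_right :: "('g, 'm) monoid_scheme \<Rightarrow> 'g topology \<Rightarrow> ('g \<Rightarrow> real) set" where
  "UCb_right G T = {f \<in> extensional (carrier G). bounded (f ` carrier G) \<and>
     (\<forall>\<epsilon>>0. \<exists>U. \<one>\<^bsub>G\<^esub> \<in> T interior_of U \<and>
        (\<forall>x\<in>carrier G. \<forall>y\<in>carrier G. x \<otimes>\<^bsub>G\<^esub> inv\<^bsub>G\<^esub> y \<in> U \<longrightarrow> \<bar>f x - f y\<bar> \<le> \<epsilon>))}"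

definition amenable :: "('g, 'm) monoid_scheme \<Rightarrow> 'g topology \<Rightarrow> bool" where
  "amenable G T \<longleftrightarrow> (\<exists>\<nu> :: ('g \<Rightarrow> real) \<Rightarrow> real.
     (\<forall>f\<in>UCb_right G T. \<forall>h\<in>UCb_right G T. \<nu> (\<lambda>x\<in>carrier G. f x + h x) = \<nu> f + \<nu> h) \<and>
     (\<forall>f\<in>UCb_right G T. \<forall>c. \<nu> (\<lambda>x\<in>carrier G. c * f x) = c * \<nu> f) \<and>
     (\<forall>f\<in>UCb_right G T. (INF x\<in>carrier G. f x) \<le> \<nu> f \<and> \<nu> f \<le> (SUP x\<in>carrier G. f x)) \<and>
     (\<forall>f\<in>UCb_right G T. \<forall>g\<in>carrier G. \<nu> (\<lambda>x\<in>carrier G. f (g \<otimes>\<^bsub>G\<^esub> x)) = \<nu> f))"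

end

theory Submission
  imports Defs
begin

text \<open>Let \<open>G\<close> be the automorphism group of \<open>K\<close>. A right uniformly continuous function of \<open>x\<close> is
  one that is controlled by the restriction of \<open>x\<inverse>\<close> to a finite subset of \<open>K\<close>, that is, by an
  embedding of a finite structure into \<open>K\<close>; passing from \<open>f\<close> to its translate \<open>x \<mapsto> f (g x)\<close>
  precomposes that embedding with \<open>g\<inverse>\<close>. A mean is a positive normalised linear functional on these
  functions.

  From amenability to matchings. Hall's theorem turns the matching for a colouring \<open>\<phi>\<close> into a
  comparison of averages: for every set \<open>I\<close> of colours, the function
  \<open>max 0 (1 - \<rho>(_, \<phi>\<inverse>(I)) / \<epsilon>)\<close> must have nearly the same average over the copies \<open>\<psi> \<gamma> \<circ> \<alpha>\<close> as
  over the copies \<open>\<psi> \<gamma> \<circ> \<beta>\<close> (\<open>matchings_of_amenable\<close>). For one such family of functions, an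
  approximation of an invariant mean by a finite average provides \<open>\<psi>\<close> (\<open>averaging_copies\<close>). The same
  \<open>\<psi>\<close> serves all nearby families, and the families of Lipschitz functions form a compact space, so
  finitely many \<open>\<psi>\<close> serve for all of them; \<open>C\<close> is spanned by the images of these finitely many
  maps, and therefore does not depend on \<open>\<phi>\<close>.

  From matchings to amenability. Two colours control one threshold of one function \<open>f\<close> only: colouring
  by \<open>f > 1/2\<close> yields a mean for which the event \<open>f > 13/20\<close> on any translate is at most as likely
  as the event \<open>f \<ge> 7/20\<close> on any other (\<open>samples_of_matchings\<close>, \<open>levels_of_samples\<close>). This is far
  from invariance, but there is a constant between the two likelihoods, and so the property survives
  convolution with an arbitrary second mean. It bounds the variation of the mean of \<open>f\<close> over
  all translates by \<open>7/10\<close> (\<open>balanced_of_levels\<close>). Convolving one mean after the other, one treats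
  finitely many functions, each threshold being taken for the average of the next function under the
  mean that was built so far (\<open>simultaneously_balanced\<close>). By compactness there is a mean no two
  translates of which differ by more than \<open>7/10\<close> on a function with values in \<open>[0, 1]\<close>
  (\<open>overlapping_mean\<close>).

  A mean with this weak property already forces an invariant mean. Regarded as measures, any two
  translates have at least \<open>3/10\<close> of their mass in common, so the square roots of their densities
  are unit vectors in a Hilbert space, with inner products at least \<open>3/10\<close>, that \<open>G\<close> permutes
  isometrically. The shortest vector of their closed convex hull is invariant and not zero, and its
  square is the density of an invariant measure. The proof of \<open>invariant_mean_of_overlap\<close> follows this
  argument without constructing measures: the integral of \<open>f\<close> against the square of an
  average of half densities is the infimum, over the decompositions of \<open>f\<close> into finitely many
  nonnegative functions \<open>e\<close>, of the sum of the squares of the averages of \<open>sqrt (\<nu> e\<^sup>h)\<close>, where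
  \<open>e\<^sup>h\<close> runs through translates of \<open>e\<close>.\<close>

section \<open>Means on a lattice of functions\<close>

lemma compact_box:
  fixes a b :: "'i \<Rightarrow> real"
  shows "compact {\<nu>. \<forall>i. \<nu> i \<in> {a i..b i}}"
proof -
  have "compactin (product_topology (\<lambda>_. euclidean) UNIV) (PiE UNIV (\<lambda>i. {a i..b i}))"
    by (simp add: compactin_PiE)
  moreover have "PiE UNIV (\<lambda>i. {a i..b i}) = {\<nu>. \<forall>i. \<nu> i \<in> {a i..b i}}"
    by (auto simp: PiE_def Pi_def)
  ultimately show ?thesis
    by (simp add: euclidean_product_topology)
qed

text \<open>Additivity, homogeneity and positivity are only required on \<open>U\<close>, and positivity only looks at
  \<open>X\<close>. So the functions need not be normalised off \<open>X\<close>: a mean does not see their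
  values there (\<open>mean_cong\<close> below).\<close>

definition means :: "'g set \<Rightarrow> ('g \<Rightarrow> real) set \<Rightarrow> (('g \<Rightarrow> real) \<Rightarrow> real) set" where
  "means X U = {\<nu>.
     (\<forall>f\<in>U. \<forall>h\<in>U. \<nu> (\<lambda>x. f x + h x) = \<nu> f + \<nu> h) \<and>
     (\<forall>f\<in>U. \<forall>c. \<nu> (\<lambda>x. c * f x) = c * \<nu> f) \<and>
     (\<forall>f\<in>U. (\<forall>x\<in>X. 0 \<le> f x) \<longrightarrow> 0 \<le> \<nu> f) \<and> \<nu> (\<lambda>_. 1) = 1}"

locale function_lattice =
  fixes X :: "'g set" and U :: "('g \<Rightarrow> real) set"
  assumes nonempty: "X \<noteq> {}"
    and cong_closed: "f \<in> U \<Longrightarrow> (\<And>x. x \<in> X \<Longrightarrow> h x = f x) \<Longrightarrow> h \<in> U"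
    and bounded_on: "f \<in> U \<Longrightarrow> \<exists>c. \<forall>x\<in>X. \<bar>f x\<bar> \<le> c"
    and const_closed [simp]: "(\<lambda>_. c) \<in> U"
    and add_closed: "f \<in> U \<Longrightarrow> h \<in> U \<Longrightarrow> (\<lambda>x. f x + h x) \<in> U"
    and scale_closed: "f \<in> U \<Longrightarrow> (\<lambda>x. c * f x) \<in> U"
    and min_closed: "f \<in> U \<Longrightarrow> h \<in> U \<Longrightarrow> (\<lambda>x. min (f x) (h x)) \<in> U"
begin

lemma diff_closed: "f \<in> U \<Longrightarrow> h \<in> U \<Longrightarrow> (\<lambda>x. f x - h x) \<in> U"
  using add_closed[OF _ scale_closed, of f h "-1"] by simp

lemma max_closed: "f \<in> U \<Longrightarrow> h \<in> U \<Longrightarrow> (\<lambda>x. max (f x) (h x)) \<in> U"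
proof -
  assume fh: "f \<in> U" "h \<in> U"
  have "(\<lambda>x. f x + h x - min (f x) (h x)) \<in> U"
    using fh by (intro diff_closed add_closed min_closed)
  moreover have "(\<lambda>x. f x + h x - min (f x) (h x)) = (\<lambda>x. max (f x) (h x))"
    by (auto simp: min_def max_def)
  ultimately show ?thesis by simp
qed

lemma sum_list_in: "set E \<subseteq> U \<Longrightarrow> (\<lambda>x. \<Sum>e\<leftarrow>E. e x) \<in> U"
  by (induction E) (auto intro: add_closed)

lemma sum_in: "finite J \<Longrightarrow> (\<And>j. j \<in> J \<Longrightarrow> f j \<in> U) \<Longrightarrow> (\<lambda>x. \<Sum>j\<in>J. f j x) \<in> U"
  by (induction J rule: finite_induct) (auto intro: add_closed)

lemma sup_bound:
  assumes "f \<in> U" obtains c where "0 \<le> c" "\<And>x. x \<in> X \<Longrightarrow> \<bar>f x\<bar> \<le> c"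
proof -
  obtain c where "\<forall>x\<in>X. \<bar>f x\<bar> \<le> c" using bounded_on assms by blast
  then show ?thesis using that[of "max c 0"] by fastforce
qed

context
  fixes \<nu> assumes \<nu>: "\<nu> \<in> means X U"
begin

lemma mean_add: "f \<in> U \<Longrightarrow> h \<in> U \<Longrightarrow> \<nu> (\<lambda>x. f x + h x) = \<nu> f + \<nu> h"
  using \<nu> by (simp add: means_def)

lemma mean_scale: "f \<in> U \<Longrightarrow> \<nu> (\<lambda>x. c * f x) = c * \<nu> f"
  using \<nu> by (simp add: means_def)

lemma mean_nonneg: "f \<in> U \<Longrightarrow> (\<And>x. x \<in> X \<Longrightarrow> 0 \<le> f x) \<Longrightarrow> 0 \<le> \<nu> f"
  using \<nu> by (simp add: means_def)

lemma mean_const: "\<nu> (\<lambda>_. c) = c"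
  using mean_scale[of "\<lambda>_. 1" c] \<nu> by (simp add: means_def)

lemma mean_diff: "f \<in> U \<Longrightarrow> h \<in> U \<Longrightarrow> \<nu> (\<lambda>x. f x - h x) = \<nu> f - \<nu> h"
  using mean_add[OF _ scale_closed, of f h "-1"] mean_scale[of h "-1"] by simp

lemma mean_mono:
  assumes "f \<in> U" "h \<in> U" "\<And>x. x \<in> X \<Longrightarrow> f x \<le> h x"
  shows "\<nu> f \<le> \<nu> h"
  using mean_nonneg[OF diff_closed[OF assms(2,1)]] mean_diff[OF assms(2,1)] assms(3) by simp

lemma mean_cong:
  assumes "f \<in> U" "\<And>x. x \<in> X \<Longrightarrow> h x = f x"
  shows "\<nu> h = \<nu> f"
  using assms cong_closed[OF assms] by (intro antisym mean_mono) auto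

lemma mean_bound:
  assumes "f \<in> U" "\<And>x. x \<in> X \<Longrightarrow> \<bar>f x\<bar> \<le> c"
  shows "\<bar>\<nu> f\<bar> \<le> c"
proof -
  have "\<nu> (\<lambda>_. -c) \<le> \<nu> f" "\<nu> f \<le> \<nu> (\<lambda>_. c)"
    using assms by (auto intro!: mean_mono simp: abs_le_iff) fastforce
  then show ?thesis by (simp add: mean_const abs_le_iff)
qed

lemma mean_sum_list: "set E \<subseteq> U \<Longrightarrow> \<nu> (\<lambda>x. \<Sum>e\<leftarrow>E. e x) = (\<Sum>e\<leftarrow>E. \<nu> e)"
  by (induction E) (auto simp: mean_const mean_add sum_list_in)

lemma mean_sum:
  "finite J \<Longrightarrow> (\<And>j. j \<in> J \<Longrightarrow> f j \<in> U) \<Longrightarrow> \<nu> (\<lambda>x. \<Sum>j\<in>J. f j x) = (\<Sum>j\<in>J. \<nu> (f j))"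
  by (induction J rule: finite_induct) (auto simp: mean_const mean_add sum_in)

end

lemma finite_average_mean:
  assumes "finite F" "F \<noteq> {}" "\<And>i. i \<in> F \<Longrightarrow> x i \<in> X"
  shows "(\<lambda>f. (\<Sum>i\<in>F. f (x i)) / real (card F)) \<in> means X U"
  using assms by (auto simp: means_def sum.distrib add_divide_distrib sum_distrib_left
      intro!: divide_nonneg_nonneg sum_nonneg)

lemma evaluation_mean: "x \<in> X \<Longrightarrow> (\<lambda>f. f x) \<in> means X U"
  by (auto simp: means_def)

text \<open>This is weak-* compactness of the set of means, in the form in which it is used: comparisons
  between values of a mean are closed conditions, so any family of them that is finitely
  satisfiable is satisfiable.\<close>

lemma means_compactness:
  assumes R: "\<And>f h c. (f, h, c) \<in> R \<Longrightarrow> f \<in> U \<and> h \<in> U"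
    and fin: "\<And>R'. finite R' \<Longrightarrow> R' \<subseteq> R \<Longrightarrow>
       \<exists>\<nu>\<in>means X U. \<forall>(f, h, c)\<in>R'. \<nu> f \<le> \<nu> h + c"
  shows "\<exists>\<nu>\<in>means X U. \<forall>(f, h, c)\<in>R. \<nu> f \<le> \<nu> h + c"
proof -
  obtain b where b: "\<And>f x. f \<in> U \<Longrightarrow> x \<in> X \<Longrightarrow> \<bar>f x\<bar> \<le> b f"
    using bounded_on by metis
  \<comment> \<open>Fixing the values off \<open>U\<close> at \<open>0\<close> puts all means into one compact box.\<close>
  define a where "a = (\<lambda>f. if f \<in> U then b f else 0)"
  define S where "S = {\<nu>. \<forall>f. \<nu> f \<in> {- a f..a f}}"
  define \<C> where "\<C> =
     ((\<lambda>(f, h). {\<nu>::('g \<Rightarrow> real) \<Rightarrow> real. \<nu> (\<lambda>x. f x + h x) = \<nu> f + \<nu> h}) ` (U \<times> U)) \<union>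
     ((\<lambda>(f, c). {\<nu>. \<nu> (\<lambda>x. c * f x) = c * \<nu> f}) ` (U \<times> UNIV)) \<union>
     ((\<lambda>f. {\<nu>. 0 \<le> \<nu> f}) ` {f\<in>U. \<forall>x\<in>X. 0 \<le> f x}) \<union> {{\<nu>. \<nu> (\<lambda>_. 1) = 1}}"
  define D where "D = (\<lambda>(f, h, c). {\<nu>::('g \<Rightarrow> real) \<Rightarrow> real. \<nu> f \<le> \<nu> h + c})"
  have means: "means X U = \<Inter>\<C>"
    unfolding means_def \<C>_def by (auto simp: Ball_def)
  have "S \<inter> \<Inter>(\<C> \<union> D ` R) \<noteq> {}"
  proof (rule compact_imp_fip)
    show "compact S" unfolding S_def by (rule compact_box)
  next
    note cont = continuous_on_product_coordinates continuous_on_add continuous_on_mult continuous_on_const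
    have "closed {\<nu>::('g \<Rightarrow> real) \<Rightarrow> real. \<nu> f = \<nu> h + \<nu> u}"
         "closed {\<nu>::('g \<Rightarrow> real) \<Rightarrow> real. \<nu> f = c * \<nu> h}"
         "closed {\<nu>::('g \<Rightarrow> real) \<Rightarrow> real. 0 \<le> \<nu> f}"
         "closed {\<nu>::('g \<Rightarrow> real) \<Rightarrow> real. \<nu> f = c}"
         "closed {\<nu>::('g \<Rightarrow> real) \<Rightarrow> real. \<nu> f \<le> \<nu> h + c}" for f h u c
      by (intro closed_Collect_eq closed_Collect_le cont)+
    moreover fix T assume "T \<in> \<C> \<union> D ` R"
    ultimately show "closed T"
      unfolding \<C>_def D_def by fast
  next
    fix \<F> assume F: "finite \<F>" "\<F> \<subseteq> \<C> \<union> D ` R"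
    have "finite (\<F> \<inter> D ` R)" "\<F> \<inter> D ` R \<subseteq> D ` R" using F(1) by auto
    then obtain R' where R': "R' \<subseteq> R" "finite R'" "\<F> \<inter> D ` R = D ` R'"
      by (meson finite_subset_image)
    obtain \<nu> where \<nu>: "\<nu> \<in> means X U" "\<forall>(f, h, c)\<in>R'. \<nu> f \<le> \<nu> h + c"
      using fin[OF R'(2,1)] by blast
    define \<nu>' where "\<nu>' = (\<lambda>f. if f \<in> U then \<nu> f else 0)"
    have "\<bar>\<nu> f\<bar> \<le> b f" if "f \<in> U" for f
      using mean_bound[OF \<nu>(1) that b] that by blast
    then have "\<nu>' \<in> S"
      unfolding S_def \<nu>'_def a_def by (auto simp: abs_le_iff minus_le_iff)
    moreover have "\<nu>' \<in> means X U"
      using \<nu>(1) add_closed scale_closed unfolding means_def \<nu>'_def by auto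
    moreover have "\<nu>' \<in> T" if "T \<in> \<F> \<inter> D ` R" for T
    proof -
      have "T \<in> D ` R'" using that R'(3) by blast
      then obtain f h c where "(f, h, c) \<in> R'" "T = {\<nu>. \<nu> f \<le> \<nu> h + c}"
        by (auto simp: D_def)
      then show ?thesis
        using \<nu>(2) R R'(1) unfolding \<nu>'_def by auto
    qed
    ultimately show "S \<inter> \<Inter>\<F> \<noteq> {}"
      using F(2) unfolding means by blast
  qed
  then obtain \<nu> where "\<nu> \<in> \<Inter>\<C>" "\<nu> \<in> \<Inter>(D ` R)" by blast
  then show ?thesis unfolding means[symmetric] D_def by (intro bexI[of _ \<nu>]) auto
qed

end

section \<open>Convolution and means that cannot separate translates\<close>

text \<open>The second assumption is what convolution of means needs. It holds for the right uniformity because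
  right translations, unlike left translations, are uniformly equicontinuous for it.\<close>

locale translation_lattice = group G + function_lattice "carrier G" U
  for G :: "('g, 'm) monoid_scheme" (structure) and U +
  assumes translate: "f \<in> U \<Longrightarrow> g \<in> carrier G \<Longrightarrow> (\<lambda>x. f (g \<otimes> x)) \<in> U"
    and average: "\<nu> \<in> means (carrier G) U \<Longrightarrow> f \<in> U \<Longrightarrow> (\<lambda>x. \<nu> (\<lambda>y. f (x \<otimes> y))) \<in> U"
begin

abbreviation M :: "(('g \<Rightarrow> real) \<Rightarrow> real) set" where
  "M \<equiv> means (carrier G) U"

lemma mean_translate_twice:
  assumes "\<nu> \<in> M" "f \<in> U" "g \<in> carrier G" "h \<in> carrier G"
  shows "\<nu> (\<lambda>x. f (g \<otimes> (h \<otimes> x))) = \<nu> (\<lambda>x. f (g \<otimes> h \<otimes> x))"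
proof (rule mean_cong[OF assms(1)])
  show "(\<lambda>x. f (g \<otimes> h \<otimes> x)) \<in> U"
    using assms by (simp add: translate)
qed (use assms in \<open>auto simp: m_assoc\<close>)

text \<open>As a measure, this is the law of \<open>x y\<close> for independent \<open>x\<close> with law \<open>\<kappa>\<close> and \<open>y\<close> with
  law \<open>\<mu>\<close>.\<close>

definition conv :: "(('g \<Rightarrow> real) \<Rightarrow> real) \<Rightarrow> (('g \<Rightarrow> real) \<Rightarrow> real) \<Rightarrow> ('g \<Rightarrow> real) \<Rightarrow> real" where
  "conv \<mu> \<kappa> = (\<lambda>f. \<kappa> (\<lambda>x. \<mu> (\<lambda>y. f (x \<otimes> y))))"

lemma conv_mean:
  assumes \<mu>: "\<mu> \<in> M" and \<kappa>: "\<kappa> \<in> M"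
  shows "conv \<mu> \<kappa> \<in> M"
proof -
  have "conv \<mu> \<kappa> (\<lambda>x. f x + h x) = conv \<mu> \<kappa> f + conv \<mu> \<kappa> h" if "f \<in> U" "h \<in> U" for f h
  proof -
    have "conv \<mu> \<kappa> (\<lambda>x. f x + h x) = \<kappa> (\<lambda>x. \<mu> (\<lambda>y. f (x \<otimes> y)) + \<mu> (\<lambda>y. h (x \<otimes> y)))"
      unfolding conv_def using that \<mu>
      by (intro mean_cong[OF \<kappa> add_closed[OF average average]]) (simp_all add: mean_add[OF \<mu>] translate[OF that(1)] translate[OF that(2)])
    then show ?thesis
      using that \<mu> by (simp add: conv_def mean_add[OF \<kappa>] average)
  qed
  moreover have "conv \<mu> \<kappa> (\<lambda>x. c * f x) = c * conv \<mu> \<kappa> f" if "f \<in> U" for f c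
  proof -
    have "conv \<mu> \<kappa> (\<lambda>x. c * f x) = \<kappa> (\<lambda>x. c * \<mu> (\<lambda>y. f (x \<otimes> y)))"
      unfolding conv_def using that \<mu>
      by (intro mean_cong[OF \<kappa> scale_closed[OF average]]) (simp_all add: mean_scale[OF \<mu>] translate[OF that])
    then show ?thesis
      using that \<mu> by (simp add: conv_def mean_scale[OF \<kappa>] average)
  qed
  moreover have "0 \<le> conv \<mu> \<kappa> f" if "f \<in> U" "\<forall>x\<in>carrier G. 0 \<le> f x" for f
    unfolding conv_def using that \<mu>
    by (intro mean_nonneg[OF \<kappa> average] mean_nonneg[OF \<mu> translate]) auto
  moreover have "conv \<mu> \<kappa> (\<lambda>_. 1) = 1"
    using \<mu> \<kappa> by (simp add: conv_def mean_const)
  ultimately show ?thesis by (simp add: means_def)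
qed

definition unit_valued :: "('g \<Rightarrow> real) set" where
  "unit_valued = {f \<in> U. \<forall>x\<in>carrier G. 0 \<le> f x \<and> f x \<le> 1}"

text \<open>The quantifier over \<open>\<kappa>\<close> makes the property hereditary: it passes from \<open>\<mu>\<close> to \<open>conv \<mu> \<kappa>\<close>.
  This is why finitely many functions can be treated one after the other.\<close>

definition balanced :: "(('g \<Rightarrow> real) \<Rightarrow> real) \<Rightarrow> ('g \<Rightarrow> real) \<Rightarrow> bool" where
  "balanced \<mu> f \<longleftrightarrow> (\<forall>\<kappa>\<in>M. \<forall>g\<in>carrier G. \<forall>h\<in>carrier G.
     conv \<mu> \<kappa> (\<lambda>x. f (g \<otimes> x)) \<le> conv \<mu> \<kappa> (\<lambda>x. f (h \<otimes> x)) + 7/10)"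

text \<open>Continuous substitutes for the indicators of \<open>f > 13/20\<close> and \<open>f \<ge> 7/20\<close>: the first
  function lies below the former indicator, the second above the latter.\<close>

definition upper_level :: "('g \<Rightarrow> real) \<Rightarrow> 'g \<Rightarrow> real" where
  "upper_level f x = min 1 (max 0 (20 * f x - 13))"

definition lower_level :: "('g \<Rightarrow> real) \<Rightarrow> 'g \<Rightarrow> real" where
  "lower_level f x = min 1 (max 0 (20 * f x - 6))"

lemma levels_in: "f \<in> U \<Longrightarrow> upper_level f \<in> U" "f \<in> U \<Longrightarrow> lower_level f \<in> U"
  unfolding upper_level_def[abs_def] lower_level_def[abs_def]
  by (simp_all add: min_closed max_closed diff_closed scale_closed)

text \<open>Pointwise, the two level functions bound \<open>f\<close> from either side, at the cost of \<open>7/10\<close>: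
  \<open>3/10 * lower_level f \<le> f \<le> 7/10 + 3/10 * upper_level f\<close>.\<close>

lemma balanced_of_levels:
  assumes f: "f \<in> unit_valued" and \<mu>: "\<mu> \<in> M"
    and le: "\<And>g h. g \<in> carrier G \<Longrightarrow> h \<in> carrier G \<Longrightarrow>
      \<mu> (\<lambda>x. upper_level f (g \<otimes> x)) \<le> \<mu> (\<lambda>x. lower_level f (h \<otimes> x))"
  shows "balanced \<mu> f"
  unfolding balanced_def
proof (intro ballI)
  fix \<kappa> g h assume \<kappa>: "\<kappa> \<in> M" and gh: "g \<in> carrier G" "h \<in> carrier G"
  have fU: "f \<in> U" using f by (simp add: unit_valued_def)
  note U = fU levels_in[OF fU]
  let ?m = "conv \<mu> \<kappa>"
  have m: "?m \<in> M" using \<mu> \<kappa> by (rule conv_mean)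
  \<comment> \<open>The constant \<open>c\<close> lies between the two level functions for all translates at once, so it
    survives averaging over translates.\<close>
  define c where "c = (INF h\<in>carrier G. \<mu> (\<lambda>x. lower_level f (h \<otimes> x)))"
  have bdd: "bdd_below ((\<lambda>h. \<mu> (\<lambda>x. lower_level f (h \<otimes> x))) ` carrier G)"
    using le[OF one_closed] by (intro bdd_belowI2) auto
  have up: "\<mu> (\<lambda>x. upper_level f (g \<otimes> x)) \<le> c" if "g \<in> carrier G" for g
    unfolding c_def using le that by (intro cINF_greatest) auto
  have low: "c \<le> \<mu> (\<lambda>x. lower_level f (h \<otimes> x))" if "h \<in> carrier G" for h
    unfolding c_def using bdd that by (rule cINF_lower)
  have "?m (\<lambda>x. upper_level f (g \<otimes> x)) \<le> \<kappa> (\<lambda>_. c)"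
    unfolding conv_def using gh \<mu> up
    by (intro mean_mono[OF \<kappa> average[OF \<mu> translate[OF U(2)]] const_closed])
      (simp_all add: mean_translate_twice[OF \<mu> U(2)])
  then have 1: "?m (\<lambda>x. upper_level f (g \<otimes> x)) \<le> c" using \<kappa> by (simp add: mean_const)
  have "\<kappa> (\<lambda>_. c) \<le> ?m (\<lambda>x. lower_level f (h \<otimes> x))"
    unfolding conv_def using gh \<mu> low
    by (intro mean_mono[OF \<kappa> const_closed average[OF \<mu> translate[OF U(3)]]])
      (simp_all add: mean_translate_twice[OF \<mu> U(3)])
  then have 2: "c \<le> ?m (\<lambda>x. lower_level f (h \<otimes> x))" using \<kappa> by (simp add: mean_const)
  have range: "0 \<le> f x \<and> f x \<le> 1" if "x \<in> carrier G" for x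
    using f that by (simp add: unit_valued_def)
  have tr: "(\<lambda>x. u (a \<otimes> x)) \<in> U" if "u \<in> {f, upper_level f, lower_level f}" "a \<in> {g, h}" for u a
    using that U gh translate by blast
  have "?m (\<lambda>x. f (g \<otimes> x)) \<le> ?m (\<lambda>x. 7/10 + 3/10 * upper_level f (g \<otimes> x))"
  proof (rule mean_mono[OF m])
    fix x assume "x \<in> carrier G"
    then show "f (g \<otimes> x) \<le> 7/10 + 3/10 * upper_level f (g \<otimes> x)"
      using range[of "g \<otimes> x"] gh 
      by (cases "20 * f (g \<otimes> x) \<le> 13"; cases "20 * f (g \<otimes> x) \<ge> 14") (simp_all add: upper_level_def field_simps)
  qed (intro add_closed const_closed scale_closed tr; simp)+
  also have "\<dots> = ?m (\<lambda>_. 7/10) + ?m (\<lambda>x. 3/10 * upper_level f (g \<otimes> x))"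
    by (intro mean_add[OF m] const_closed scale_closed tr) simp_all
  also have "\<dots> = 7/10 + 3/10 * ?m (\<lambda>x. upper_level f (g \<otimes> x))"
    by (subst mean_scale[OF m]) (simp_all add: tr mean_const[OF m])
  also have "\<dots> \<le> 7/10 + 3/10 * ?m (\<lambda>x. lower_level f (h \<otimes> x))"
    using 1 2 by simp
  also have "\<dots> = 7/10 + ?m (\<lambda>x. 3/10 * lower_level f (h \<otimes> x))"
    by (subst mean_scale[OF m]) (simp_all add: tr)
  also have "?m (\<lambda>x. 3/10 * lower_level f (h \<otimes> x)) \<le> ?m (\<lambda>x. f (h \<otimes> x))"
  proof (rule mean_mono[OF m])
    fix x assume "x \<in> carrier G"
    then show "3/10 * lower_level f (h \<otimes> x) \<le> f (h \<otimes> x)"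
      using range[of "h \<otimes> x"] gh 
      by (cases "20 * f (h \<otimes> x) \<le> 6"; cases "20 * f (h \<otimes> x) \<ge> 7") (simp_all add: lower_level_def field_simps)
  qed (intro scale_closed tr; simp)+
  finally show "?m (\<lambda>x. f (g \<otimes> x)) \<le> ?m (\<lambda>x. f (h \<otimes> x)) + 7/10" by simp
qed

text \<open>If \<open>\<nu>\<close> balances the functions in \<open>\<F>\<close> and \<open>\<mu>\<close> balances the average
  \<open>x \<mapsto> \<nu> (f\<^sup>x)\<close> of one more function \<open>f\<close>, then \<open>conv \<nu> \<mu>\<close> balances all of them.\<close>

lemma simultaneously_balanced:
  assumes single: "\<And>f. f \<in> unit_valued \<Longrightarrow> \<exists>\<mu>\<in>M. balanced \<mu> f"
    and "finite \<F>" "\<F> \<subseteq> unit_valued"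
  shows "\<exists>\<nu>\<in>M. \<forall>f\<in>\<F>. balanced \<nu> f"
  using assms(2,3)
proof (induction \<F> rule: finite_induct)
  case empty
  then show ?case using evaluation_mean[OF one_closed] by auto
next
  case (insert f \<F>)
  then obtain \<nu> where \<nu>: "\<nu> \<in> M" "\<And>f. f \<in> \<F> \<Longrightarrow> balanced \<nu> f" by auto
  have fU: "f \<in> U" and range: "\<And>x. x \<in> carrier G \<Longrightarrow> 0 \<le> f x \<and> f x \<le> 1"
    using insert.prems by (auto simp: unit_valued_def)
  define f' where "f' = (\<lambda>x. \<nu> (\<lambda>y. f (x \<otimes> y)))"
  have "\<nu> (\<lambda>y. f (x \<otimes> y)) \<le> \<nu> (\<lambda>_. 1)" "0 \<le> \<nu> (\<lambda>y. f (x \<otimes> y))" if "x \<in> carrier G" for x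
    using that range by (simp_all add: mean_mono[OF \<nu>(1)] mean_nonneg[OF \<nu>(1)] translate[OF fU])
  then have "f' \<in> unit_valued"
    using average[OF \<nu>(1) fU] \<nu>(1) by (auto simp: unit_valued_def f'_def mean_const)
  then obtain \<mu> where \<mu>: "\<mu> \<in> M" "balanced \<mu> f'" using single by blast
  have assoc: "conv (conv \<nu> \<mu>) \<kappa> u = conv \<nu> (conv \<mu> \<kappa>) u" if \<kappa>: "\<kappa> \<in> M" and u: "u \<in> U" for \<kappa> u
  proof -
    have "\<mu> (\<lambda>y. \<nu> (\<lambda>z. u (x \<otimes> (y \<otimes> z)))) = \<mu> (\<lambda>y. \<nu> (\<lambda>z. u (x \<otimes> y \<otimes> z)))"
      if "x \<in> carrier G" for x
      using that translate[OF average[OF \<nu>(1) u]]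
      by (intro mean_cong[OF \<mu>(1)]) (simp_all add: mean_translate_twice[OF \<nu>(1) u])
    then show ?thesis
      using average[OF \<mu>(1) average[OF \<nu>(1) u]] unfolding conv_def
      by (intro mean_cong[OF \<kappa>]) auto
  qed
  have new: "conv \<nu> \<kappa> (\<lambda>x. f (g \<otimes> x)) = \<kappa> (\<lambda>x. f' (g \<otimes> x))"
    if "\<kappa> \<in> M" "g \<in> carrier G" for \<kappa> g
    unfolding conv_def f'_def
    using that(2) translate[OF average[OF \<nu>(1) fU] that(2)]
    by (intro mean_cong[OF that(1)]) (simp_all add: mean_translate_twice[OF \<nu>(1) fU])
  have "balanced (conv \<nu> \<mu>) h" if "h \<in> insert f \<F>" for h
    unfolding balanced_def
  proof (intro ballI)
    fix \<kappa> a b assume *: "\<kappa> \<in> M" "a \<in> carrier G" "b \<in> carrier G"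
    have hU: "h \<in> U" using that insert.prems by (auto simp: unit_valued_def)
    have \<mu>\<kappa>: "conv \<mu> \<kappa> \<in> M" using \<mu>(1) *(1) by (rule conv_mean)
    have "conv \<nu> (conv \<mu> \<kappa>) (\<lambda>x. h (a \<otimes> x)) \<le> conv \<nu> (conv \<mu> \<kappa>) (\<lambda>x. h (b \<otimes> x)) + 7/10"
    proof (cases "h = f")
      case True
      then show ?thesis
        using \<mu>(2) * unfolding balanced_def by (simp add: new[OF \<mu>\<kappa>])
    next
      case False
      then show ?thesis
        using \<nu>(2) that * \<mu>\<kappa> unfolding balanced_def by blast
    qed
    then show "conv (conv \<nu> \<mu>) \<kappa> (\<lambda>x. h (a \<otimes> x)) \<le> conv (conv \<nu> \<mu>) \<kappa> (\<lambda>x. h (b \<otimes> x)) + 7/10"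
      using assoc[OF *(1) translate[OF hU]] * by simp
  qed
  then show ?case using conv_mean[OF \<nu>(1) \<mu>(1)] by blast
qed

lemma overlapping_mean:
  assumes single: "\<And>f. f \<in> unit_valued \<Longrightarrow> \<exists>\<mu>\<in>M. balanced \<mu> f"
  shows "\<exists>\<nu>\<in>M. \<forall>f\<in>unit_valued. \<forall>g\<in>carrier G. \<forall>h\<in>carrier G.
    \<nu> (\<lambda>x. f (g \<otimes> x)) \<le> \<nu> (\<lambda>x. f (h \<otimes> x)) + 7/10"
proof -
  define cmp where "cmp = (\<lambda>(f::'g \<Rightarrow> real, g, h). (\<lambda>x. f (g \<otimes> x), \<lambda>x. f (h \<otimes> x), 7/10::real))"
  have "\<exists>\<nu>\<in>M. \<forall>(f, h, c)\<in>cmp ` (unit_valued \<times> carrier G \<times> carrier G). \<nu> f \<le> \<nu> h + c"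
  proof (rule means_compactness)
    fix R' assume "finite R'" "R' \<subseteq> cmp ` (unit_valued \<times> carrier G \<times> carrier G)"
    then obtain T where T: "T \<subseteq> unit_valued \<times> carrier G \<times> carrier G" "finite T" "R' = cmp ` T"
      by (meson finite_subset_image)
    have fin: "finite (fst ` T)" "fst ` T \<subseteq> unit_valued" using T by auto
    then obtain \<nu> where \<nu>: "\<nu> \<in> M" "\<And>f. f \<in> fst ` T \<Longrightarrow> balanced \<nu> f"
      using simultaneously_balanced[OF single fin] by blast
    have "\<nu> (\<lambda>x. f (g \<otimes> x)) \<le> \<nu> (\<lambda>x. f (h \<otimes> x)) + 7/10" if "(f, g, h) \<in> T" for f g h
    proof -
      have "f \<in> fst ` T" using that by force
      then have b: "balanced \<nu> f" by (rule \<nu>(2))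
      have gh: "g \<in> carrier G" "h \<in> carrier G" and fU: "f \<in> U"
        using T(1) that by (auto simp: unit_valued_def)
      \<comment> \<open>Convolving with the evaluation at the identity gives back \<open>\<nu>\<close>.\<close>
      have "conv \<nu> (\<lambda>f. f \<one>) (\<lambda>x. f (a \<otimes> x)) = \<nu> (\<lambda>x. f (a \<otimes> x))" if "a \<in> carrier G" for a
        unfolding conv_def using mean_translate_twice[OF \<nu>(1) fU that one_closed] that by simp
      then show ?thesis
        using b[unfolded balanced_def, rule_format, OF evaluation_mean[OF one_closed] gh] gh by simp
    qed
    then show "\<exists>\<nu>\<in>M. \<forall>(f, h, c)\<in>R'. \<nu> f \<le> \<nu> h + c"
      using \<nu>(1) T(3) by (intro bexI[of _ \<nu>]) (auto simp: cmp_def)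
  next
    fix f h c assume "(f, h, c) \<in> cmp ` (unit_valued \<times> carrier G \<times> carrier G)"
    then show "f \<in> U \<and> h \<in> U"
      by (auto simp: cmp_def unit_valued_def translate)
  qed
  then obtain \<nu> where \<nu>: "\<nu> \<in> M"
      "\<forall>(f, h, c)\<in>cmp ` (unit_valued \<times> carrier G \<times> carrier G). \<nu> f \<le> \<nu> h + c"
    by (rule bexE)
  show ?thesis
  proof (intro bexI[OF _ \<nu>(1)] ballI)
    fix f g h assume "f \<in> unit_valued" "g \<in> carrier G" "h \<in> carrier G"
    then have "cmp (f, g, h) \<in> cmp ` (unit_valued \<times> carrier G \<times> carrier G)" by simp
    from bspec[OF \<nu>(2) this]
    show "\<nu> (\<lambda>x. f (g \<otimes> x)) \<le> \<nu> (\<lambda>x. f (h \<otimes> x)) + 7/10" by (simp add: cmp_def)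
  qed
qed

end

section \<open>Additive minorants of superadditive functionals\<close>

context function_lattice
begin

definition pos_cone :: "('g \<Rightarrow> real) set" where
  "pos_cone = {f \<in> U. \<forall>x\<in>X. 0 \<le> f x}"

definition decomp :: "('g \<Rightarrow> real) \<Rightarrow> ('g \<Rightarrow> real) list \<Rightarrow> bool" where
  "decomp f E \<longleftrightarrow> set E \<subseteq> pos_cone \<and> (\<forall>x\<in>X. (\<Sum>e\<leftarrow>E. e x) = f x)"

definition superadditive :: "(('g \<Rightarrow> real) \<Rightarrow> real) \<Rightarrow> bool" where
  "superadditive p \<longleftrightarrow>
     (\<forall>f\<in>pos_cone. 0 \<le> p f) \<and>
     (\<forall>f\<in>pos_cone. \<forall>h\<in>pos_cone. p f + p h \<le> p (\<lambda>x. f x + h x)) \<and>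
     (\<forall>f\<in>pos_cone. \<forall>c\<ge>0. p (\<lambda>x. c * f x) = c * p f) \<and>
     (\<forall>f\<in>pos_cone. \<forall>h\<in>pos_cone. (\<forall>x\<in>X. f x = h x) \<longrightarrow> p f = p h)"

text \<open>For a superadditive \<open>p\<close> this is the largest additive functional below \<open>p\<close>. It plays the role of
  the integral against a measure whose mass on small pieces is given by \<open>p\<close>.\<close>

definition minorant :: "(('g \<Rightarrow> real) \<Rightarrow> real) \<Rightarrow> ('g \<Rightarrow> real) \<Rightarrow> real" where
  "minorant p f = Inf {(\<Sum>e\<leftarrow>E. p e) | E. decomp f E}"

lemma cone_add: "f \<in> pos_cone \<Longrightarrow> h \<in> pos_cone \<Longrightarrow> (\<lambda>x. f x + h x) \<in> pos_cone"
  by (simp add: pos_cone_def add_closed)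

lemma cone_scale: "f \<in> pos_cone \<Longrightarrow> 0 \<le> c \<Longrightarrow> (\<lambda>x. c * f x) \<in> pos_cone"
  by (simp add: pos_cone_def scale_closed)

lemma cone_const: "0 \<le> c \<Longrightarrow> (\<lambda>_. c) \<in> pos_cone"
  by (simp add: pos_cone_def)

lemma cone_sum_list: "set E \<subseteq> pos_cone \<Longrightarrow> (\<lambda>x. \<Sum>e\<leftarrow>E. e x) \<in> pos_cone"
  by (induction E) (auto intro: cone_add simp: cone_const)

lemma decomp_self: "f \<in> pos_cone \<Longrightarrow> decomp f [f]"
  by (simp add: decomp_def)

lemma minorant_cong: "(\<And>x. x \<in> X \<Longrightarrow> f x = h x) \<Longrightarrow> minorant p f = minorant p h"
  by (simp add: minorant_def decomp_def)

context
  fixes p assumes p: "superadditive p"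
begin

lemma superadditive_nonneg: "f \<in> pos_cone \<Longrightarrow> 0 \<le> p f"
  and superadditive_add: "f \<in> pos_cone \<Longrightarrow> h \<in> pos_cone \<Longrightarrow> p f + p h \<le> p (\<lambda>x. f x + h x)"
  and superadditive_scale: "f \<in> pos_cone \<Longrightarrow> 0 \<le> c \<Longrightarrow> p (\<lambda>x. c * f x) = c * p f"
  and superadditive_cong:
    "f \<in> pos_cone \<Longrightarrow> h \<in> pos_cone \<Longrightarrow> (\<And>x. x \<in> X \<Longrightarrow> f x = h x) \<Longrightarrow> p f = p h"
  using p unfolding superadditive_def by blast+

lemma sum_list_nonneg': "set E \<subseteq> pos_cone \<Longrightarrow> 0 \<le> (\<Sum>e\<leftarrow>E. p e)"
  by (induction E) (auto intro: superadditive_nonneg add_nonneg_nonneg)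

lemma minorant_le: "decomp f E \<Longrightarrow> minorant p f \<le> (\<Sum>e\<leftarrow>E. p e)"
  unfolding minorant_def
  by (rule cInf_lower) (auto intro!: bdd_belowI[of _ 0] sum_list_nonneg' simp: decomp_def)

lemma minorant_greatest:
  assumes "f \<in> pos_cone" "\<And>E. decomp f E \<Longrightarrow> c \<le> (\<Sum>e\<leftarrow>E. p e)"
  shows "c \<le> minorant p f"
  unfolding minorant_def using assms decomp_self[of f] by (intro cInf_greatest) auto

lemma minorant_nonneg: "f \<in> pos_cone \<Longrightarrow> 0 \<le> minorant p f"
  by (rule minorant_greatest) (auto simp: decomp_def intro: sum_list_nonneg')

lemma minorant_attained:
  assumes "f \<in> pos_cone" "0 < \<tau>"
  obtains E where "decomp f E" "(\<Sum>e\<leftarrow>E. p e) \<le> minorant p f + \<tau>"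
  using minorant_greatest[OF assms(1), of "minorant p f + \<tau>"] assms(2) by force

lemma superadditive_sum_list:
  "set E \<subseteq> pos_cone \<Longrightarrow> (\<Sum>e\<leftarrow>E. p e) \<le> p (\<lambda>x. \<Sum>e\<leftarrow>E. e x)"
proof (induction E)
  case Nil
  have "0 \<le> p (\<lambda>_. 0)"
    by (simp add: superadditive_nonneg cone_const)
  then show ?case by simp
next
  case (Cons e E)
  have "p e + p (\<lambda>x. \<Sum>e\<leftarrow>E. e x) \<le> p (\<lambda>x. e x + (\<Sum>e\<leftarrow>E. e x))"
    using Cons.prems cone_sum_list[of E] by (intro superadditive_add) auto
  then show ?case using Cons by simp
qed

lemma decomp_le:
  assumes "f \<in> pos_cone" "decomp f E" shows "(\<Sum>e\<leftarrow>E. p e) \<le> p f"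
proof -
  have "p (\<lambda>x. \<Sum>e\<leftarrow>E. e x) = p f"
    using assms cone_sum_list[of E] by (intro superadditive_cong) (auto simp: decomp_def)
  then show ?thesis using superadditive_sum_list[of E] assms(2) by (simp add: decomp_def)
qed

text \<open>The Riesz decomposition property of the lattice: every summand \<open>e\<close> is split into
  \<open>min e f\<close> and the rest, and superadditivity makes the splitting cheap.\<close>

lemma riesz_decomposition:
  assumes "f \<in> pos_cone" "h \<in> pos_cone" "decomp (\<lambda>x. f x + h x) E"
  shows "\<exists>E1 E2. decomp f E1 \<and> decomp h E2 \<and>
    (\<Sum>e\<leftarrow>E1. p e) + (\<Sum>e\<leftarrow>E2. p e) \<le> (\<Sum>e\<leftarrow>E. p e)"
  using assms
proof (induction E arbitrary: f h)
  case Nil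
  have "f x = 0 \<and> h x = 0" if "x \<in> X" for x
    using that Nil by (force simp: pos_cone_def decomp_def)
  then show ?case by (intro exI[of _ "[]"]) (auto simp: decomp_def)
next
  case (Cons e E)
  have e: "e \<in> pos_cone" and E: "set E \<subseteq> pos_cone"
    and sum: "\<And>x. x \<in> X \<Longrightarrow> e x + (\<Sum>e\<leftarrow>E. e x) = f x + h x"
    using Cons.prems(3) by (auto simp: decomp_def)
  have tail: "0 \<le> (\<Sum>e\<leftarrow>E. e x)" if "x \<in> X" for x
    using cone_sum_list[OF E] that by (simp add: pos_cone_def)
  define a where "a = (\<lambda>x. min (e x) (f x))"
  define b where "b = (\<lambda>x. e x - a x)"
  have U: "a \<in> U" "b \<in> U" "f \<in> U" "h \<in> U"
    using e Cons.prems unfolding a_def b_def pos_cone_def by (auto intro: min_closed diff_closed)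
  have ab: "a \<in> pos_cone" "b \<in> pos_cone"
    using U e Cons.prems unfolding pos_cone_def by (auto simp: a_def b_def)
  have f': "(\<lambda>x. f x - a x) \<in> pos_cone"
    using U diff_closed[OF U(3,1)] unfolding pos_cone_def by (auto simp: a_def)
  have "b x \<le> h x" if "x \<in> X" for x
  proof -
    have "0 \<le> h x" "e x \<le> f x + h x"
      using that Cons.prems(2) sum[OF that] tail[OF that] by (auto simp: pos_cone_def)
    then show ?thesis by (simp add: b_def a_def min_def)
  qed
  then have h': "(\<lambda>x. h x - b x) \<in> pos_cone"
    using diff_closed[OF U(4,2)] unfolding pos_cone_def by auto
  have "decomp (\<lambda>x. (f x - a x) + (h x - b x)) E"
    using E sum by (auto simp: decomp_def b_def) (smt (verit))
  from Cons.IH[OF f' h' this] obtain E1 E2 where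
    E12: "decomp (\<lambda>x. f x - a x) E1" "decomp (\<lambda>x. h x - b x) E2"
      "(\<Sum>e\<leftarrow>E1. p e) + (\<Sum>e\<leftarrow>E2. p e) \<le> (\<Sum>e\<leftarrow>E. p e)"
    by blast
  have "p a + p b \<le> p (\<lambda>x. a x + b x)"
    using ab by (rule superadditive_add)
  also have "(\<lambda>x. a x + b x) = e" by (simp add: b_def)
  finally show ?case
    using E12 ab by (intro exI[of _ "a # E1"] exI[of _ "b # E2"]) (auto simp: decomp_def)
qed

lemma minorant_add:
  assumes f: "f \<in> pos_cone" and h: "h \<in> pos_cone"
  shows "minorant p (\<lambda>x. f x + h x) = minorant p f + minorant p h"
proof (rule antisym)
  show "minorant p (\<lambda>x. f x + h x) \<le> minorant p f + minorant p h"
  proof (rule field_le_epsilon)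
    fix \<tau> :: real assume "0 < \<tau>"
    then have "0 < \<tau> / 2" by simp
    then obtain E1 E2 where E: "decomp f E1" "(\<Sum>e\<leftarrow>E1. p e) \<le> minorant p f + \<tau>/2"
      "decomp h E2" "(\<Sum>e\<leftarrow>E2. p e) \<le> minorant p h + \<tau>/2"
      using minorant_attained f h by metis
    have "decomp (\<lambda>x. f x + h x) (E1 @ E2)"
      using E by (auto simp: decomp_def)
    from minorant_le[OF this] show "minorant p (\<lambda>x. f x + h x) \<le> minorant p f + minorant p h + \<tau>"
      using E by simp
  qed
next
  show "minorant p f + minorant p h \<le> minorant p (\<lambda>x. f x + h x)"
  proof (rule minorant_greatest)
    fix E assume "decomp (\<lambda>x. f x + h x) E"
    from riesz_decomposition[OF f h this] obtain E1 E2 where E: "decomp f E1" "decomp h E2"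
      "(\<Sum>e\<leftarrow>E1. p e) + (\<Sum>e\<leftarrow>E2. p e) \<le> (\<Sum>e\<leftarrow>E. p e)" by blast
    then show "minorant p f + minorant p h \<le> (\<Sum>e\<leftarrow>E. p e)"
      using minorant_le[OF E(1)] minorant_le[OF E(2)] by linarith
  qed (rule cone_add[OF f h])
qed

lemma minorant_zero: "minorant p (\<lambda>_. 0) = 0"
  using minorant_add[of "\<lambda>_. 0" "\<lambda>_. 0"] cone_const[of 0] by simp

lemma minorant_scale:
  assumes f: "f \<in> pos_cone" and c: "0 \<le> c"
  shows "minorant p (\<lambda>x. c * f x) = c * minorant p f"
proof -
  have le: "minorant p (\<lambda>x. c * f x) \<le> c * minorant p f" if "f \<in> pos_cone" "0 < c" for f c
  proof -
    have "minorant p (\<lambda>x. c * f x) / c \<le> minorant p f"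
    proof (rule minorant_greatest[OF that(1)])
      fix E assume E: "decomp f E"
      have "decomp (\<lambda>x. c * f x) (map (\<lambda>e x. c * e x) E)"
        using E that(2) cone_scale
        by (auto simp: decomp_def o_def sum_list_const_mult)
      from minorant_le[OF this]
      have "minorant p (\<lambda>x. c * f x) \<le> (\<Sum>e\<leftarrow>E. p (\<lambda>x. c * e x))" by (simp add: o_def)
      also have "(\<Sum>e\<leftarrow>E. p (\<lambda>x. c * e x)) = (\<Sum>e\<leftarrow>E. c * p e)"
        using E that(2) by (intro arg_cong[of _ _ sum_list] map_cong refl superadditive_scale)
          (auto simp: decomp_def)
      finally show "minorant p (\<lambda>x. c * f x) / c \<le> (\<Sum>e\<leftarrow>E. p e)"
        using that(2) by (simp add: sum_list_const_mult field_simps)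
    qed
    then show ?thesis using that(2) by (simp add: field_simps)
  qed
  show ?thesis
  proof (cases "c = 0")
    case True
    then show ?thesis by (simp add: minorant_zero)
  next
    case False
    then have "0 < c" using c by simp
    moreover have "minorant p (\<lambda>x. (1/c) * (c * f x)) \<le> (1/c) * minorant p (\<lambda>x. c * f x)"
      using \<open>0 < c\<close> f by (intro le cone_scale) auto
    ultimately show ?thesis
      using le[OF f, of c] by (auto simp: field_simps)
  qed
qed

lemma minorant_sum_list:
  "set E \<subseteq> pos_cone \<Longrightarrow> minorant p (\<lambda>x. \<Sum>e\<leftarrow>E. e x) = (\<Sum>e\<leftarrow>E. minorant p e)"
  by (induction E) (simp_all add: minorant_zero minorant_add cone_sum_list)

lemma minorant_decomp:
  assumes "decomp f E" shows "(\<Sum>e\<leftarrow>E. minorant p e) = minorant p f"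
  using assms minorant_sum_list[of E] minorant_cong[of f "\<lambda>x. \<Sum>e\<leftarrow>E. e x"]
  by (simp add: decomp_def)

end

text \<open>Refining a decomposition cannot increase the sum of a superadditive functional, so one
  refines a nearly optimal decomposition for \<open>p\<close> by nearly optimal ones, for \<open>q\<close>, of its members.\<close>

lemma simultaneous_refinement:
  assumes p: "superadditive p" and q: "superadditive q" and f: "f \<in> pos_cone" and \<tau>: "0 < \<tau>"
  obtains E where "decomp f E" "(\<Sum>e\<leftarrow>E. p e) \<le> minorant p f + \<tau>"
    "(\<Sum>e\<leftarrow>E. q e) \<le> minorant q f + \<tau>"
proof -
  obtain E1 where E1: "decomp f E1" "(\<Sum>e\<leftarrow>E1. p e) \<le> minorant p f + \<tau>"
    using minorant_attained[OF p f \<tau>] by blast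
  have refine: "\<exists>E. set E \<subseteq> pos_cone \<and> (\<forall>x\<in>X. (\<Sum>e\<leftarrow>E. e x) = (\<Sum>e\<leftarrow>E1. e x)) \<and>
      (\<Sum>e\<leftarrow>E. p e) \<le> (\<Sum>e\<leftarrow>E1. p e) \<and> (\<Sum>e\<leftarrow>E. q e) \<le> (\<Sum>e\<leftarrow>E1. minorant q e) + \<tau>"
    if "set E1 \<subseteq> pos_cone" "0 < \<tau>" for E1 \<tau>
    using that
  proof (induction E1 arbitrary: \<tau>)
    case Nil
    then show ?case by (intro exI[of _ "[]"]) auto
  next
    case (Cons e E1)
    then have e: "e \<in> pos_cone" and h: "0 < \<tau> / 2" by auto
    obtain D where D: "decomp e D" "(\<Sum>e\<leftarrow>D. q e) \<le> minorant q e + \<tau>/2"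
      using minorant_attained[OF q e h] by blast
    obtain E where "set E \<subseteq> pos_cone" "\<forall>x\<in>X. (\<Sum>e\<leftarrow>E. e x) = (\<Sum>e\<leftarrow>E1. e x)"
      "(\<Sum>e\<leftarrow>E. p e) \<le> (\<Sum>e\<leftarrow>E1. p e)" "(\<Sum>e\<leftarrow>E. q e) \<le> (\<Sum>e\<leftarrow>E1. minorant q e) + \<tau>/2"
      using Cons.IH[OF _ h] Cons.prems by auto
    then show ?case
      using D decomp_le[OF p e D(1)] by (intro exI[of _ "D @ E"]) (auto simp: decomp_def)
  qed
  have "set E1 \<subseteq> pos_cone" using E1(1) by (simp add: decomp_def)
  from refine[OF this \<tau>] obtain E where "set E \<subseteq> pos_cone" "\<forall>x\<in>X. (\<Sum>e\<leftarrow>E. e x) = (\<Sum>e\<leftarrow>E1. e x)"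
      "(\<Sum>e\<leftarrow>E. p e) \<le> (\<Sum>e\<leftarrow>E1. p e)" "(\<Sum>e\<leftarrow>E. q e) \<le> (\<Sum>e\<leftarrow>E1. minorant q e) + \<tau>"
    by blast
  then show ?thesis
    using E1 minorant_decomp[OF q E1(1)] by (intro that[of E]) (auto simp: decomp_def)
qed

text \<open>Linear inequalities between superadditive functionals pass to their additive minorants, which is how
  the parallelogram law is transported from numbers to half densities.\<close>

lemma minorant_compare:
  assumes p: "superadditive p" and q: "superadditive q" and r: "superadditive r"
    and nn: "0 \<le> \<alpha>" "0 \<le> \<beta>" "0 \<le> a" "0 \<le> b"
    and le: "\<And>e. e \<in> pos_cone \<Longrightarrow> \<alpha> * q e + \<beta> * r e \<le> a * p e + b * q e"
    and f: "f \<in> pos_cone"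
  shows "\<alpha> * minorant q f + \<beta> * minorant r f \<le> a * minorant p f + b * minorant q f"
proof (rule field_le_epsilon)
  fix \<tau> :: real assume \<tau>: "0 < \<tau>"
  define \<delta> where "\<delta> = \<tau> / (a + b + 1)"
  have "0 < a + b + 1" using nn by simp
  then have \<delta>: "0 < \<delta>" "(a + b + 1) * \<delta> = \<tau>"
    using \<tau> by (simp_all add: \<delta>_def)
  then have \<delta>_le: "a * \<delta> + b * \<delta> \<le> \<tau>" by (simp add: algebra_simps)
  obtain E where E: "decomp f E" "(\<Sum>e\<leftarrow>E. p e) \<le> minorant p f + \<delta>"
    "(\<Sum>e\<leftarrow>E. q e) \<le> minorant q f + \<delta>"
    using simultaneous_refinement[OF p q f \<delta>(1)] by blast
  have "\<alpha> * minorant q f + \<beta> * minorant r f \<le> \<alpha> * (\<Sum>e\<leftarrow>E. q e) + \<beta> * (\<Sum>e\<leftarrow>E. r e)"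
    using minorant_le[OF q E(1)] minorant_le[OF r E(1)] nn
    by (intro add_mono mult_left_mono)
  also have "\<dots> = (\<Sum>e\<leftarrow>E. \<alpha> * q e + \<beta> * r e)"
    by (simp add: sum_list_addf sum_list_const_mult)
  also have "\<dots> \<le> (\<Sum>e\<leftarrow>E. a * p e + b * q e)"
    using le E(1) by (intro sum_list_mono) (auto simp: decomp_def)
  also have "\<dots> = a * (\<Sum>e\<leftarrow>E. p e) + b * (\<Sum>e\<leftarrow>E. q e)"
    by (simp add: sum_list_addf sum_list_const_mult)
  also have "\<dots> \<le> a * (minorant p f + \<delta>) + b * (minorant q f + \<delta>)"
    using E nn by (intro add_mono mult_left_mono)
  also have "\<dots> \<le> a * minorant p f + b * minorant q f + \<tau>"
    using \<delta>_le by (simp add: algebra_simps)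
  finally show "\<alpha> * minorant q f + \<beta> * minorant r f \<le> a * minorant p f + b * minorant q f + \<tau>" .
qed

text \<open>A bounded function becomes nonnegative after adding a constant, so an additive functional on
  the nonnegative functions extends to all of \<open>U\<close>.\<close>

lemma mean_of_additive:
  assumes L_add: "\<And>f h. f \<in> pos_cone \<Longrightarrow> h \<in> pos_cone \<Longrightarrow> \<Lambda> (\<lambda>x. f x + h x) = \<Lambda> f + \<Lambda> h"
    and L_scale: "\<And>f c. f \<in> pos_cone \<Longrightarrow> 0 \<le> c \<Longrightarrow> \<Lambda> (\<lambda>x. c * f x) = c * \<Lambda> f"
    and nonneg: "\<And>f. f \<in> pos_cone \<Longrightarrow> 0 \<le> \<Lambda> f"
    and pos: "0 < \<Lambda> (\<lambda>_. 1)"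
  shows "\<exists>\<mu>\<in>means X U. \<forall>f\<in>pos_cone. \<mu> f = \<Lambda> f / \<Lambda> (\<lambda>_. 1)"
proof -
  let ?l = "\<Lambda> (\<lambda>_. 1)"
  have const': "\<Lambda> (\<lambda>_. c) = c * ?l" if "0 \<le> c" for c
    using L_scale[OF cone_const, of 1 c] that by simp
  have "\<exists>c. 0 \<le> c \<and> (\<forall>x\<in>X. \<bar>f x\<bar> \<le> c)" if "f \<in> U" for f
    using sup_bound[OF that] by metis
  then obtain b where b: "\<And>f. f \<in> U \<Longrightarrow> 0 \<le> b f"
      "\<And>f x. f \<in> U \<Longrightarrow> x \<in> X \<Longrightarrow> \<bar>f x\<bar> \<le> b f"
    by metis
  define v where "v f = \<Lambda> (\<lambda>x. f x + b f) - b f * ?l" for f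
  have shift: "(\<lambda>x. f x + c) \<in> pos_cone" if "f \<in> U" "\<And>x. x \<in> X \<Longrightarrow> \<bar>f x\<bar> \<le> c" for f c
    using that add_closed[OF that(1) const_closed]
    by (fastforce simp: pos_cone_def)
  have v: "v f = \<Lambda> (\<lambda>x. f x + c) - c * ?l" if f: "f \<in> U" "(\<lambda>x. f x + c) \<in> pos_cone" "0 \<le> c" for f c
  proof -
    have c: "(\<lambda>x. f x + b f) \<in> pos_cone" using shift b f by auto
    have "\<Lambda> (\<lambda>x. (f x + c) + b f) = \<Lambda> (\<lambda>x. f x + c) + b f * ?l"
      using L_add[OF f(2) cone_const[OF b(1)[OF f(1)]]] const'[OF b(1)[OF f(1)]] by simp
    moreover have "\<Lambda> (\<lambda>x. (f x + b f) + c) = \<Lambda> (\<lambda>x. f x + b f) + c * ?l"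
      using L_add[OF c cone_const[OF f(3)]] const'[OF f(3)] by simp
    ultimately show ?thesis by (simp add: v_def algebra_simps)
  qed
  have v_add: "v (\<lambda>x. f x + h x) = v f + v h" if "f \<in> U" "h \<in> U" for f h
  proof -
    have c: "(\<lambda>x. f x + b f) \<in> pos_cone" "(\<lambda>x. h x + b h) \<in> pos_cone" using shift b that by auto
    have eq: "(\<lambda>x. (f x + h x) + (b f + b h)) = (\<lambda>x. (f x + b f) + (h x + b h))"
      by (simp add: algebra_simps)
    have "v (\<lambda>x. f x + h x) = \<Lambda> (\<lambda>x. (f x + h x) + (b f + b h)) - (b f + b h) * ?l"
      using that b(1) cone_add[OF c] unfolding eq[symmetric]
      by (intro v add_closed add_nonneg_nonneg)
    then show ?thesis unfolding eq L_add[OF c] by (simp add: v_def algebra_simps)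
  qed
  have v_pos: "v (\<lambda>x. c * f x) = c * v f" if "f \<in> U" "0 \<le> c" for f c
  proof -
    have k: "(\<lambda>x. f x + b f) \<in> pos_cone" using shift b that by auto
    have eq: "(\<lambda>x. c * f x + c * b f) = (\<lambda>x. c * (f x + b f))" by (simp add: algebra_simps)
    have "v (\<lambda>x. c * f x) = \<Lambda> (\<lambda>x. c * f x + c * b f) - (c * b f) * ?l"
      using that b(1) cone_scale[OF k that(2)] unfolding eq[symmetric]
      by (intro v scale_closed mult_nonneg_nonneg)
    then show ?thesis unfolding eq L_scale[OF k that(2)] by (simp add: v_def algebra_simps)
  qed
  have v_cone: "v f = \<Lambda> f" if "f \<in> pos_cone" for f
    using v[of f 0] that by (simp add: pos_cone_def)
  have v_minus: "v (\<lambda>x. - f x) = - v f" if "f \<in> U" for f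
    using v_add[OF that scale_closed[OF that, of "-1"]]
      v_cone[OF cone_const[of 0]] const'[of 0] by simp
  have v_scale: "v (\<lambda>x. c * f x) = c * v f" if "f \<in> U" for f c
  proof (cases "0 \<le> c")
    case False
    then show ?thesis
      using v_pos[OF scale_closed[OF that, of "-1"], of "-c"]
        v_minus[OF that] by simp
  qed (simp add: v_pos that)
  have "(\<lambda>f. v f / ?l) \<in> means X U"
    unfolding means_def using pos v_cone[OF cone_const[of 1]] v_cone nonneg
    by (auto simp: v_add v_scale add_divide_distrib pos_cone_def)
  then show ?thesis using v_cone by (intro bexI[of _ "\<lambda>f. v f / ?l"]) auto
qed

end

section \<open>From overlapping translates to an invariant mean\<close>

text \<open>Minkowski's inequality for the exponent \<open>1/2\<close>, for which its direction is reversed.\<close>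

lemma sum_sqrt_minkowski:
  fixes a b :: "'i \<Rightarrow> real"
  assumes "\<And>i. i \<in> set hs \<Longrightarrow> 0 \<le> a i \<and> 0 \<le> b i"
  shows "(\<Sum>i\<leftarrow>hs. sqrt (a i))\<^sup>2 + (\<Sum>i\<leftarrow>hs. sqrt (b i))\<^sup>2 \<le> (\<Sum>i\<leftarrow>hs. sqrt (a i + b i))\<^sup>2"
  using assms
proof (induction hs)
  case (Cons i hs)
  define A where "A = (\<Sum>i\<leftarrow>hs. sqrt (a i))"
  define B where "B = (\<Sum>i\<leftarrow>hs. sqrt (b i))"
  define S where "S = (\<Sum>i\<leftarrow>hs. sqrt (a i + b i))"
  define s t where "s = sqrt (a i)" and "t = sqrt (b i)"
  define u where "u = sqrt (a i + b i)"
  have ab: "0 \<le> a i" "0 \<le> b i" using Cons.prems by auto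
  have st: "u\<^sup>2 = s\<^sup>2 + t\<^sup>2" "0 \<le> u" using ab by (simp_all add: s_def t_def u_def)
  have S: "A\<^sup>2 + B\<^sup>2 \<le> S\<^sup>2" using Cons unfolding A_def B_def S_def by auto
  have S0: "0 \<le> S" unfolding S_def using Cons.prems by (intro sum_list_nonneg) auto
  have "(A * s + B * t)\<^sup>2 \<le> (A\<^sup>2 + B\<^sup>2) * (s\<^sup>2 + t\<^sup>2)"
    using zero_le_power2[of "A * t - B * s"] by (simp add: power2_eq_square algebra_simps)
  also have "\<dots> \<le> S\<^sup>2 * u\<^sup>2" unfolding st(1) using S by (intro mult_right_mono) auto
  finally have "(A * s + B * t)\<^sup>2 \<le> (S * u)\<^sup>2" by (simp add: power_mult_distrib)
  then have "A * s + B * t \<le> S * u"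
    using S0 st(2) by (intro power2_le_imp_le[of "A * s + B * t"]) auto
  then have "(s + A)\<^sup>2 + (t + B)\<^sup>2 \<le> (u + S)\<^sup>2"
    using S st(1) by (simp add: power2_eq_square algebra_simps)
  then show ?case by (simp add: A_def B_def S_def s_def t_def u_def)
qed simp

lemma sum_list_swap:
  "(\<Sum>x\<leftarrow>xs. \<Sum>y\<leftarrow>ys. f x y) = (\<Sum>y\<leftarrow>ys. \<Sum>x\<leftarrow>xs. f x y :: real)"
  by (induction xs) (simp_all add: sum_list_addf)

lemma sum_list_square:
  "(\<Sum>x\<leftarrow>xs. f x :: real)\<^sup>2 = (\<Sum>x\<leftarrow>xs. \<Sum>y\<leftarrow>xs. f x * f y)"
  by (simp add: power2_eq_square sum_list_mult_const[symmetric] sum_list_const_mult[symmetric] mult.commute)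

context translation_lattice
begin

text \<open>If the translates of \<open>\<nu>\<close> by the entries of \<open>hs\<close> had constant densities on a piece \<open>e\<close> of the
  space, this would be the squared norm, on that piece, of the average of their half densities. In
  general it is only an upper bound, which becomes sharp when the piece is decomposed further.\<close>

definition energy :: "(('g \<Rightarrow> real) \<Rightarrow> real) \<Rightarrow> 'g list \<Rightarrow> ('g \<Rightarrow> real) \<Rightarrow> real" where
  "energy \<nu> hs e = ((\<Sum>h\<leftarrow>hs. sqrt (\<nu> (\<lambda>x. e (h \<otimes> x)))) / real (length hs))\<^sup>2"

context
  fixes \<nu>
  assumes \<nu>: "\<nu> \<in> M"
begin

lemma mean_translate_nonneg:
  "e \<in> pos_cone \<Longrightarrow> h \<in> carrier G \<Longrightarrow> 0 \<le> \<nu> (\<lambda>x. e (h \<otimes> x))"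
  by (rule mean_nonneg[OF \<nu>]) (auto simp: pos_cone_def translate)

lemma energy_superadditive:
  assumes hs: "set hs \<subseteq> carrier G"
  shows "superadditive (energy \<nu> hs)"
proof -
  have U: "e \<in> U" if "e \<in> pos_cone" for e using that by (simp add: pos_cone_def)
  have "energy \<nu> hs f + energy \<nu> hs h \<le> energy \<nu> hs (\<lambda>x. f x + h x)"
    if fh: "f \<in> pos_cone" "h \<in> pos_cone" for f h
  proof -
    have eq: "(\<Sum>k\<leftarrow>hs. sqrt (\<nu> (\<lambda>x. f (k \<otimes> x) + h (k \<otimes> x)))) =
        (\<Sum>k\<leftarrow>hs. sqrt (\<nu> (\<lambda>x. f (k \<otimes> x)) + \<nu> (\<lambda>x. h (k \<otimes> x))))"
      using hs by (intro arg_cong[of _ _ sum_list] map_cong refl arg_cong[of _ _ sqrt] mean_add[OF \<nu>])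
        (auto simp: translate[OF U[OF fh(1)]] translate[OF U[OF fh(2)]])
    have "(\<Sum>k\<leftarrow>hs. sqrt (\<nu> (\<lambda>x. f (k \<otimes> x))))\<^sup>2 + (\<Sum>k\<leftarrow>hs. sqrt (\<nu> (\<lambda>x. h (k \<otimes> x))))\<^sup>2
       \<le> (\<Sum>k\<leftarrow>hs. sqrt (\<nu> (\<lambda>x. f (k \<otimes> x)) + \<nu> (\<lambda>x. h (k \<otimes> x))))\<^sup>2"
      using hs mean_translate_nonneg fh by (intro sum_sqrt_minkowski) auto
    then show ?thesis
      unfolding energy_def eq
      by (simp add: power_divide add_divide_distrib[symmetric] divide_right_mono)
  qed
  moreover have "energy \<nu> hs (\<lambda>x. c * f x) = c * energy \<nu> hs f" if f: "f \<in> pos_cone" "0 \<le> c" for f c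
  proof -
    have "(\<Sum>k\<leftarrow>hs. sqrt (\<nu> (\<lambda>x. c * f (k \<otimes> x)))) = (\<Sum>k\<leftarrow>hs. sqrt c * sqrt (\<nu> (\<lambda>x. f (k \<otimes> x))))"
    proof (intro arg_cong[of _ _ sum_list] map_cong refl)
      fix k assume "k \<in> set hs"
      then have "\<nu> (\<lambda>x. c * f (k \<otimes> x)) = c * \<nu> (\<lambda>x. f (k \<otimes> x))"
        using hs by (intro mean_scale[OF \<nu>]) (auto simp: translate[OF U[OF f(1)]])
      then show "sqrt (\<nu> (\<lambda>x. c * f (k \<otimes> x))) = sqrt c * sqrt (\<nu> (\<lambda>x. f (k \<otimes> x)))"
        by (simp add: real_sqrt_mult)
    qed
    then show ?thesis
      using f(2) by (simp add: energy_def sum_list_const_mult power_mult_distrib power_divide)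
  qed
  moreover have "energy \<nu> hs f = energy \<nu> hs h"
    if "f \<in> pos_cone" "h \<in> pos_cone" "\<forall>x\<in>carrier G. f x = h x" for f h
  proof -
    have "\<nu> (\<lambda>x. f (k \<otimes> x)) = \<nu> (\<lambda>x. h (k \<otimes> x))" if "k \<in> set hs" for k
      using hs that \<open>\<forall>x\<in>carrier G. f x = h x\<close> translate[OF U[OF \<open>h \<in> pos_cone\<close>]]
      by (intro mean_cong[OF \<nu>]) auto
    then show ?thesis by (simp add: energy_def cong: map_cong)
  qed
  moreover have "0 \<le> energy \<nu> hs f" for f by (simp add: energy_def)
  ultimately show ?thesis
    unfolding superadditive_def by blast
qed

abbreviation least_energy :: "'g list \<Rightarrow> ('g \<Rightarrow> real) \<Rightarrow> real" where
  "least_energy hs \<equiv> minorant (energy \<nu> hs)"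

text \<open>Translating a function amounts to translating all the half densities; a decomposition of \<open>f\<close>
  is translated along with it.\<close>

lemma least_energy_translate:
  assumes hs: "set hs \<subseteq> carrier G" and g: "g \<in> carrier G" and f: "f \<in> pos_cone"
  shows "least_energy hs (\<lambda>x. f (g \<otimes> x)) \<le> least_energy (map ((\<otimes>) g) hs) f"
proof -
  have hs': "set (map ((\<otimes>) g) hs) \<subseteq> carrier G" using hs g by auto
  show ?thesis
  proof (rule minorant_greatest[OF energy_superadditive[OF hs'] f])
    fix E assume E: "decomp f E"
    have "decomp (\<lambda>x. f (g \<otimes> x)) (map (\<lambda>e x. e (g \<otimes> x)) E)"
      using E g by (auto simp: decomp_def o_def pos_cone_def translate subset_eq)
    from minorant_le[OF energy_superadditive[OF hs] this]
    have "least_energy hs (\<lambda>x. f (g \<otimes> x)) \<le> (\<Sum>e\<leftarrow>E. energy \<nu> hs (\<lambda>x. e (g \<otimes> x)))"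
      by (simp add: o_def)
    also have "\<dots> = (\<Sum>e\<leftarrow>E. energy \<nu> (map ((\<otimes>) g) hs) e)"
    proof (intro arg_cong[of _ _ sum_list] map_cong refl)
      fix e assume "e \<in> set E"
      then have e: "e \<in> U" using E by (auto simp: decomp_def pos_cone_def)
      have "(\<Sum>h\<leftarrow>hs. sqrt (\<nu> (\<lambda>x. e (g \<otimes> (h \<otimes> x))))) = (\<Sum>h\<leftarrow>hs. sqrt (\<nu> (\<lambda>x. e (g \<otimes> h \<otimes> x))))"
        using hs g by (intro arg_cong[of _ _ sum_list] map_cong refl arg_cong[of _ _ sqrt]
            mean_translate_twice[OF \<nu> e]) auto
      then show "energy \<nu> hs (\<lambda>x. e (g \<otimes> x)) = energy \<nu> (map ((\<otimes>) g) hs) e"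
        by (simp add: energy_def o_def)
    qed
    finally show "least_energy hs (\<lambda>x. f (g \<otimes> x)) \<le> (\<Sum>e\<leftarrow>E. energy \<nu> (map ((\<otimes>) g) hs) e)" .
  qed
qed

lemma least_energy_le_1:
  assumes "set hs \<subseteq> carrier G" "f \<in> unit_valued"
  shows "least_energy hs f \<le> 1"
proof -
  have f: "f \<in> pos_cone" "f \<in> U" using assms(2) by (auto simp: unit_valued_def pos_cone_def)
  have "least_energy hs f \<le> energy \<nu> hs f"
    using minorant_le[OF energy_superadditive[OF assms(1)] decomp_self[OF f(1)]] by simp
  also have "\<dots> \<le> 1"
  proof -
    have "sqrt (\<nu> (\<lambda>x. f (h \<otimes> x))) \<le> 1" if "h \<in> set hs" for h
    proof -
      have "\<nu> (\<lambda>x. f (h \<otimes> x)) \<le> \<nu> (\<lambda>_. 1)"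
        using assms that by (intro mean_mono[OF \<nu> translate[OF f(2)]]) (auto simp: unit_valued_def)
      then show ?thesis using mean_const[OF \<nu>] by simp
    qed
    then have "(\<Sum>h\<leftarrow>hs. sqrt (\<nu> (\<lambda>x. f (h \<otimes> x)))) \<le> (\<Sum>h\<leftarrow>hs. 1)"
      by (rule sum_list_mono)
    moreover have "0 \<le> (\<Sum>h\<leftarrow>hs. sqrt (\<nu> (\<lambda>x. f (h \<otimes> x))))"
      using assms mean_translate_nonneg[OF f(1)] by (intro sum_list_nonneg) auto
    ultimately show ?thesis
      by (simp add: energy_def power_le_one divide_le_eq_1 sum_list_triv)
  qed
  finally show ?thesis .
qed

text \<open>The overlap hypothesis says that half densities of any two translates have inner product at least
  \<open>3/10\<close>: it is applied to the sum of those pieces that are larger for \<open>g\<close> than for \<open>h\<close>, and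
  \<open>min a b \<le> sqrt a * sqrt b\<close>.\<close>

lemma least_energy_1_ge:
  assumes overlap: "\<And>f g h. f \<in> unit_valued \<Longrightarrow> g \<in> carrier G \<Longrightarrow> h \<in> carrier G \<Longrightarrow>
      \<nu> (\<lambda>x. f (g \<otimes> x)) \<le> \<nu> (\<lambda>x. f (h \<otimes> x)) + 7/10"
    and hs: "set hs \<subseteq> carrier G" "hs \<noteq> []"
  shows "3/10 \<le> least_energy hs (\<lambda>_. 1)"
proof (rule minorant_greatest[OF energy_superadditive[OF hs(1)] cone_const])
  fix E assume E: "decomp (\<lambda>_. 1) E"
  define w where "w = (\<lambda>h e. \<nu> (\<lambda>x. e (h \<otimes> x)))"
  have E_U: "set E \<subseteq> U" and E_pos: "set E \<subseteq> pos_cone"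
    using E by (auto simp: decomp_def pos_cone_def)
  have w_sum: "w h (\<lambda>x. \<Sum>e\<leftarrow>D. e x) = (\<Sum>e\<leftarrow>D. w h e)"
    if "set D \<subseteq> set E" "h \<in> carrier G" for D h
  proof -
    have "set (map (\<lambda>e x. e (h \<otimes> x)) D) \<subseteq> U"
      using that E_U translate[OF _ that(2)] by auto
    from mean_sum_list[OF \<nu> this] show ?thesis by (simp add: w_def o_def)
  qed
  have pair: "3/10 \<le> (\<Sum>e\<leftarrow>E. sqrt (w g e) * sqrt (w h e))" if g: "g \<in> carrier G" and h: "h \<in> carrier G" for g h
  proof -
    define D where "D = filter (\<lambda>e. w h e < w g e) E"
    have D: "set D \<subseteq> set E" by (auto simp: D_def)
    have "(\<Sum>e\<leftarrow>D. e x) \<le> (\<Sum>e\<leftarrow>E. e x)" if "x \<in> carrier G" for x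
    proof -
      have "(\<Sum>e\<leftarrow>filter P F. e x) \<le> (\<Sum>e\<leftarrow>F. e x)" if "set F \<subseteq> pos_cone" for P F
        using that \<open>x \<in> carrier G\<close> by (induction F) (auto simp: pos_cone_def add_increasing)
      then show ?thesis using E_pos by (simp add: D_def)
    qed
    moreover have "(\<lambda>x. \<Sum>e\<leftarrow>D. e x) \<in> pos_cone"
      using D E_pos by (intro cone_sum_list) auto
    ultimately have "(\<lambda>x. \<Sum>e\<leftarrow>D. e x) \<in> unit_valued"
      using E by (auto simp: unit_valued_def pos_cone_def decomp_def)
    from overlap[OF this g h]
    have "(\<Sum>e\<leftarrow>D. w g e) \<le> (\<Sum>e\<leftarrow>D. w h e) + 7/10"
      using w_sum[OF D g] w_sum[OF D h] by (simp add: w_def)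
    moreover have "(\<Sum>e\<leftarrow>E. w g e) - (\<Sum>e\<leftarrow>D. w g e) + (\<Sum>e\<leftarrow>D. w h e) = (\<Sum>e\<leftarrow>E. min (w g e) (w h e))"
      unfolding D_def by (induction E) auto
    moreover have "(\<Sum>e\<leftarrow>E. w g e) = 1"
    proof -
      have "w g (\<lambda>x. \<Sum>e\<leftarrow>E. e x) = \<nu> (\<lambda>_. 1)"
        unfolding w_def using E g by (intro mean_cong[OF \<nu>]) (auto simp: decomp_def)
      then show ?thesis using w_sum[of E, OF _ g] mean_const[OF \<nu>] by simp
    qed
    moreover have "(\<Sum>e\<leftarrow>E. min (w g e) (w h e)) \<le> (\<Sum>e\<leftarrow>E. sqrt (w g e) * sqrt (w h e))"
    proof (rule sum_list_mono)
      fix e assume "e \<in> set E"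
      then have nn: "0 \<le> w g e" "0 \<le> w h e"
        using E_pos g h mean_translate_nonneg by (auto simp: w_def)
      define m where "m = min (w g e) (w h e)"
      have "m = sqrt m * sqrt m" using nn by (simp add: m_def)
      also have "\<dots> \<le> sqrt (w g e) * sqrt (w h e)"
        using nn by (intro mult_mono) (auto simp: m_def)
      finally show "min (w g e) (w h e) \<le> sqrt (w g e) * sqrt (w h e)" by (simp add: m_def)
    qed
    ultimately show ?thesis by linarith
  qed
  let ?n = "real (length hs)"
  have n: "0 < ?n" using hs(2) by simp
  have "?n\<^sup>2 * (3/10) = (\<Sum>g\<leftarrow>hs. \<Sum>h\<leftarrow>hs. 3/10)"
    by (simp add: sum_list_triv power2_eq_square)
  also have "\<dots> \<le> (\<Sum>g\<leftarrow>hs. \<Sum>h\<leftarrow>hs. \<Sum>e\<leftarrow>E. sqrt (w g e) * sqrt (w h e))"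
    using hs(1) pair by (intro sum_list_mono) auto
  also have "\<dots> = (\<Sum>e\<leftarrow>E. \<Sum>g\<leftarrow>hs. \<Sum>h\<leftarrow>hs. sqrt (w g e) * sqrt (w h e))"
    by (subst sum_list_swap[of _ E hs], subst sum_list_swap[of _ E hs]) (rule refl)
  also have "\<dots> = (\<Sum>e\<leftarrow>E. ?n\<^sup>2 * energy \<nu> hs e)"
    using n by (simp add: energy_def sum_list_square[symmetric] w_def power_divide)
  also have "\<dots> = ?n\<^sup>2 * (\<Sum>e\<leftarrow>E. energy \<nu> hs e)"
    by (simp add: sum_list_const_mult)
  finally show "3/10 \<le> (\<Sum>e\<leftarrow>E. energy \<nu> hs e)"
    using n by (simp add: mult_le_cancel_left_pos)
qed simp

text \<open>Let the average over \<open>hs\<close> have nearly minimal squared norm. Its translate by \<open>g\<close> has the same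
  norm, and so does, up to a small error, the midpoint of the two, because it is again an average.
  By the parallelogram law the two averages nearly coincide.\<close>

lemma almost_invariant_mean:
  assumes overlap: "\<And>f g h. f \<in> unit_valued \<Longrightarrow> g \<in> carrier G \<Longrightarrow> h \<in> carrier G \<Longrightarrow>
      \<nu> (\<lambda>x. f (g \<otimes> x)) \<le> \<nu> (\<lambda>x. f (h \<otimes> x)) + 7/10"
    and s: "0 < s"
  shows "\<exists>\<mu>\<in>M. \<forall>f\<in>unit_valued. \<forall>g\<in>carrier G. \<mu> (\<lambda>x. f (g \<otimes> x)) \<le> \<mu> f + 14 * s"
proof -
  define N where "N = {hs. set hs \<subseteq> carrier G \<and> hs \<noteq> []}"
  have "[\<one>] \<in> N" by (simp add: N_def)
  have ge: "3/10 \<le> least_energy hs (\<lambda>_. 1)" if "hs \<in> N" for hs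
    using least_energy_1_ge[OF overlap] that unfolding N_def by blast
  have sup: "superadditive (energy \<nu> hs)" if "hs \<in> N" for hs
    using that energy_superadditive by (simp add: N_def)
  define r where "r = (INF hs\<in>N. least_energy hs (\<lambda>_. 1))"
  have r_le: "r \<le> least_energy hs (\<lambda>_. 1)" if "hs \<in> N" for hs
    unfolding r_def using ge that by (intro cINF_lower bdd_belowI2[of _ "3/10"])
  have "\<exists>hs\<in>N. least_energy hs (\<lambda>_. 1) < r + s\<^sup>2"
  proof (rule ccontr)
    assume "\<not> ?thesis"
    then have "r + s\<^sup>2 \<le> (INF hs\<in>N. least_energy hs (\<lambda>_. 1))"
      using \<open>[\<one>] \<in> N\<close> by (intro cINF_greatest) (auto simp: not_less)
    then show False using s by (simp add: r_def[symmetric])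
  qed
  then obtain hs where hs: "hs \<in> N" "least_energy hs (\<lambda>_. 1) < r + s\<^sup>2" by blast
  then have hs_car: "set hs \<subseteq> carrier G" "hs \<noteq> []" by (auto simp: N_def)
  note add = minorant_add[OF sup] and nonneg = minorant_nonneg[OF sup]
  let ?L = "least_energy hs"
  have l: "3/10 \<le> ?L (\<lambda>_. 1)" using ge hs(1) by blast
  then have "0 < ?L (\<lambda>_. 1)" by linarith
  then have "\<exists>\<mu>\<in>M. \<forall>f\<in>pos_cone. \<mu> f = ?L f / ?L (\<lambda>_. 1)"
    using add[OF hs(1)] minorant_scale[OF sup[OF hs(1)]] nonneg[OF hs(1)]
    by (intro mean_of_additive)
  then obtain \<mu> where \<mu>: "\<mu> \<in> M" "\<And>f. f \<in> pos_cone \<Longrightarrow> \<mu> f = ?L f / ?L (\<lambda>_. 1)" by blast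
  have "\<mu> (\<lambda>x. f (g \<otimes> x)) \<le> \<mu> f + 14 * s" if f: "f \<in> unit_valued" and g: "g \<in> carrier G" for f g
  proof -
    define hs' where "hs' = map ((\<otimes>) g) hs"
    define hs'' where "hs'' = hs @ hs'"
    have N: "hs' \<in> N" "hs'' \<in> N" using hs_car g by (auto simp: N_def hs'_def hs''_def)
    let ?L' = "least_energy hs'" and ?L'' = "least_energy hs''"
    have U: "f \<in> U" and cone: "f \<in> pos_cone" "(\<lambda>x. 1 - f x) \<in> pos_cone" "(\<lambda>_. 1) \<in> pos_cone"
      using f by (auto simp: unit_valued_def pos_cone_def diff_closed)
    have split: "least_energy k (\<lambda>_. 1) = least_energy k f + least_energy k (\<lambda>x. 1 - f x)"
      if "k \<in> N" for k
      using add[OF that cone(1,2)] by simp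
    have "map ((\<otimes>) (inv g)) hs' = hs"
      using hs_car g unfolding hs'_def map_map by (intro map_idI) (auto simp: m_assoc[symmetric])
    then have L'1: "?L' (\<lambda>_. 1) \<le> ?L (\<lambda>_. 1)"
      using least_energy_translate[of hs' "inv g" "\<lambda>_. 1"] N(1) g cone(3) by (simp add: N_def)
    have "3/10 \<le> ?L'' (\<lambda>_. 1)" "r \<le> ?L'' (\<lambda>_. 1)" using ge r_le N by auto
    have avg: "energy \<nu> hs'' e = ((a + b) / 2)\<^sup>2" "energy \<nu> hs e = a\<^sup>2" "energy \<nu> hs' e = b\<^sup>2"
      if "a = (\<Sum>h\<leftarrow>hs. sqrt (\<nu> (\<lambda>x. e (h \<otimes> x)))) / real (length hs)"
         "b = (\<Sum>h\<leftarrow>hs'. sqrt (\<nu> (\<lambda>x. e (h \<otimes> x)))) / real (length hs)" for a b e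
      unfolding that by (simp_all add: energy_def hs''_def hs'_def add_divide_distrib mult.commute)
    have parallelogram: "0 * b\<^sup>2 + 2 * ((a + b)/2)\<^sup>2 \<le> 1 * a\<^sup>2 + 1 * b\<^sup>2" for a b :: real
      using zero_le_power2[of "a - b"] by (simp add: power2_eq_square field_simps)
    have "0 * ?L' u + 2 * ?L'' u \<le> 1 * ?L u + 1 * ?L' u" if "u \<in> pos_cone" for u
    proof (rule minorant_compare[OF sup sup sup _ _ _ _ _ that])
      fix e
      show "0 * energy \<nu> hs' e + 2 * energy \<nu> hs'' e \<le> 1 * energy \<nu> hs e + 1 * energy \<nu> hs' e"
        unfolding avg[OF refl refl] using parallelogram .
    qed (use hs(1) N in auto)
    then have "2 * ?L'' (\<lambda>x. 1 - f x) \<le> ?L (\<lambda>x. 1 - f x) + ?L' (\<lambda>x. 1 - f x)"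
      using cone(2) by simp
    then have defect: "?L f + ?L' f - 2 * ?L'' f \<le> 2 * s\<^sup>2"
      using split[OF hs(1)] split[OF N(1)] split[OF N(2)] L'1 hs(2) r_le[OF N(2)] by linarith
    \<comment> \<open>The next inequality bounds \<open>b\<^sup>2 - a\<^sup>2 = (b - a) (b + a)\<close> by \<open>(a - b)\<^sup>2 / (2 s) + s (a + b)\<^sup>2 / 2\<close>, where
      the first square is the defect in the parallelogram law.\<close>
    have "1 * ?L' f + (2/s) * ?L'' f \<le> (1 + 1/s + s) * ?L f + (1/s + s) * ?L' f"
    proof (rule minorant_compare[OF sup sup sup _ _ _ _ _ cone(1)])
      fix e
      have "1 * b\<^sup>2 + (2/s) * ((a + b)/2)\<^sup>2 \<le> (1 + 1/s + s) * a\<^sup>2 + (1/s + s) * b\<^sup>2" for a b :: real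
      proof -
        have "0 \<le> ((a - b) + s * (a + b))\<^sup>2 / (2 * s) + s * (a - b)\<^sup>2 / 2" using s by simp
        also have "\<dots> = (1 + 1/s + s) * a\<^sup>2 + (1/s + s) * b\<^sup>2 - (1 * b\<^sup>2 + (2/s) * ((a + b)/2)\<^sup>2)"
          using s by (simp add: field_simps power2_eq_square)
        finally show ?thesis by simp
      qed
      then show "1 * energy \<nu> hs' e + (2/s) * energy \<nu> hs'' e
          \<le> (1 + 1/s + s) * energy \<nu> hs e + (1/s + s) * energy \<nu> hs' e"
        unfolding avg[OF refl refl] .
    qed (use hs(1) N s in auto)
    then have "?L' f \<le> ?L f + (?L f + ?L' f - 2 * ?L'' f) / s + s * (?L f + ?L' f)"
      by (simp add: algebra_simps add_divide_distrib diff_divide_distrib)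
    also have "\<dots> \<le> ?L f + (2 * s\<^sup>2) / s + s * (1 + 1)"
      using s defect least_energy_le_1[OF hs_car(1) f] least_energy_le_1[of hs' f] N(1) f
      by (intro add_mono mult_left_mono divide_right_mono) (auto simp: N_def)
    also have "\<dots> = ?L f + 4 * s" using s by (simp add: power2_eq_square)
    finally have "?L (\<lambda>x. f (g \<otimes> x)) \<le> ?L f + 4 * s"
      using least_energy_translate[OF hs_car(1) g cone(1)] by (simp add: hs'_def)
    then have "?L (\<lambda>x. f (g \<otimes> x)) / ?L (\<lambda>_. 1) \<le> (?L f + 4 * s) / ?L (\<lambda>_. 1)"
      using l by (intro divide_right_mono) auto
    also have "\<dots> \<le> ?L f / ?L (\<lambda>_. 1) + 14 * s"
    proof -
      \<comment> \<open>Here \<open>4 / (3/10) < 14\<close>, as the total mass is at least \<open>3/10\<close>.\<close>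
      have "4 * s \<le> 14 * s * ?L (\<lambda>_. 1)" using l s mult_left_mono[OF l, of "14 * s"] by simp
      then have "4 * s / ?L (\<lambda>_. 1) \<le> 14 * s"
        using l by (subst pos_divide_le_eq) auto
      then show ?thesis by (simp add: add_divide_distrib)
    qed
    finally show ?thesis
      using \<mu>(2)[OF cone(1)] \<mu>(2)[of "\<lambda>x. f (g \<otimes> x)"] cone(1) U g
      by (simp add: pos_cone_def translate)
  qed
  then show ?thesis using \<mu>(1) by blast
qed

end

text \<open>The shortest vector of the convex hull of the half densities is the limit of the nearly shortest ones;
  compactness of the set of means replaces the completeness of the Hilbert space.\<close>

theorem invariant_mean_of_overlap:
  assumes \<nu>: "\<nu> \<in> M"
    and overlap: "\<And>f g h. f \<in> unit_valued \<Longrightarrow> g \<in> carrier G \<Longrightarrow> h \<in> carrier G \<Longrightarrow>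
      \<nu> (\<lambda>x. f (g \<otimes> x)) \<le> \<nu> (\<lambda>x. f (h \<otimes> x)) + 7/10"
  shows "\<exists>\<mu>\<in>M. \<forall>f\<in>U. \<forall>g\<in>carrier G. \<mu> (\<lambda>x. f (g \<otimes> x)) = \<mu> f"
proof -
  define T where "T = unit_valued \<times> carrier G \<times> {0::real<..}"
  define cmp where "cmp = (\<lambda>(f::'g \<Rightarrow> real, g, \<epsilon>::real). (\<lambda>x. f (g \<otimes> x), f, \<epsilon>))"
  have "\<exists>\<mu>\<in>M. \<forall>(f, h, c)\<in>cmp ` T. \<mu> f \<le> \<mu> h + c"
  proof (rule means_compactness)
    fix R' assume "finite R'" "R' \<subseteq> cmp ` T"
    then obtain T' where T': "T' \<subseteq> T" "finite T'" "R' = cmp ` T'"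
      by (meson finite_subset_image)
    define \<epsilon> where "\<epsilon> = Min (insert 1 ((\<lambda>(f, g, \<epsilon>). \<epsilon>) ` T'))"
    have \<epsilon>: "0 < \<epsilon>" "\<And>f g c. (f, g, c) \<in> T' \<Longrightarrow> \<epsilon> \<le> c"
    proof -
      show "0 < \<epsilon>" unfolding \<epsilon>_def using T' by (subst Min_gr_iff) (auto simp: T_def)
      show "\<epsilon> \<le> c" if "(f, g, c) \<in> T'" for f g c
        unfolding \<epsilon>_def using that T'(2) by (intro Min_le) force+
    qed
    then obtain \<mu> where \<mu>: "\<mu> \<in> M" "\<And>f g. f \<in> unit_valued \<Longrightarrow> g \<in> carrier G \<Longrightarrow>
        \<mu> (\<lambda>x. f (g \<otimes> x)) \<le> \<mu> f + 14 * (\<epsilon>/14)"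
      using almost_invariant_mean[OF \<nu> overlap, of "\<epsilon>/14"] by auto
    have "\<mu> (\<lambda>x. f (g \<otimes> x)) \<le> \<mu> f + c" if "(f, g, c) \<in> T'" for f g c
    proof -
      have "f \<in> unit_valued" "g \<in> carrier G" using T'(1) that by (auto simp: T_def)
      from \<mu>(2)[OF this] \<epsilon>(2)[OF that] show ?thesis by simp
    qed
    then show "\<exists>\<mu>\<in>M. \<forall>(f, h, c)\<in>R'. \<mu> f \<le> \<mu> h + c"
      using \<mu>(1) T'(3) by (intro bexI[of _ \<mu>]) (auto simp: cmp_def)
  next
    fix f h c assume "(f, h, c) \<in> cmp ` T"
    then show "f \<in> U \<and> h \<in> U"
      by (auto simp: cmp_def T_def unit_valued_def translate)
  qed
  then obtain \<mu> where \<mu>: "\<mu> \<in> M" and cmp: "\<forall>(f, h, c)\<in>cmp ` T. \<mu> f \<le> \<mu> h + c"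
    by (rule bexE)
  have le: "\<mu> (\<lambda>x. f (g \<otimes> x)) \<le> \<mu> f" if "f \<in> unit_valued" "g \<in> carrier G" for f g
  proof (rule field_le_epsilon)
    fix \<epsilon> :: real assume "0 < \<epsilon>"
    then have "cmp (f, g, \<epsilon>) \<in> cmp ` T" using that by (simp add: T_def)
    from bspec[OF cmp this] show "\<mu> (\<lambda>x. f (g \<otimes> x)) \<le> \<mu> f + \<epsilon>" by (simp add: cmp_def)
  qed
  have eq: "\<mu> (\<lambda>x. f (g \<otimes> x)) = \<mu> f" if f: "f \<in> unit_valued" and g: "g \<in> carrier G" for f g
  proof (rule antisym[OF le[OF f g]])
    have fU: "f \<in> U" using f by (simp add: unit_valued_def)
    have "\<mu> f = \<mu> (\<lambda>x. f (g \<otimes> (inv g \<otimes> x)))"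
      using g by (intro mean_cong[OF \<mu> fU, symmetric]) (simp add: m_assoc[symmetric])
    also have "\<dots> \<le> \<mu> (\<lambda>x. f (g \<otimes> x))"
      using f g by (intro le[of "\<lambda>x. f (g \<otimes> x)"]) (auto simp: unit_valued_def translate)
    finally show "\<mu> f \<le> \<mu> (\<lambda>x. f (g \<otimes> x))" .
  qed
  have "\<mu> (\<lambda>x. f (g \<otimes> x)) = \<mu> f" if f: "f \<in> U" and g: "g \<in> carrier G" for f g
  proof -
    obtain c where c: "0 \<le> c" "\<And>x. x \<in> carrier G \<Longrightarrow> \<bar>f x\<bar> \<le> c"
      using sup_bound[OF f] by metis
    define d where "d = 2 * c + 1"
    have d: "0 < d" using c(1) by (simp add: d_def)
    define h where "h = (\<lambda>x. (1/d) * f x + c/d)"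
    have hU: "h \<in> U" unfolding h_def by (intro add_closed scale_closed const_closed f)
    have "0 \<le> h x \<and> h x \<le> 1" if "x \<in> carrier G" for x
      using c(2)[OF that] d by (auto simp: h_def abs_le_iff field_simps) (simp_all add: d_def)
    then have h: "h \<in> unit_valued" using hU by (simp add: unit_valued_def)
    have "\<mu> (\<lambda>x. (1/d) * u x + c/d) = (1/d) * \<mu> u + c/d" if "u \<in> U" for u
      using mean_add[OF \<mu> scale_closed[OF that] const_closed] mean_scale[OF \<mu> that] mean_const[OF \<mu>]
      by metis
    from this[OF f] this[OF translate[OF f g]] eq[OF h g] show ?thesis
      using d by (simp add: h_def)
  qed
  then show ?thesis using \<mu> by blast
qed

end

section \<open>Means and finite averages\<close>

context function_lattice
begin

text \<open>A convex-hull argument without separation theorems: choosing the points one by one, each so that it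
  points, up to a constant, away from the error accumulated so far, the squared error grows at most
  linearly in the number of points, and the average error tends to zero.\<close>

lemma finite_average_approximation:
  assumes \<nu>: "\<nu> \<in> means X U" and J: "finite J" and h: "\<And>j. j \<in> J \<Longrightarrow> h j \<in> U" and \<epsilon>: "0 < \<epsilon>"
  shows "\<exists>N x. 0 < N \<and> (\<forall>i<N. x i \<in> X) \<and>
    (\<forall>j\<in>J. \<bar>(\<Sum>i<N. h j (x i)) / real N - \<nu> (h j)\<bar> \<le> \<epsilon>)"
proof -
  have "\<exists>c. 0 \<le> c \<and> (\<forall>x\<in>X. \<bar>h j x\<bar> \<le> c)" if "j \<in> J" for j
    using sup_bound[OF h[OF that]] by metis
  then obtain b where b: "\<And>j x. j \<in> J \<Longrightarrow> x \<in> X \<Longrightarrow> \<bar>h j x\<bar> \<le> b j" by metis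
  define d where "d = (\<lambda>j x. h j x - \<nu> (h j))"
  have d_le: "(d j x)\<^sup>2 \<le> (2 * b j)\<^sup>2" if "j \<in> J" "x \<in> X" for j x
  proof -
    have "\<bar>\<nu> (h j)\<bar> \<le> b j" using mean_bound[OF \<nu> h b] that by blast
    then have "\<bar>d j x\<bar> \<le> 2 * b j" using b[OF that] by (simp add: d_def)
    then show ?thesis using power_mono[of "\<bar>d j x\<bar>" "2 * b j" 2] by simp
  qed
  define C where "C = (\<Sum>j\<in>J. (2 * b j)\<^sup>2)"
  have C: "0 \<le> C" unfolding C_def by (intro sum_nonneg) auto
  \<comment> \<open>The mean of \<open>\<Sum>j. s j * d j\<close> vanishes, so this function cannot exceed \<open>1\<close> everywhere.\<close>
  have pick: "\<exists>x\<in>X. (\<Sum>j\<in>J. s j * d j x) \<le> 1" for s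
  proof (rule ccontr)
    assume "\<not> ?thesis"
    then have gt: "1 \<le> (\<Sum>j\<in>J. s j * d j x)" if "x \<in> X" for x using that by force
    have dU: "(\<lambda>x. s j * d j x) \<in> U" if "j \<in> J" for j
      unfolding d_def by (intro scale_closed diff_closed h that const_closed)
    have "\<nu> (\<lambda>_. 1) \<le> \<nu> (\<lambda>x. \<Sum>j\<in>J. s j * d j x)"
      using gt by (intro mean_mono[OF \<nu> const_closed sum_in[OF J]] dU)
    also have "\<dots> = (\<Sum>j\<in>J. \<nu> (\<lambda>x. s j * d j x))"
      by (intro mean_sum[OF \<nu> J] dU)
    also have "\<dots> = (\<Sum>j\<in>J. s j * (\<nu> (h j) - \<nu> (\<lambda>_. \<nu> (h j))))"
      unfolding d_def
      by (intro sum.cong refl) (simp add: mean_scale[OF \<nu>] mean_diff[OF \<nu>] h diff_closed)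
    finally show False by (simp add: mean_const[OF \<nu>])
  qed
  have "\<exists>xs. length xs = n \<and> set xs \<subseteq> X \<and> (\<Sum>j\<in>J. (\<Sum>x\<leftarrow>xs. d j x)\<^sup>2) \<le> real n * (C + 2)" for n
  proof (induction n)
    case (Suc n)
    then obtain xs where xs: "length xs = n" "set xs \<subseteq> X"
      "(\<Sum>j\<in>J. (\<Sum>x\<leftarrow>xs. d j x)\<^sup>2) \<le> real n * (C + 2)" by blast
    obtain x where x: "x \<in> X" "(\<Sum>j\<in>J. (\<Sum>x\<leftarrow>xs. d j x) * d j x) \<le> 1"
      using pick[of "\<lambda>j. \<Sum>x\<leftarrow>xs. d j x"] by blast
    have "(\<Sum>j\<in>J. (\<Sum>x\<leftarrow>x # xs. d j x)\<^sup>2) =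
        (\<Sum>j\<in>J. (\<Sum>x\<leftarrow>xs. d j x)\<^sup>2) + 2 * (\<Sum>j\<in>J. (\<Sum>x\<leftarrow>xs. d j x) * d j x) + (\<Sum>j\<in>J. (d j x)\<^sup>2)"
      by (simp add: sum.distrib[symmetric] sum_distrib_left power2_eq_square algebra_simps)
    also have "\<dots> \<le> real n * (C + 2) + 2 * 1 + C"
      unfolding C_def using xs x d_le by (intro add_mono mult_left_mono sum_mono) (auto simp: C_def)
    also have "\<dots> = real (Suc n) * (C + 2)" by (simp add: algebra_simps)
    finally show ?case using xs x by (intro exI[of _ "x # xs"]) auto
  qed simp
  moreover obtain N :: nat where N: "(C + 2) / \<epsilon>\<^sup>2 < real N" using reals_Archimedean2 by blast
  ultimately obtain xs where xs: "length xs = N" "set xs \<subseteq> X"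
    "(\<Sum>j\<in>J. (\<Sum>x\<leftarrow>xs. d j x)\<^sup>2) \<le> real N * (C + 2)" by blast
  have N0: "0 < real N" using N C \<epsilon> by (smt (verit) divide_pos_pos zero_less_power)
  have "\<bar>(\<Sum>i<N. h j (xs ! i)) / real N - \<nu> (h j)\<bar> \<le> \<epsilon>" if "j \<in> J" for j
  proof -
    define t where "t = (\<Sum>x\<leftarrow>xs. d j x)"
    have t: "t = (\<Sum>i<N. h j (xs ! i)) - real N * \<nu> (h j)"
      unfolding t_def d_def using xs(1)
      by (simp add: sum_list_sum_nth atLeast0LessThan sum_subtractf)
    have "t\<^sup>2 \<le> (\<Sum>j\<in>J. (\<Sum>x\<leftarrow>xs. d j x)\<^sup>2)"
      unfolding t_def using J that by (intro member_le_sum) auto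
    also have "\<dots> \<le> real N * (C + 2)" by (rule xs(3))
    also have "\<dots> \<le> real N * (real N * \<epsilon>\<^sup>2)"
      using N \<epsilon> by (intro mult_left_mono) (auto simp: field_simps)
    finally have "t\<^sup>2 \<le> (real N * \<epsilon>)\<^sup>2" by (simp add: power2_eq_square algebra_simps)
    then have "\<bar>t\<bar> \<le> real N * \<epsilon>" using \<epsilon> by (simp add: abs_le_square_iff[symmetric])
    moreover have "(\<Sum>i<N. h j (xs ! i)) / real N - \<nu> (h j) = t / real N"
      using N0 by (simp add: t field_simps)
    ultimately show ?thesis using N0 by (simp add: field_simps)
  qed
  then show ?thesis
    using N0 xs(1,2) by (intro exI[of _ N] exI[of _ "\<lambda>i. xs ! i"]) (auto simp: subset_eq)
qed

end

context translation_lattice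
begin

text \<open>The samples come for finitely many translates at a time, with an error \<open>\<epsilon>\<close>; both restrictions are
  removed by compactness.\<close>

lemma levels_of_samples:
  assumes f: "f \<in> unit_valued"
    and samples: "\<And>S \<epsilon>. finite S \<Longrightarrow> S \<subseteq> carrier G \<Longrightarrow> 0 < \<epsilon> \<Longrightarrow>
      \<exists>(F::nat set) x. finite F \<and> F \<noteq> {} \<and> x \<in> F \<rightarrow> carrier G \<and>
        (\<forall>g\<in>S. \<forall>h\<in>S. real (card {i\<in>F. 13/20 < f (g \<otimes> x i)}) \<le>
           real (card {i\<in>F. 7/20 \<le> f (h \<otimes> x i)}) + \<epsilon> * real (card F))"
  shows "\<exists>\<mu>\<in>M. \<forall>g\<in>carrier G. \<forall>h\<in>carrier G.
      \<mu> (\<lambda>x. upper_level f (g \<otimes> x)) \<le> \<mu> (\<lambda>x. lower_level f (h \<otimes> x))"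
proof -
  have fU: "f \<in> U" using f by (simp add: unit_valued_def)
  define T where "T = carrier G \<times> carrier G \<times> {0::real<..}"
  define cmp where "cmp = (\<lambda>(g, h, \<epsilon>::real).
    (\<lambda>x. upper_level f (g \<otimes> x), \<lambda>x. lower_level f (h \<otimes> x), \<epsilon>))"
  have "\<exists>\<mu>\<in>M. \<forall>(f, h, c)\<in>cmp ` T. \<mu> f \<le> \<mu> h + c"
  proof (rule means_compactness)
    fix R' assume "finite R'" "R' \<subseteq> cmp ` T"
    then obtain T' where T': "T' \<subseteq> T" "finite T'" "R' = cmp ` T'"
      by (meson finite_subset_image)
    define \<epsilon> where "\<epsilon> = Min (insert 1 ((\<lambda>(f, g, \<epsilon>). \<epsilon>) ` T'))"
    have \<epsilon>: "0 < \<epsilon>" "\<And>g h c. (g, h, c) \<in> T' \<Longrightarrow> \<epsilon> \<le> c"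
    proof -
      show "0 < \<epsilon>" unfolding \<epsilon>_def using T' by (subst Min_gr_iff) (auto simp: T_def)
      show "\<epsilon> \<le> c" if "(g, h, c) \<in> T'" for g h c
        unfolding \<epsilon>_def using that T'(2) by (intro Min_le) force+
    qed
    define S where "S = fst ` T' \<union> (fst \<circ> snd) ` T'"
    have S: "finite S" "S \<subseteq> carrier G" "\<And>g h c. (g, h, c) \<in> T' \<Longrightarrow> g \<in> S \<and> h \<in> S"
      using T' by (force simp: S_def T_def)+
    from samples[OF S(1,2) \<epsilon>(1)] obtain F :: "nat set" and x where F: "finite F" "F \<noteq> {}" "x \<in> F \<rightarrow> carrier G"
      "\<And>g h. g \<in> S \<Longrightarrow> h \<in> S \<Longrightarrow> real (card {i\<in>F. 13/20 < f (g \<otimes> x i)}) \<le>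
           real (card {i\<in>F. 7/20 \<le> f (h \<otimes> x i)}) + \<epsilon> * real (card F)"
      by blast
    define \<mu> where "\<mu> = (\<lambda>f. (\<Sum>i\<in>F. f (x i)) / real (card F))"
    have n: "0 < real (card F)" using F by (simp add: card_gt_0_iff)
    have "\<mu> (\<lambda>x. upper_level f (g \<otimes> x)) \<le> \<mu> (\<lambda>x. lower_level f (h \<otimes> x)) + c"
      if "(g, h, c) \<in> T'" for g h c
    proof -
      have "(\<Sum>i\<in>F. upper_level f (g \<otimes> x i)) \<le> (\<Sum>i\<in>F. if 13/20 < f (g \<otimes> x i) then 1 else 0)"
        by (intro sum_mono) (auto simp: upper_level_def)
      also have "\<dots> = real (card {i\<in>F. 13/20 < f (g \<otimes> x i)})"
        using F(1) by (simp add: sum.If_cases Int_def)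
      also have "\<dots> \<le> real (card {i\<in>F. 7/20 \<le> f (h \<otimes> x i)}) + \<epsilon> * real (card F)"
        using F(4) S(3)[OF that] by blast
      also have "real (card {i\<in>F. 7/20 \<le> f (h \<otimes> x i)}) = (\<Sum>i\<in>F. if 7/20 \<le> f (h \<otimes> x i) then 1 else 0)"
        using F(1) by (simp add: sum.If_cases Int_def)
      also have "\<dots> \<le> (\<Sum>i\<in>F. lower_level f (h \<otimes> x i))"
        by (intro sum_mono) (auto simp: lower_level_def)
      also have "\<epsilon> * real (card F) \<le> c * real (card F)"
        using \<epsilon>(2)[OF that] by (intro mult_right_mono) auto
      finally have "(\<Sum>i\<in>F. upper_level f (g \<otimes> x i)) \<le> (\<Sum>i\<in>F. lower_level f (h \<otimes> x i)) + c * real (card F)"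
        by simp
      then show ?thesis using n by (simp add: \<mu>_def field_simps)
    qed
    moreover have "\<mu> \<in> M" unfolding \<mu>_def using F by (intro finite_average_mean) auto
    ultimately show "\<exists>\<mu>\<in>M. \<forall>(f, h, c)\<in>R'. \<mu> f \<le> \<mu> h + c"
      using T'(3) by (intro bexI[of _ \<mu>]) (auto simp: cmp_def)
  next
    fix u v c assume "(u, v, c) \<in> cmp ` T"
    then show "u \<in> U \<and> v \<in> U"
      by (auto simp: cmp_def T_def translate[OF levels_in(1)[OF fU]] translate[OF levels_in(2)[OF fU]])
  qed
  then obtain \<mu> where \<mu>: "\<mu> \<in> M" and cmp: "\<forall>(f, h, c)\<in>cmp ` T. \<mu> f \<le> \<mu> h + c"
    by (rule bexE)
  show ?thesis
  proof (intro bexI[OF _ \<mu>] ballI)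
    fix g h assume gh: "g \<in> carrier G" "h \<in> carrier G"
    show "\<mu> (\<lambda>x. upper_level f (g \<otimes> x)) \<le> \<mu> (\<lambda>x. lower_level f (h \<otimes> x))"
    proof (rule field_le_epsilon)
      fix \<epsilon> :: real assume "0 < \<epsilon>"
      then have "cmp (g, h, \<epsilon>) \<in> cmp ` T" using gh by (simp add: T_def)
      from bspec[OF cmp this]
      show "\<mu> (\<lambda>x. upper_level f (g \<otimes> x)) \<le> \<mu> (\<lambda>x. lower_level f (h \<otimes> x)) + \<epsilon>"
        by (simp add: cmp_def)
    qed
  qed
qed

theorem invariant_mean_of_samples:
  assumes "\<And>f S \<epsilon>. f \<in> unit_valued \<Longrightarrow> finite S \<Longrightarrow> S \<subseteq> carrier G \<Longrightarrow> 0 < \<epsilon> \<Longrightarrow>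
      \<exists>(F::nat set) x. finite F \<and> F \<noteq> {} \<and> x \<in> F \<rightarrow> carrier G \<and>
        (\<forall>g\<in>S. \<forall>h\<in>S. real (card {i\<in>F. 13/20 < f (g \<otimes> x i)}) \<le>
           real (card {i\<in>F. 7/20 \<le> f (h \<otimes> x i)}) + \<epsilon> * real (card F))"
  shows "\<exists>\<mu>\<in>M. \<forall>f\<in>U. \<forall>g\<in>carrier G. \<mu> (\<lambda>x. f (g \<otimes> x)) = \<mu> f"
proof -
  have "\<exists>\<mu>\<in>M. balanced \<mu> f" if f: "f \<in> unit_valued" for f
    using levels_of_samples[OF f assms[OF f]] balanced_of_levels[OF f] by blast
  from overlapping_mean[OF this] invariant_mean_of_overlap show ?thesis by blast
qed

end

section \<open>Partial matchings\<close>

text \<open>The argument of Halmos and Vaughan: if a proper subfamily is critical, match it first and then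
  the others outside of its neighbours; otherwise any single choice leaves Hall's condition intact.\<close>

lemma hall_marriage:
  assumes "finite I" "\<And>i. i \<in> I \<Longrightarrow> finite (A i)"
    and "\<And>S. S \<subseteq> I \<Longrightarrow> card S \<le> card (\<Union>i\<in>S. A i)"
  shows "\<exists>m. inj_on m I \<and> (\<forall>i\<in>I. m i \<in> A i)"
  using assms
proof (induction "card I" arbitrary: I A rule: less_induct)
  case less
  note fin = less.prems(1,2) and hall = less.prems(3)
  have finU: "finite (\<Union>i\<in>S. A i)" if "S \<subseteq> I" for S
    using that fin by (auto intro: finite_subset)
  show ?case
  proof (cases "\<exists>S. S \<subset> I \<and> S \<noteq> {} \<and> card (\<Union>i\<in>S. A i) \<le> card S")
    case True
    then obtain S where S: "S \<subset> I" "S \<noteq> {}" "card (\<Union>i\<in>S. A i) \<le> card S" by blast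
    define B where "B = (\<Union>i\<in>S. A i)"
    have finS: "finite S" using S(1) fin(1) by (meson finite_subset psubsetE)
    have "card S < card I" using S(1) fin(1) by (rule psubset_card_mono[rotated])
    then obtain m1 where m1: "inj_on m1 S" "\<forall>i\<in>S. m1 i \<in> A i"
      using less.hyps[of S A] S(1) finS fin(2) hall by (metis psubsetE subset_iff subset_trans)
    have "\<exists>m2. inj_on m2 (I - S) \<and> (\<forall>i\<in>I - S. m2 i \<in> A i - B)"
    proof (rule less.hyps)
      show "card (I - S) < card I"
        using S fin(1) by (intro psubset_card_mono) auto
      fix T assume T: "T \<subseteq> I - S"
      have "finite T" using T fin(1) by (meson finite_Diff finite_subset)
      have "card T + card S = card (T \<union> S)"
        using T \<open>finite T\<close> finS by (subst card_Un_disjoint) auto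
      also have "\<dots> \<le> card (\<Union>i\<in>T \<union> S. A i)" using T S(1) by (intro hall) auto
      also have "(\<Union>i\<in>T \<union> S. A i) = (\<Union>i\<in>T. A i - B) \<union> B" by (auto simp: B_def)
      also have "card \<dots> \<le> card (\<Union>i\<in>T. A i - B) + card B" by (rule card_Un_le)
      finally show "card T \<le> card (\<Union>i\<in>T. A i - B)" using S(3) by (simp add: B_def)
    qed (use fin in auto)
    then obtain m2 where m2: "inj_on m2 (I - S)" "\<forall>i\<in>I - S. m2 i \<in> A i - B" by blast
    define m where "m = (\<lambda>i. if i \<in> S then m1 i else m2 i)"
    have in_B: "m1 i \<in> B" if "i \<in> S" for i using m1(2) that by (auto simp: B_def)
    have not_B: "m2 i \<notin> B" if "i \<in> I - S" for i using m2(2) that by blast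
    have "inj_on m I"
    proof (rule inj_onI)
      fix i j assume ij: "i \<in> I" "j \<in> I" "m i = m j"
      show "i = j"
      proof (cases "i \<in> S"; cases "j \<in> S")
        assume "i \<in> S" "j \<in> S"
        then show ?thesis using ij(3) inj_onD[OF m1(1)] by (simp add: m_def)
      next
        assume "i \<notin> S" "j \<notin> S"
        then show ?thesis using ij inj_onD[OF m2(1)] by (simp add: m_def)
      next
        assume "i \<in> S" "j \<notin> S"
        then show ?thesis using ij in_B[of i] not_B[of j] by (simp add: m_def)
      next
        assume "i \<notin> S" "j \<in> S"
        then show ?thesis using ij in_B[of j] not_B[of i] by (simp add: m_def)
      qed
    qed
    then show ?thesis
      using m1(2) m2(2) by (intro exI[of _ m]) (auto simp: m_def)
  next
    case False
    show ?thesis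
    proof (cases "I = {}")
      case False': False
      then obtain i where i: "i \<in> I" by blast
      have "A i \<noteq> {}" using hall[of "{i}"] i by auto
      then obtain a where a: "a \<in> A i" by blast
      have "\<exists>m. inj_on m (I - {i}) \<and> (\<forall>j\<in>I - {i}. m j \<in> A j - {a})"
      proof (rule less.hyps)
        show "card (I - {i}) < card I" using i fin(1) by (intro card_Diff1_less)
        fix T assume T: "T \<subseteq> I - {i}"
        show "card T \<le> card (\<Union>j\<in>T. A j - {a})"
        proof (cases "T = {}")
          case nonempty: False
          have "T \<subset> I" using T i by blast
          then have "card T < card (\<Union>j\<in>T. A j)" using False nonempty by (simp add: not_le) blast
          moreover have "(\<Union>j\<in>T. A j - {a}) = (\<Union>j\<in>T. A j) - {a}" by blast
          moreover have "card (\<Union>j\<in>T. A j) - 1 \<le> card ((\<Union>j\<in>T. A j) - {a})"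
            by (simp add: card_Diff_singleton_if)
          ultimately show ?thesis by simp
        qed simp
      qed (use fin in auto)
      then obtain m where m: "inj_on m (I - {i})" "\<forall>j\<in>I - {i}. m j \<in> A j - {a}" by blast
      have "inj_on (m(i := a)) I"
        using m unfolding inj_on_def by auto
      then show ?thesis
        using m(2) a by (intro exI[of _ "m(i := a)"]) auto
    qed simp
  qed
qed

lemma partial_matching:
  assumes F: "finite F"
    and hall: "\<And>S. S \<subseteq> F \<Longrightarrow> card S \<le> card {y\<in>F. \<exists>x\<in>S. r x y} + d"
  shows "\<exists>D m. D \<subseteq> F \<and> m \<in> D \<rightarrow> F \<and> inj_on m D \<and> (\<forall>x\<in>D. r x (m x)) \<and> card F \<le> card D + d"
proof -
  \<comment> \<open>\<open>d\<close> dummy partners absorb the deficiency.\<close>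
  define A where "A = (\<lambda>x. Inl ` {y\<in>F. r x y} \<union> Inr ` {..<d})"
  have "\<exists>m. inj_on m F \<and> (\<forall>x\<in>F. m x \<in> A x)"
  proof (rule hall_marriage[OF F])
    fix S assume S: "S \<subseteq> F"
    show "card S \<le> card (\<Union>x\<in>S. A x)"
    proof (cases "S = {}")
      case False
      then have "(\<Union>x\<in>S. A x) = Inl ` {y\<in>F. \<exists>x\<in>S. r x y} \<union> Inr ` {..<d}"
        by (auto simp: A_def)
      moreover have "card \<dots> = card {y\<in>F. \<exists>x\<in>S. r x y} + d"
        using F by (subst card_Un_disjoint) (auto simp: card_image)
      ultimately show ?thesis using hall[OF S] by simp
    qed simp
  qed (use F in \<open>auto simp: A_def\<close>)
  then obtain m where m: "inj_on m F" "\<And>x. x \<in> F \<Longrightarrow> m x \<in> A x" by blast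
  define D where "D = {x\<in>F. isl (m x)}"
  have D: "D \<subseteq> F" by (auto simp: D_def)
  have val: "m x = Inl (projl (m x)) \<and> projl (m x) \<in> F \<and> r x (projl (m x))" if "x \<in> D" for x
    using m(2)[of x] that by (auto simp: D_def A_def)
  have "inj_on (projl \<circ> m) D"
    using m(1) val D unfolding inj_on_def o_def by (metis subsetD)
  moreover have "m ` (F - D) \<subseteq> Inr ` {..<d}"
    using m(2) by (fastforce simp: D_def A_def)
  then have "card (m ` (F - D)) \<le> d"
    by (metis card_image_le card_lessThan card_mono finite_imageI finite_lessThan le_trans)
  then have "card (F - D) \<le> d"
    using m(1) by (subst (asm) card_image) (auto intro: inj_on_subset)
  then have "card F \<le> card D + d"
    using F D by (simp add: card_Diff_subset finite_subset)
  ultimately show ?thesis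
    using D val by (intro exI[of _ D] exI[of _ "projl \<circ> m"]) auto
qed

section \<open>Morphisms and finite substructures\<close>

lemma ldist_self [simp]: "x \<in> univ A \<Longrightarrow> ldist A x x = 0"
  by simp

lemma Mor_in: "\<alpha> \<in> Mor L A B \<Longrightarrow> x \<in> univ A \<Longrightarrow> \<alpha> x \<in> univ B"
  by (auto simp: Mor_def)

lemma Mor_dist: "\<alpha> \<in> Mor L A B \<Longrightarrow> x \<in> univ A \<Longrightarrow> y \<in> univ A \<Longrightarrow> ldist B (\<alpha> x) (\<alpha> y) = ldist A x y"
  by (auto simp: Mor_def)

lemma Mor_rel: "\<alpha> \<in> Mor L A B \<Longrightarrow> R \<in> symbols L \<Longrightarrow> xs \<in> tuples (univ A) (arity L R) \<Longrightarrow>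
    lrel B R (map \<alpha> xs) = lrel A R xs"
  by (auto simp: Mor_def)

lemma Mor_extensional: "\<alpha> \<in> Mor L A B \<Longrightarrow> \<alpha> \<in> extensional (univ A)"
  by (auto simp: Mor_def PiE_def)

lemma Mor_inj: assumes "\<alpha> \<in> Mor L A B" shows "inj_on \<alpha> (univ A)"
proof (rule inj_onI)
  fix x y assume xy: "x \<in> univ A" "y \<in> univ A" "\<alpha> x = \<alpha> y"
  then have "ldist B (\<alpha> x) (\<alpha> y) = 0" using Mor_in[OF assms] by simp
  then have "ldist A x y = 0" using Mor_dist[OF assms xy(1,2)] by simp
  then show "x = y" using xy by simp
qed

lemma Mor_compose:
  assumes \<alpha>: "\<alpha> \<in> Mor L A B" and \<beta>: "\<beta> \<in> Mor L B C"
  shows "compose (univ A) \<beta> \<alpha> \<in> Mor L A C"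
proof -
  have "lrel C R (map (compose (univ A) \<beta> \<alpha>) xs) = lrel A R xs"
    if "R \<in> symbols L" "xs \<in> tuples (univ A) (arity L R)" for R xs
  proof -
    have "map (compose (univ A) \<beta> \<alpha>) xs = map \<beta> (map \<alpha> xs)"
      using that(2) by (auto simp: tuples_def compose_eq)
    moreover have "map \<alpha> xs \<in> tuples (univ B) (arity L R)"
      using that(2) Mor_in[OF \<alpha>] by (auto simp: tuples_def)
    ultimately show ?thesis
      using Mor_rel[OF \<beta> that(1)] Mor_rel[OF \<alpha> that] by metis
  qed
  moreover have "compose (univ A) \<beta> \<alpha> \<in> univ A \<rightarrow>\<^sub>E univ C"
    using Mor_in[OF \<alpha>] Mor_in[OF \<beta>] by (auto simp: compose_def)
  ultimately show ?thesis
    using Mor_dist[OF \<alpha>] Mor_dist[OF \<beta>] Mor_in[OF \<alpha>] by (auto simp: Mor_def compose_eq)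
qed

lemma Mor_identity: "(\<lambda>x\<in>univ A. x) \<in> Mor L A A"
proof -
  have "map (\<lambda>x\<in>univ A. x) xs = xs" if "set xs \<subseteq> univ A" for xs
    using that by (induction xs) auto
  then show ?thesis by (auto simp: Mor_def tuples_def)
qed

text \<open>An embedding whose image contains that of another one can be cancelled, as embeddings are injective
  and reflect all the structure.\<close>

lemma Mor_factor:
  assumes i: "i \<in> Mor L A K" and \<beta>: "\<beta> \<in> Mor L B K" and sub: "\<beta> ` univ B \<subseteq> i ` univ A"
  obtains \<alpha> where "\<alpha> \<in> Mor L B A" "\<And>b. b \<in> univ B \<Longrightarrow> i (\<alpha> b) = \<beta> b"
proof -
  define \<alpha> where "\<alpha> = (\<lambda>b\<in>univ B. inv_into (univ A) i (\<beta> b))"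
  have \<alpha>: "\<alpha> b \<in> univ A" "i (\<alpha> b) = \<beta> b" if "b \<in> univ B" for b
    using that sub by (auto simp: \<alpha>_def inv_into_into f_inv_into_f image_subset_iff)
  have "lrel A R (map \<alpha> xs) = lrel B R xs"
    if "R \<in> symbols L" "xs \<in> tuples (univ B) (arity L R)" for R xs
  proof -
    have "map \<alpha> xs \<in> tuples (univ A) (arity L R)" "map i (map \<alpha> xs) = map \<beta> xs"
      using that(2) \<alpha> by (auto simp: tuples_def)
    then show ?thesis
      using Mor_rel[OF i that(1)] Mor_rel[OF \<beta> that] by metis
  qed
  moreover have "ldist A (\<alpha> x) (\<alpha> y) = ldist B x y" if "x \<in> univ B" "y \<in> univ B" for x y
    using Mor_dist[OF i, of "\<alpha> x" "\<alpha> y"] Mor_dist[OF \<beta> that] \<alpha> that by simp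
  ultimately have "\<alpha> \<in> Mor L B A"
    using \<alpha>(1) by (auto simp: Mor_def) (simp add: \<alpha>_def)
  then show ?thesis using \<alpha>(2) that by blast
qed

lemma finite_Mor: "finite (univ A) \<Longrightarrow> finite (univ B) \<Longrightarrow> finite (Mor L A B)"
  by (rule finite_subset[of _ "univ A \<rightarrow>\<^sub>E univ B"]) (auto simp: Mor_def finite_PiE)

lemma mcomplete_of_finite:
  assumes "finite (mspace m)" shows "mcomplete_of m"
proof -
  have "compact_space (mtopology_of m)"
    using finite_imp_compactin[of "mspace m" "mtopology_of m"] assms
    by (simp add: compact_space_def)
  then show ?thesis
    unfolding mcomplete_of_def mtopology_of_def
    by (rule Metric_space.compact_space_imp_mcomplete[OF Metric_space_mspace_mdist])
qed

text \<open>Pulling back the metric and the relations along an injection of a finite set. The identity yields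
  finite substructures, an injection of another type yields copies of them over that type.\<close>

lemma structure_on_finite_set:
  fixes K :: "('a, 'r) lstructure" and h :: "'b \<Rightarrow> 'a"
  assumes K: "is_structure L K" and Q: "finite Q" "inj_on h Q" "h ` Q \<subseteq> univ K"
  obtains A :: "('b, 'r) lstructure" where
    "finite_structure L A" "univ A = Q" "(\<lambda>x\<in>Q. h x) \<in> Mor L A K"
proof -
  define m where "m = metric (Q, \<lambda>x y. ldist K (h x) (h y))"
  have "Metric_space Q (\<lambda>x y. ldist K (h x) (h y))"
    using Q by unfold_locales
      (auto simp: mdist_commute image_subset_iff inj_on_eq_iff intro: mdist_triangle)
  then have m: "mspace m = Q" "mdist m = (\<lambda>x y. ldist K (h x) (h y))"
    by (simp_all add: m_def Metric_space.mspace_metric Metric_space.mdist_metric)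
  define A :: "('b, 'r) lstructure" where "A = \<lparr>lmetric = m, lrel = \<lambda>R xs. lrel K R (map h xs)\<rparr>"
  have "\<bar>lrel A R xs - lrel A R ys\<bar> \<le> lipconst L R * sup_dist (lmetric A) xs ys"
    if R: "R \<in> symbols L" "xs \<in> tuples Q (arity L R)" "ys \<in> tuples Q (arity L R)" for R xs ys
  proof -
    have "map h xs \<in> tuples (univ K) (arity L R)" "map h ys \<in> tuples (univ K) (arity L R)"
      using R Q(3) by (auto simp: tuples_def)
    moreover have "sup_dist (lmetric K) (map h xs) (map h ys) = sup_dist m xs ys"
      using R by (auto simp: sup_dist_def m tuples_def intro!: arg_cong[of _ _ Max] image_cong)
    ultimately show ?thesis using K R(1) by (force simp: is_structure_def A_def)
  qed
  then have "finite_structure L A"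
    using Q(1) mcomplete_of_finite[of m] by (auto simp: finite_structure_def is_structure_def A_def m)
  moreover have "lrel K R (map (\<lambda>x\<in>Q. h x) xs) = lrel K R (map h xs)" if "set xs \<subseteq> Q" for R xs
    using that by (intro arg_cong[of _ _ "lrel K R"]) auto
  then have "(\<lambda>x\<in>Q. h x) \<in> Mor L A K"
    using Q(3) by (auto simp: Mor_def A_def m tuples_def)
  ultimately show ?thesis using m(1) by (intro that[of A]) (simp_all add: A_def)
qed

text \<open>The members of the age live on another type than \<open>K\<close>; this provides a member for every finite
  subset of \<open>K\<close>.\<close>

lemma age_copy:
  fixes K :: "('a, 'r) lstructure"
  assumes "infinite (UNIV :: 'b set)" "is_structure L K" "finite P" "P \<subseteq> univ K"
  obtains A :: "('b, 'r) lstructure" and i where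
    "A \<in> age L K" "finite (univ A)" "i \<in> Mor L A K" "i ` univ A = P"
proof -
  obtain Q :: "'b set" where Q: "finite Q" "card Q = card P"
    using infinite_arbitrarily_large[OF assms(1)] by blast
  then obtain h where h: "bij_betw h Q P"
    using finite_same_card_bij[OF Q(1) assms(3)] by blast
  then have "inj_on h Q" "h ` Q \<subseteq> univ K" using assms(4) by (auto simp: bij_betw_def)
  from structure_on_finite_set[OF assms(2) Q(1) this] obtain A :: "('b, 'r) lstructure"
    where A: "finite_structure L A" "univ A = Q" "(\<lambda>x\<in>Q. h x) \<in> Mor L A K" by blast
  show ?thesis
    using A h by (intro that[of A "\<lambda>x\<in>Q. h x"])
      (auto simp: age_def finite_structure_def bij_betw_def)
qed

text \<open>Homogeneity, restated for pairs of embeddings of a finite structure that need not be a substructure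
  of \<open>K\<close>.\<close>

lemma homogeneous_extension:
  assumes hom: "homogeneous L K" and K: "is_structure L K"
    and i: "i \<in> Mor L B K" and \<beta>: "\<beta> \<in> Mor L B K" and fin: "finite (univ B)" and \<epsilon>: "0 < \<epsilon>"
  obtains y where "y \<in> automorphisms L K" "\<And>b. b \<in> univ B \<Longrightarrow> ldist K (y (i b)) (\<beta> b) < \<epsilon>"
proof -
  let ?P = "i ` univ B"
  have P: "finite ?P" "?P \<subseteq> univ K" using fin Mor_in[OF i] by auto
  obtain S where S: "finite_structure L S" "univ S = ?P" "(\<lambda>x\<in>?P. x) \<in> Mor L S K"
    using structure_on_finite_set[OF K P(1), of "\<lambda>x. x"] P(2) by auto
  have sub: "substructure L S K"
    using S P(2) by (simp add: substructure_def finite_structure_def)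
  obtain \<alpha> where \<alpha>: "\<alpha> \<in> Mor L S B" "\<And>p. p \<in> ?P \<Longrightarrow> i (\<alpha> p) = p"
    using Mor_factor[OF i S(3)] S(2) by (auto simp: image_subset_iff)
  have \<alpha>i: "\<alpha> (i b) = b" if "b \<in> univ B" for b
    using that \<alpha>(2)[of "i b"] Mor_in[OF \<alpha>(1), of "i b"] S(2) inj_onD[OF Mor_inj[OF i]] by simp
  obtain y where y: "y \<in> automorphisms L K"
    "\<forall>b\<in>univ S. ldist K (y b) (compose (univ S) \<beta> \<alpha> b) < \<epsilon>"
    using hom sub P(1) S(2) \<epsilon> Mor_compose[OF \<alpha>(1) \<beta>] unfolding homogeneous_def by metis
  show ?thesis
    using y \<alpha>i S(2) by (intro that[of y]) (auto simp: compose_eq)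
qed

lemma rho_less_iff:
  assumes "finite (univ A)"
  shows "rho A B \<alpha> \<beta> < \<epsilon> \<longleftrightarrow> 0 < \<epsilon> \<and> (\<forall>a\<in>univ A. ldist B (\<alpha> a) (\<beta> a) < \<epsilon>)"
proof (cases "univ A = {}")
  case False
  have eq: "(SUP a\<in>univ A. ldist B (\<alpha> a) (\<beta> a)) = Max ((\<lambda>a. ldist B (\<alpha> a) (\<beta> a)) ` univ A)"
    using assms False by (intro cSup_eq_Max) auto
  have "0 < \<epsilon>" if "a \<in> univ A" "ldist B (\<alpha> a) (\<beta> a) < \<epsilon>" for a
    using that mdist_nonneg[of "lmetric B" "\<alpha> a" "\<beta> a"] by linarith
  then show ?thesis
    using assms False by (auto simp: rho_def eq)
qed (simp add: rho_def)

lemma rho_le_iff: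
  assumes "finite (univ A)" "0 \<le> \<epsilon>"
  shows "rho A B \<alpha> \<beta> \<le> \<epsilon> \<longleftrightarrow> (\<forall>a\<in>univ A. ldist B (\<alpha> a) (\<beta> a) \<le> \<epsilon>)"
proof (cases "univ A = {}")
  case False
  have eq: "(SUP a\<in>univ A. ldist B (\<alpha> a) (\<beta> a)) = Max ((\<lambda>a. ldist B (\<alpha> a) (\<beta> a)) ` univ A)"
    using assms False by (intro cSup_eq_Max) auto
  show ?thesis using assms False by (auto simp: rho_def eq)
qed (simp add: rho_def assms)

section \<open>The automorphism group and its uniformly continuous functions\<close>

lemma carrier_Aut: "carrier (Aut L K) = automorphisms L K"
  by (simp add: Aut_def)

lemma automorphisms_Bij: "automorphisms L K \<subseteq> Bij (univ K)"
  by (auto simp: automorphisms_def Bij_def Mor_extensional)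

lemma mult_Aut:
  "x \<in> automorphisms L K \<Longrightarrow> y \<in> automorphisms L K \<Longrightarrow> x \<otimes>\<^bsub>Aut L K\<^esub> y = compose (univ K) x y"
  using automorphisms_Bij[of L K] by (auto simp: Aut_def BijGroup_def subset_eq)

lemma one_Aut: "\<one>\<^bsub>Aut L K\<^esub> = (\<lambda>x\<in>univ K. x)"
  by (simp add: Aut_def BijGroup_def)

lemma automorphism_Mor: "x \<in> automorphisms L K \<Longrightarrow> x \<in> Mor L K K"
  by (simp add: automorphisms_def)

lemma automorphism_inverse:
  assumes "x \<in> automorphisms L K"
  obtains y where "y \<in> automorphisms L K" "\<And>a. a \<in> univ K \<Longrightarrow> x (y a) = a"
    "\<And>a. a \<in> univ K \<Longrightarrow> y (x a) = a"
proof -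
  have x: "x \<in> Mor L K K" "bij_betw x (univ K) (univ K)"
    using assms by (auto simp: automorphisms_def)
  obtain y where y: "y \<in> Mor L K K" "\<And>a. a \<in> univ K \<Longrightarrow> x (y a) = a"
    using Mor_factor[OF x(1) Mor_identity] x(2) by (auto simp: bij_betw_def)
  have yx: "y (x a) = a" if "a \<in> univ K" for a
    using that y(2)[of "x a"] inj_onD[OF Mor_inj[OF x(1)]] Mor_in[OF x(1)] Mor_in[OF y(1)] by simp
  have "bij_betw y (univ K) (univ K)"
    by (rule bij_betw_byWitness[of _ x]) (use y yx Mor_in[OF x(1)] Mor_in[OF y(1)] in auto)
  then show ?thesis using y yx by (intro that[of y]) (auto simp: automorphisms_def)
qed

lemma group_Aut: "group (Aut L K)"
proof (rule groupI, unfold carrier_Aut)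
  show "x \<otimes>\<^bsub>Aut L K\<^esub> y \<in> automorphisms L K"
    if "x \<in> automorphisms L K" "y \<in> automorphisms L K" for x y
    using that Mor_compose[of y L K K x K] bij_betw_compose[of y "univ K" "univ K" x "univ K"]
    by (simp add: mult_Aut) (simp add: automorphisms_def)
  then have closed: "compose (univ K) x y \<in> automorphisms L K"
    if "x \<in> automorphisms L K" "y \<in> automorphisms L K" for x y
    using that by (metis mult_Aut)
  show one: "\<one>\<^bsub>Aut L K\<^esub> \<in> automorphisms L K"
    using Mor_identity[of K L] by (auto simp: automorphisms_def one_Aut bij_betw_def inj_on_def)
  show "x \<otimes>\<^bsub>Aut L K\<^esub> y \<otimes>\<^bsub>Aut L K\<^esub> z = x \<otimes>\<^bsub>Aut L K\<^esub> (y \<otimes>\<^bsub>Aut L K\<^esub> z)"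
    if "x \<in> automorphisms L K" "y \<in> automorphisms L K" "z \<in> automorphisms L K" for x y z
    using that closed Mor_in[OF automorphism_Mor[OF that(3)]]
    by (simp add: mult_Aut compose_assoc[of z "univ K" "univ K"])
  show "\<one>\<^bsub>Aut L K\<^esub> \<otimes>\<^bsub>Aut L K\<^esub> x = x" if x: "x \<in> automorphisms L K" for x
    unfolding mult_Aut[OF one x] unfolding one_Aut
    using Mor_in[OF automorphism_Mor[OF x]] Mor_extensional[OF automorphism_Mor[OF x]]
    by (intro extensionalityI[of _ "univ K"]) (auto simp: compose_eq)
  show "\<exists>y\<in>automorphisms L K. y \<otimes>\<^bsub>Aut L K\<^esub> x = \<one>\<^bsub>Aut L K\<^esub>" if x: "x \<in> automorphisms L K" for x
  proof -
    obtain y where y: "y \<in> automorphisms L K" "\<And>a. a \<in> univ K \<Longrightarrow> y (x a) = a"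
      using automorphism_inverse[OF x] by metis
    have "y \<otimes>\<^bsub>Aut L K\<^esub> x = \<one>\<^bsub>Aut L K\<^esub>"
      using y(2) unfolding mult_Aut[OF y(1) x] one_Aut compose_def by auto
    then show ?thesis using y(1) by blast
  qed
qed

lemma inv_Aut:
  assumes x: "x \<in> automorphisms L K"
  shows "inv\<^bsub>Aut L K\<^esub> x \<in> automorphisms L K"
    and "a \<in> univ K \<Longrightarrow> x ((inv\<^bsub>Aut L K\<^esub> x) a) = a"
    and "a \<in> univ K \<Longrightarrow> (inv\<^bsub>Aut L K\<^esub> x) (x a) = a"
proof -
  interpret group "Aut L K" by (rule group_Aut)
  have x': "x \<in> carrier (Aut L K)" using x by (simp add: carrier_Aut)
  show i: "inv\<^bsub>Aut L K\<^esub> x \<in> automorphisms L K" using inv_closed[OF x'] by (simp add: carrier_Aut)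
  show "a \<in> univ K \<Longrightarrow> x ((inv\<^bsub>Aut L K\<^esub> x) a) = a"
    using r_inv[OF x'] unfolding mult_Aut[OF x i] one_Aut by (metis compose_eq restrict_apply')
  show "a \<in> univ K \<Longrightarrow> (inv\<^bsub>Aut L K\<^esub> x) (x a) = a"
    using l_inv[OF x'] unfolding mult_Aut[OF i x] one_Aut by (metis compose_eq restrict_apply')
qed

text \<open>This identity is why left translation of functions on the group becomes precomposition of embeddings.\<close>

lemma inv_mult_Aut_apply:
  assumes "g \<in> automorphisms L K" "x \<in> automorphisms L K" "a \<in> univ K"
  shows "(inv\<^bsub>Aut L K\<^esub> (g \<otimes>\<^bsub>Aut L K\<^esub> x)) a = (inv\<^bsub>Aut L K\<^esub> x) ((inv\<^bsub>Aut L K\<^esub> g) a)"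
proof -
  interpret group "Aut L K" by (rule group_Aut)
  have "inv\<^bsub>Aut L K\<^esub> (g \<otimes>\<^bsub>Aut L K\<^esub> x) = inv\<^bsub>Aut L K\<^esub> x \<otimes>\<^bsub>Aut L K\<^esub> inv\<^bsub>Aut L K\<^esub> g"
    using assms by (intro inv_mult_group) (auto simp: carrier_Aut)
  also have "\<dots> = compose (univ K) (inv\<^bsub>Aut L K\<^esub> x) (inv\<^bsub>Aut L K\<^esub> g)"
    by (rule mult_Aut[OF inv_Aut(1)[OF assms(2)] inv_Aut(1)[OF assms(1)]])
  finally show ?thesis using assms(3) by (simp add: compose_eq)
qed

lemma identity_neighbourhood_Aut:
  "\<one>\<^bsub>Aut L K\<^esub> \<in> Aut_topology L K interior_of V \<longleftrightarrow>
   (\<exists>P \<delta>. finite P \<and> P \<subseteq> univ K \<and> 0 < \<delta> \<and>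
      {x \<in> automorphisms L K. \<forall>a\<in>P. ldist K (x a) a < \<delta>} \<subseteq> V)" (is "?L \<longleftrightarrow> ?R")
proof
  have one: "\<one>\<^bsub>Aut L K\<^esub> \<in> automorphisms L K"
    using monoid.one_closed[OF group.is_monoid[OF group_Aut]] by (simp add: carrier_Aut)
  assume ?R
  then obtain P \<delta> where P: "finite P" "P \<subseteq> univ K" "0 < \<delta>"
    "{x \<in> automorphisms L K. \<forall>a\<in>P. ldist K (x a) a < \<delta>} \<subseteq> V" by blast
  define B where "B a = (if a \<in> P then mball_of (lmetric K) a \<delta> else univ K)" for a
  define N where "N = {x \<in> automorphisms L K. \<forall>a\<in>P. ldist K (x a) a < \<delta>}"
  have "openin (product_topology (\<lambda>_. mtopology_of (lmetric K)) (univ K)) (PiE (univ K) B)"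
  proof -
    have "finite {a \<in> univ K. B a \<noteq> univ K}"
      by (rule finite_subset[OF _ P(1)]) (auto simp: B_def)
    moreover have "openin (mtopology_of (lmetric K)) (mball_of (lmetric K) a \<delta>)" for a
      unfolding mball_of_def mtopology_of_def
      by (rule Metric_space.openin_mball[OF Metric_space_mspace_mdist])
    then have "openin (mtopology_of (lmetric K)) (B a)" for a
      using openin_topspace[of "mtopology_of (lmetric K)"] by (simp add: B_def)
    ultimately show ?thesis by (simp add: openin_PiE_gen)
  qed
  moreover have "N = PiE (univ K) B \<inter> automorphisms L K"
  proof -
    have "x \<in> N \<longleftrightarrow> x \<in> PiE (univ K) B" if x: "x \<in> automorphisms L K" for x
    proof -
      have "x a \<in> B a \<longleftrightarrow> a \<notin> P \<or> ldist K (x a) a < \<delta>" if "a \<in> univ K" for a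
        using that Mor_in[OF automorphism_Mor[OF x] that]
        by (simp add: B_def mdist_commute[of _ a])
      moreover have "x \<in> PiE (univ K) B \<longleftrightarrow> (\<forall>a\<in>univ K. x a \<in> B a)"
        using Mor_extensional[OF automorphism_Mor[OF x]] by (simp add: PiE_iff)
      ultimately show ?thesis using P(2) x unfolding N_def by blast
    qed
    then show ?thesis by (auto simp: N_def)
  qed
  ultimately have "openin (Aut_topology L K) N"
    by (auto simp: Aut_topology_def openin_subtopology)
  moreover have "\<one>\<^bsub>Aut L K\<^esub> \<in> N" using one P by (auto simp: N_def one_Aut)
  ultimately show ?L using P(4) unfolding interior_of_def N_def by blast
next
  have one: "\<one>\<^bsub>Aut L K\<^esub> \<in> automorphisms L K"
    using monoid.one_closed[OF group.is_monoid[OF group_Aut]] by (simp add: carrier_Aut)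
  assume ?L
  then obtain W where W: "openin (product_topology (\<lambda>_. mtopology_of (lmetric K)) (univ K)) W"
      "\<one>\<^bsub>Aut L K\<^esub> \<in> W" "W \<inter> automorphisms L K \<subseteq> V"
    by (auto simp: interior_of_def Aut_topology_def openin_subtopology)
  then obtain B where B: "finite {a \<in> univ K. B a \<noteq> univ K}"
      "\<And>a. a \<in> univ K \<Longrightarrow> openin (mtopology_of (lmetric K)) (B a)"
      "\<one>\<^bsub>Aut L K\<^esub> \<in> PiE (univ K) B" "PiE (univ K) B \<subseteq> W"
    unfolding openin_product_topology_alt by fastforce
  define P where "P = {a \<in> univ K. B a \<noteq> univ K}"
  have "\<exists>r>0. mball_of (lmetric K) a r \<subseteq> B a" if "a \<in> P" for a
  proof -
    have "a \<in> B a" using B(3) that by (auto simp: one_Aut P_def PiE_iff)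
    then show ?thesis
      using B(2)[of a] that unfolding mtopology_of_def mball_of_def P_def
      by (simp add: Metric_space.openin_mtopology[OF Metric_space_mspace_mdist])
  qed
  then obtain r where r: "\<And>a. a \<in> P \<Longrightarrow> 0 < r a" "\<And>a. a \<in> P \<Longrightarrow> mball_of (lmetric K) a (r a) \<subseteq> B a"
    by metis
  define \<delta> where "\<delta> = Min (insert 1 (r ` P))"
  have P: "finite P" "P \<subseteq> univ K" using B(1) by (auto simp: P_def)
  have \<delta>: "0 < \<delta>" "\<And>a. a \<in> P \<Longrightarrow> \<delta> \<le> r a"
    using P(1) r(1) by (auto simp: \<delta>_def)
  have "x \<in> V" if x: "x \<in> automorphisms L K" "\<forall>a\<in>P. ldist K (x a) a < \<delta>" for x
  proof -
    have "x a \<in> B a" if "a \<in> univ K" for a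
    proof (cases "a \<in> P")
      case True
      have "x a \<in> mball_of (lmetric K) a (r a)"
        using True x \<delta>(2)[OF True] that Mor_in[OF automorphism_Mor[OF x(1)] that]
        by (auto simp: mdist_commute dest!: bspec[of P])
      then show ?thesis using r(2)[OF True] by blast
    next
      case False
      then show ?thesis
        using that Mor_in[OF automorphism_Mor[OF x(1)] that] by (simp add: P_def)
    qed
    then have "x \<in> PiE (univ K) B"
      using Mor_extensional[OF automorphism_Mor[OF x(1)]] by (simp add: PiE_iff)
    then show ?thesis using B(4) W(3) x(1) by blast
  qed
  then show ?R using P \<delta>(1) by blast
qed

text \<open>Functions here are arbitrary outside the automorphisms, in contrast to the extensional functions in
  \<open>UCb_right\<close>.\<close>

definition UC :: "'r language \<Rightarrow> ('a, 'r) lstructure \<Rightarrow> (('a \<Rightarrow> 'a) \<Rightarrow> real) set" where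
  "UC L K = {f. restrict f (automorphisms L K) \<in> UCb_right (Aut L K) (Aut_topology L K)}"

text \<open>The automorphism \<open>x y\<inverse>\<close> moves \<open>a\<close> by exactly the distance between \<open>x\<inverse> a\<close> and \<open>y\<inverse> a\<close>.\<close>

lemma UC_iff:
  "f \<in> UC L K \<longleftrightarrow> (\<exists>c. \<forall>x\<in>automorphisms L K. \<bar>f x\<bar> \<le> c) \<and>
    (\<forall>\<epsilon>>0. \<exists>P \<delta>. finite P \<and> P \<subseteq> univ K \<and> 0 < \<delta> \<and>
      (\<forall>x\<in>automorphisms L K. \<forall>y\<in>automorphisms L K.
         (\<forall>a\<in>P. ldist K ((inv\<^bsub>Aut L K\<^esub> x) a) ((inv\<^bsub>Aut L K\<^esub> y) a) < \<delta>) \<longrightarrow> \<bar>f x - f y\<bar> \<le> \<epsilon>))"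
    (is "_ \<longleftrightarrow> ?B \<and> (\<forall>\<epsilon>>0. ?R \<epsilon>)")
proof -
  interpret group "Aut L K" by (rule group_Aut)
  let ?G = "automorphisms L K"
  have "(\<exists>V. \<one>\<^bsub>Aut L K\<^esub> \<in> Aut_topology L K interior_of V \<and>
        (\<forall>x\<in>?G. \<forall>y\<in>?G. x \<otimes>\<^bsub>Aut L K\<^esub> inv\<^bsub>Aut L K\<^esub> y \<in> V \<longrightarrow> \<bar>f x - f y\<bar> \<le> \<epsilon>)) \<longleftrightarrow> ?R \<epsilon>" for \<epsilon>
  proof -
    have dist: "ldist K ((x \<otimes>\<^bsub>Aut L K\<^esub> inv\<^bsub>Aut L K\<^esub> y) a) a =
        ldist K ((inv\<^bsub>Aut L K\<^esub> x) a) ((inv\<^bsub>Aut L K\<^esub> y) a)"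
      if x: "x \<in> ?G" and y: "y \<in> ?G" and a: "a \<in> univ K" for x y a
    proof -
      let ?x = "inv\<^bsub>Aut L K\<^esub> x" and ?y = "inv\<^bsub>Aut L K\<^esub> y"
      have in': "?x a \<in> univ K" "?y a \<in> univ K"
        using Mor_in[OF automorphism_Mor[OF inv_Aut(1)[OF x]] a]
          Mor_in[OF automorphism_Mor[OF inv_Aut(1)[OF y]] a] by blast+
      have "ldist K (x (?y a)) (x (?x a)) = ldist K (?y a) (?x a)"
        using Mor_dist[OF automorphism_Mor[OF x]] in' by blast
      moreover have "(x \<otimes>\<^bsub>Aut L K\<^esub> ?y) a = x (?y a)"
        using a by (simp add: mult_Aut[OF x inv_Aut(1)[OF y]] compose_eq)
      ultimately show ?thesis
        using inv_Aut(2)[OF x a] by (simp add: mdist_commute)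
    qed
    have mem: "x \<otimes>\<^bsub>Aut L K\<^esub> inv\<^bsub>Aut L K\<^esub> y \<in> ?G" if "x \<in> ?G" "y \<in> ?G" for x y
      using that m_closed inv_closed by (simp add: carrier_Aut)
    show ?thesis
    proof
      assume "\<exists>V. \<one>\<^bsub>Aut L K\<^esub> \<in> Aut_topology L K interior_of V \<and>
        (\<forall>x\<in>?G. \<forall>y\<in>?G. x \<otimes>\<^bsub>Aut L K\<^esub> inv\<^bsub>Aut L K\<^esub> y \<in> V \<longrightarrow> \<bar>f x - f y\<bar> \<le> \<epsilon>)"
      then obtain V P \<delta> where P: "finite P" "P \<subseteq> univ K" "0 < \<delta>"
        "{x \<in> ?G. \<forall>a\<in>P. ldist K (x a) a < \<delta>} \<subseteq> V"
        "\<forall>x\<in>?G. \<forall>y\<in>?G. x \<otimes>\<^bsub>Aut L K\<^esub> inv\<^bsub>Aut L K\<^esub> y \<in> V \<longrightarrow> \<bar>f x - f y\<bar> \<le> \<epsilon>"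
        unfolding identity_neighbourhood_Aut by blast
      have "\<bar>f x - f y\<bar> \<le> \<epsilon>"
        if "x \<in> ?G" "y \<in> ?G" "\<forall>a\<in>P. ldist K ((inv\<^bsub>Aut L K\<^esub> x) a) ((inv\<^bsub>Aut L K\<^esub> y) a) < \<delta>" for x y
      proof -
        have "x \<otimes>\<^bsub>Aut L K\<^esub> inv\<^bsub>Aut L K\<^esub> y \<in> {x \<in> ?G. \<forall>a\<in>P. ldist K (x a) a < \<delta>}"
          using mem[OF that(1,2)] dist[OF that(1,2)] that(3) P(2) by (simp add: subset_eq)
        then show ?thesis using P(4,5) that(1,2) by blast
      qed
      then show "?R \<epsilon>" using P(1-3) by blast
    next
      assume "?R \<epsilon>"
      then obtain P \<delta> where P: "finite P" "P \<subseteq> univ K" "0 < \<delta>"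
        "\<forall>x\<in>?G. \<forall>y\<in>?G. (\<forall>a\<in>P. ldist K ((inv\<^bsub>Aut L K\<^esub> x) a) ((inv\<^bsub>Aut L K\<^esub> y) a) < \<delta>)
           \<longrightarrow> \<bar>f x - f y\<bar> \<le> \<epsilon>" by blast
      have "\<bar>f x - f y\<bar> \<le> \<epsilon>" if "x \<in> ?G" "y \<in> ?G"
          "x \<otimes>\<^bsub>Aut L K\<^esub> inv\<^bsub>Aut L K\<^esub> y \<in> {x \<in> ?G. \<forall>a\<in>P. ldist K (x a) a < \<delta>}" for x y
        using P(2,4) that dist[OF that(1,2)] by (simp add: subset_eq)
      moreover have "\<one>\<^bsub>Aut L K\<^esub> \<in> Aut_topology L K interior_of {x \<in> ?G. \<forall>a\<in>P. ldist K (x a) a < \<delta>}"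
        unfolding identity_neighbourhood_Aut using P(1-3) by blast
      ultimately show "\<exists>V. \<one>\<^bsub>Aut L K\<^esub> \<in> Aut_topology L K interior_of V \<and>
        (\<forall>x\<in>?G. \<forall>y\<in>?G. x \<otimes>\<^bsub>Aut L K\<^esub> inv\<^bsub>Aut L K\<^esub> y \<in> V \<longrightarrow> \<bar>f x - f y\<bar> \<le> \<epsilon>)" by blast
    qed
  qed
  moreover have "bounded (restrict f ?G ` ?G) \<longleftrightarrow> ?B"
    by (auto simp: bounded_iff)
  ultimately show ?thesis
    unfolding UC_def UCb_right_def carrier_Aut by (simp cong: ball_cong_simp)
qed

text \<open>Closure under scaling, sums and minima follows by instances of this lemma.\<close>

lemma UC_combine:
  assumes f: "f \<in> UC L K" and h: "h \<in> UC L K"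
    and bdd: "\<exists>c. \<forall>x\<in>automorphisms L K. \<bar>u x\<bar> \<le> c"
    and mod: "\<And>\<epsilon>. 0 < \<epsilon> \<Longrightarrow> \<exists>\<delta>>0. \<forall>x\<in>automorphisms L K. \<forall>y\<in>automorphisms L K.
      \<bar>f x - f y\<bar> \<le> \<delta> \<longrightarrow> \<bar>h x - h y\<bar> \<le> \<delta> \<longrightarrow> \<bar>u x - u y\<bar> \<le> \<epsilon>"
  shows "u \<in> UC L K"
  unfolding UC_iff
proof (intro conjI allI impI bdd)
  let ?G = "automorphisms L K"
  let ?near = "\<lambda>P \<delta> x y. \<forall>a\<in>P. ldist K ((inv\<^bsub>Aut L K\<^esub> x) a) ((inv\<^bsub>Aut L K\<^esub> y) a) < \<delta>"
  fix \<epsilon> :: real assume "0 < \<epsilon>"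
  then obtain e where e: "0 < e" "\<forall>x\<in>?G. \<forall>y\<in>?G.
      \<bar>f x - f y\<bar> \<le> e \<longrightarrow> \<bar>h x - h y\<bar> \<le> e \<longrightarrow> \<bar>u x - u y\<bar> \<le> \<epsilon>" using mod by blast
  obtain P \<delta> where P: "finite P" "P \<subseteq> univ K" "0 < \<delta>"
    "\<forall>x\<in>?G. \<forall>y\<in>?G. ?near P \<delta> x y \<longrightarrow> \<bar>f x - f y\<bar> \<le> e"
    using f e(1) unfolding UC_iff by blast
  obtain Q \<eta> where Q: "finite Q" "Q \<subseteq> univ K" "0 < \<eta>"
    "\<forall>x\<in>?G. \<forall>y\<in>?G. ?near Q \<eta> x y \<longrightarrow> \<bar>h x - h y\<bar> \<le> e"
    using h e(1) unfolding UC_iff by blast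
  have "\<bar>u x - u y\<bar> \<le> \<epsilon>" if "x \<in> ?G" "y \<in> ?G" "?near (P \<union> Q) (min \<delta> \<eta>) x y" for x y
  proof -
    have "?near P \<delta> x y" "?near Q \<eta> x y" using that(3) by auto
    then show ?thesis using e(2) P(4) Q(4) that(1,2) by blast
  qed
  then show "\<exists>P \<delta>. finite P \<and> P \<subseteq> univ K \<and> 0 < \<delta> \<and>
      (\<forall>x\<in>?G. \<forall>y\<in>?G. ?near P \<delta> x y \<longrightarrow> \<bar>u x - u y\<bar> \<le> \<epsilon>)"
    using P(1-3) Q(1-3) by (intro exI[of _ "P \<union> Q"] exI[of _ "min \<delta> \<eta>"]) auto
qed

lemma UC_const: "(\<lambda>_. c) \<in> UC L K"
  unfolding UC_iff by (rule conjI, blast, auto intro!: exI[of _ "{}"] exI[of _ "1::real"])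

lemma UC_bounded: "f \<in> UC L K \<Longrightarrow> \<exists>c. \<forall>x\<in>automorphisms L K. \<bar>f x\<bar> \<le> c"
  by (simp add: UC_iff)

lemma UC_function_lattice: "function_lattice (automorphisms L K) (UC L K)"
proof
  let ?G = "automorphisms L K"
  have "\<one>\<^bsub>Aut L K\<^esub> \<in> ?G"
    using monoid.one_closed[OF group.is_monoid[OF group_Aut]] by (simp add: carrier_Aut)
  then show "?G \<noteq> {}" by blast
  show "h \<in> UC L K" if f: "f \<in> UC L K" and eq: "\<And>x. x \<in> ?G \<Longrightarrow> h x = f x" for f h
    by (rule UC_combine[OF f f]) (use UC_bounded[OF f] eq in auto)
  show "\<exists>c. \<forall>x\<in>?G. \<bar>f x\<bar> \<le> c" if "f \<in> UC L K" for f using that by (rule UC_bounded)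
  show "(\<lambda>_. c) \<in> UC L K" for c by (rule UC_const)
  fix f h assume f: "f \<in> UC L K"
  obtain c where c: "\<And>x. x \<in> ?G \<Longrightarrow> \<bar>f x\<bar> \<le> c" using UC_bounded[OF f] by blast
  show "(\<lambda>x. k * f x) \<in> UC L K" for k
  proof (rule UC_combine[OF f f])
    have "\<bar>k * f x\<bar> \<le> \<bar>k\<bar> * c" if "x \<in> ?G" for x
      using c[OF that] by (simp add: abs_mult mult_left_mono)
    then show "\<exists>c. \<forall>x\<in>?G. \<bar>k * f x\<bar> \<le> c" by blast
  next
    fix \<epsilon> :: real assume \<epsilon>: "0 < \<epsilon>"
    have "\<bar>k * f x - k * f y\<bar> \<le> \<epsilon>" if "\<bar>f x - f y\<bar> \<le> \<epsilon> / (\<bar>k\<bar> + 1)" for x y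
    proof -
      have "\<bar>k * f x - k * f y\<bar> \<le> (\<bar>k\<bar> + 1) * \<bar>f x - f y\<bar>"
        by (simp add: right_diff_distrib[symmetric] abs_mult mult_right_mono)
      also have "\<dots> \<le> (\<bar>k\<bar> + 1) * (\<epsilon> / (\<bar>k\<bar> + 1))" using that by (intro mult_left_mono) auto
      also have "\<dots> = \<epsilon>" by (simp add: add_nonneg_eq_0_iff)
      finally show ?thesis .
    qed
    then show "\<exists>\<delta>>0. \<forall>x\<in>?G. \<forall>y\<in>?G. \<bar>f x - f y\<bar> \<le> \<delta> \<longrightarrow> \<bar>f x - f y\<bar> \<le> \<delta> \<longrightarrow> \<bar>k * f x - k * f y\<bar> \<le> \<epsilon>"
      using \<epsilon> by (intro exI[of _ "\<epsilon> / (\<bar>k\<bar> + 1)"]) auto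
  qed
  assume h: "h \<in> UC L K"
  obtain d where d: "\<And>x. x \<in> ?G \<Longrightarrow> \<bar>h x\<bar> \<le> d" using UC_bounded[OF h] by blast
  show "(\<lambda>x. f x + h x) \<in> UC L K"
  proof (rule UC_combine[OF f h])
    show "\<exists>c. \<forall>x\<in>?G. \<bar>f x + h x\<bar> \<le> c"
      using c d by (intro exI[of _ "c + d"] ballI order_trans[OF abs_triangle_ineq] add_mono)
    have "\<bar>f x + h x - (f y + h y)\<bar> \<le> \<epsilon>" if "\<bar>f x - f y\<bar> \<le> \<epsilon>/2" "\<bar>h x - h y\<bar> \<le> \<epsilon>/2" for x y \<epsilon>
      using that by linarith
    then show "\<exists>\<delta>>0. \<forall>x\<in>?G. \<forall>y\<in>?G. \<bar>f x - f y\<bar> \<le> \<delta> \<longrightarrow> \<bar>h x - h y\<bar> \<le> \<delta> \<longrightarrow>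
        \<bar>f x + h x - (f y + h y)\<bar> \<le> \<epsilon>" if "0 < \<epsilon>" for \<epsilon> :: real
      using that by (intro exI[of _ "\<epsilon>/2"]) simp
  qed
  show "(\<lambda>x. min (f x) (h x)) \<in> UC L K"
  proof (rule UC_combine[OF f h])
    have "\<bar>min (f x) (h x)\<bar> \<le> max c d" if "x \<in> ?G" for x
      using c[OF that] d[OF that] by (auto simp: min_def max_def)
    then show "\<exists>c. \<forall>x\<in>?G. \<bar>min (f x) (h x)\<bar> \<le> c" by blast
    have "\<bar>min (f x) (h x) - min (f y) (h y)\<bar> \<le> \<epsilon>" if "\<bar>f x - f y\<bar> \<le> \<epsilon>" "\<bar>h x - h y\<bar> \<le> \<epsilon>" for x y \<epsilon>
      using that by linarith
    then show "\<exists>\<delta>>0. \<forall>x\<in>?G. \<forall>y\<in>?G. \<bar>f x - f y\<bar> \<le> \<delta> \<longrightarrow> \<bar>h x - h y\<bar> \<le> \<delta> \<longrightarrow>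
        \<bar>min (f x) (h x) - min (f y) (h y)\<bar> \<le> \<epsilon>" if "0 < \<epsilon>" for \<epsilon> :: real
      using that by (intro exI[of _ \<epsilon>]) simp
  qed
qed

text \<open>A left translation replaces the finite set that controls \<open>f\<close> by its image under \<open>g\<inverse>\<close>. For
  averages no replacement is necessary: as \<open>z\<inverse>\<close> is isometric, the functions \<open>x \<mapsto> f (x z)\<close> share one
  modulus of continuity.\<close>

lemma UC_translation_lattice: "translation_lattice (Aut L K) (UC L K)"
proof -
  let ?G = "automorphisms L K"
  interpret group "Aut L K" by (rule group_Aut)
  interpret function_lattice "carrier (Aut L K)" "UC L K"
    unfolding carrier_Aut by (rule UC_function_lattice)
  have mem: "g \<otimes>\<^bsub>Aut L K\<^esub> x \<in> ?G" if "g \<in> ?G" "x \<in> ?G" for g x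
    using that m_closed by (simp add: carrier_Aut)
  have tr: "(\<lambda>x. f (g \<otimes>\<^bsub>Aut L K\<^esub> x)) \<in> UC L K" if f: "f \<in> UC L K" and g: "g \<in> ?G" for f g
    unfolding UC_iff
  proof (intro conjI allI impI)
    show "\<exists>c. \<forall>x\<in>?G. \<bar>f (g \<otimes>\<^bsub>Aut L K\<^esub> x)\<bar> \<le> c" using UC_bounded[OF f] mem[OF g] by blast
    fix \<epsilon> :: real assume "0 < \<epsilon>"
    then obtain P \<delta> where P: "finite P" "P \<subseteq> univ K" "0 < \<delta>"
      "\<And>x y. x \<in> ?G \<Longrightarrow> y \<in> ?G \<Longrightarrow>
        \<forall>a\<in>P. ldist K ((inv\<^bsub>Aut L K\<^esub> x) a) ((inv\<^bsub>Aut L K\<^esub> y) a) < \<delta> \<Longrightarrow> \<bar>f x - f y\<bar> \<le> \<epsilon>"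
      using f unfolding UC_iff by metis
    let ?Q = "(inv\<^bsub>Aut L K\<^esub> g) ` P"
    have "\<bar>f (g \<otimes>\<^bsub>Aut L K\<^esub> x) - f (g \<otimes>\<^bsub>Aut L K\<^esub> y)\<bar> \<le> \<epsilon>"
      if "x \<in> ?G" "y \<in> ?G" "\<forall>a\<in>?Q. ldist K ((inv\<^bsub>Aut L K\<^esub> x) a) ((inv\<^bsub>Aut L K\<^esub> y) a) < \<delta>" for x y
      using that P(2) by (intro P(4) mem g) (auto simp: inv_mult_Aut_apply[OF g] subset_eq)
    moreover have "?Q \<subseteq> univ K"
      using P(2) Mor_in[OF automorphism_Mor[OF inv_Aut(1)[OF g]]] by blast
    ultimately show "\<exists>P \<delta>. finite P \<and> P \<subseteq> univ K \<and> 0 < \<delta> \<and> (\<forall>x\<in>?G. \<forall>y\<in>?G.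
        (\<forall>a\<in>P. ldist K ((inv\<^bsub>Aut L K\<^esub> x) a) ((inv\<^bsub>Aut L K\<^esub> y) a) < \<delta>) \<longrightarrow>
        \<bar>f (g \<otimes>\<^bsub>Aut L K\<^esub> x) - f (g \<otimes>\<^bsub>Aut L K\<^esub> y)\<bar> \<le> \<epsilon>)"
      using P(1,3) by (intro exI[of _ ?Q] exI[of _ \<delta>]) auto
  qed
  have avg: "(\<lambda>x. \<nu> (\<lambda>y. f (x \<otimes>\<^bsub>Aut L K\<^esub> y))) \<in> UC L K"
    if \<nu>: "\<nu> \<in> means (carrier (Aut L K)) (UC L K)" and f: "f \<in> UC L K" for \<nu> f
    unfolding UC_iff
  proof (intro conjI allI impI)
    obtain c where "\<forall>x\<in>?G. \<bar>f x\<bar> \<le> c" using UC_bounded[OF f] by blast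
    then have "\<bar>\<nu> (\<lambda>y. f (x \<otimes>\<^bsub>Aut L K\<^esub> y))\<bar> \<le> c" if "x \<in> ?G" for x
      using mem[OF that] by (intro mean_bound[OF \<nu> tr[OF f that]]) (auto simp: carrier_Aut)
    then show "\<exists>c. \<forall>x\<in>?G. \<bar>\<nu> (\<lambda>y. f (x \<otimes>\<^bsub>Aut L K\<^esub> y))\<bar> \<le> c" by blast
    fix \<epsilon> :: real assume "0 < \<epsilon>"
    then obtain P \<delta> where P: "finite P" "P \<subseteq> univ K" "0 < \<delta>"
      "\<And>x y. x \<in> ?G \<Longrightarrow> y \<in> ?G \<Longrightarrow>
        \<forall>a\<in>P. ldist K ((inv\<^bsub>Aut L K\<^esub> x) a) ((inv\<^bsub>Aut L K\<^esub> y) a) < \<delta> \<Longrightarrow> \<bar>f x - f y\<bar> \<le> \<epsilon>"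
      using f unfolding UC_iff by metis
    have "\<bar>\<nu> (\<lambda>z. f (x \<otimes>\<^bsub>Aut L K\<^esub> z)) - \<nu> (\<lambda>z. f (y \<otimes>\<^bsub>Aut L K\<^esub> z))\<bar> \<le> \<epsilon>"
      if xy: "x \<in> ?G" "y \<in> ?G"
        "\<forall>a\<in>P. ldist K ((inv\<^bsub>Aut L K\<^esub> x) a) ((inv\<^bsub>Aut L K\<^esub> y) a) < \<delta>" for x y
    proof -
      have "\<bar>f (x \<otimes>\<^bsub>Aut L K\<^esub> z) - f (y \<otimes>\<^bsub>Aut L K\<^esub> z)\<bar> \<le> \<epsilon>" if z: "z \<in> ?G" for z
      proof (intro P(4) mem xy(1,2) z ballI)
        fix a assume a: "a \<in> P"
        have in': "(inv\<^bsub>Aut L K\<^esub> x) a \<in> univ K" "(inv\<^bsub>Aut L K\<^esub> y) a \<in> univ K"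
          using a P(2) Mor_in[OF automorphism_Mor[OF inv_Aut(1)[OF xy(1)]]]
            Mor_in[OF automorphism_Mor[OF inv_Aut(1)[OF xy(2)]]] by auto
        show "ldist K ((inv\<^bsub>Aut L K\<^esub> (x \<otimes>\<^bsub>Aut L K\<^esub> z)) a) ((inv\<^bsub>Aut L K\<^esub> (y \<otimes>\<^bsub>Aut L K\<^esub> z)) a) < \<delta>"
          using a P(2) xy in' Mor_dist[OF automorphism_Mor[OF inv_Aut(1)[OF z]] in']
          by (simp add: inv_mult_Aut_apply[OF xy(1) z] inv_mult_Aut_apply[OF xy(2) z] subset_eq)
      qed
      then have "\<bar>\<nu> (\<lambda>z. f (x \<otimes>\<^bsub>Aut L K\<^esub> z) - f (y \<otimes>\<^bsub>Aut L K\<^esub> z))\<bar> \<le> \<epsilon>"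
        using tr[OF f xy(1)] tr[OF f xy(2)]
        by (intro mean_bound[OF \<nu> diff_closed]) (auto simp: carrier_Aut)
      then show ?thesis
        using mean_diff[OF \<nu> tr[OF f xy(1)] tr[OF f xy(2)]] by simp
    qed
    then show "\<exists>P \<delta>. finite P \<and> P \<subseteq> univ K \<and> 0 < \<delta> \<and> (\<forall>x\<in>?G. \<forall>y\<in>?G.
        (\<forall>a\<in>P. ldist K ((inv\<^bsub>Aut L K\<^esub> x) a) ((inv\<^bsub>Aut L K\<^esub> y) a) < \<delta>) \<longrightarrow>
        \<bar>\<nu> (\<lambda>z. f (x \<otimes>\<^bsub>Aut L K\<^esub> z)) - \<nu> (\<lambda>z. f (y \<otimes>\<^bsub>Aut L K\<^esub> z))\<bar> \<le> \<epsilon>)"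
      using P(1-3) by blast
  qed
  show ?thesis
    by unfold_locales (auto simp: carrier_Aut intro!: tr avg)
qed

lemma amenable_iff:
  "amenable (Aut L K) (Aut_topology L K) \<longleftrightarrow>
    (\<exists>\<nu>\<in>means (automorphisms L K) (UC L K). \<forall>f\<in>UC L K. \<forall>g\<in>automorphisms L K.
       \<nu> (\<lambda>x. f (g \<otimes>\<^bsub>Aut L K\<^esub> x)) = \<nu> f)"
proof
  let ?G = "automorphisms L K" and ?U = "UCb_right (Aut L K) (Aut_topology L K)"
  interpret translation_lattice "Aut L K" "UC L K" by (rule UC_translation_lattice)
  have G: "carrier (Aut L K) = ?G" by (rule carrier_Aut)
  {
    assume "amenable (Aut L K) (Aut_topology L K)"
    then obtain \<nu> :: "(('a \<Rightarrow> 'a) \<Rightarrow> real) \<Rightarrow> real" where \<nu>: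
      "\<And>f h. f \<in> ?U \<Longrightarrow> h \<in> ?U \<Longrightarrow> \<nu> (\<lambda>x\<in>?G. f x + h x) = \<nu> f + \<nu> h"
      "\<And>f c. f \<in> ?U \<Longrightarrow> \<nu> (\<lambda>x\<in>?G. c * f x) = c * \<nu> f"
      "\<And>f. f \<in> ?U \<Longrightarrow> (INF x\<in>?G. f x) \<le> \<nu> f \<and> \<nu> f \<le> (SUP x\<in>?G. f x)"
      "\<And>f g. f \<in> ?U \<Longrightarrow> g \<in> ?G \<Longrightarrow> \<nu> (\<lambda>x\<in>?G. f (g \<otimes>\<^bsub>Aut L K\<^esub> x)) = \<nu> f"
      unfolding amenable_def G by blast
    define \<mu> where "\<mu> f = \<nu> (restrict f ?G)" for f
    have r: "restrict f ?G \<in> ?U" if "f \<in> UC L K" for f using that by (simp add: UC_def)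
    have "\<mu> (\<lambda>x. f x + h x) = \<mu> f + \<mu> h" if "f \<in> UC L K" "h \<in> UC L K" for f h
      using \<nu>(1)[OF r[OF that(1)] r[OF that(2)]] by (simp add: \<mu>_def cong: restrict_cong)
    moreover have "\<mu> (\<lambda>x. c * f x) = c * \<mu> f" if "f \<in> UC L K" for f c
      using \<nu>(2)[OF r[OF that]] by (simp add: \<mu>_def cong: restrict_cong)
    moreover have "0 \<le> \<mu> f" if "f \<in> UC L K" "\<forall>x\<in>?G. 0 \<le> f x" for f
    proof -
      have "0 \<le> (INF x\<in>?G. restrict f ?G x)"
        using that(2) nonempty[unfolded G] by (intro cINF_greatest) auto
      then show ?thesis using \<nu>(3)[OF r[OF that(1)]] by (simp add: \<mu>_def)
    qed
    moreover have "\<mu> (\<lambda>_. 1) = 1"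
    proof -
      have "restrict (\<lambda>_. 1::real) ?G ` ?G = {1}" using nonempty[unfolded G] by auto
      then show ?thesis using \<nu>(3)[OF r[OF UC_const[of 1]]] by (simp add: \<mu>_def)
    qed
    ultimately have "\<mu> \<in> means ?G (UC L K)" by (simp add: means_def)
    moreover have "\<mu> (\<lambda>x. f (g \<otimes>\<^bsub>Aut L K\<^esub> x)) = \<mu> f" if "f \<in> UC L K" "g \<in> ?G" for f g
    proof -
      have "(\<lambda>x\<in>?G. restrict f ?G (g \<otimes>\<^bsub>Aut L K\<^esub> x)) = (\<lambda>x\<in>?G. f (g \<otimes>\<^bsub>Aut L K\<^esub> x))"
        using that(2) m_closed[unfolded G] by (intro restrict_ext) simp
      then show ?thesis using \<nu>(4)[OF r[OF that(1)] that(2)] by (simp add: \<mu>_def)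
    qed
    ultimately show "\<exists>\<nu>\<in>means ?G (UC L K). \<forall>f\<in>UC L K. \<forall>g\<in>?G.
       \<nu> (\<lambda>x. f (g \<otimes>\<^bsub>Aut L K\<^esub> x)) = \<nu> f" by blast
  }
  {
    assume "\<exists>\<nu>\<in>means ?G (UC L K). \<forall>f\<in>UC L K. \<forall>g\<in>?G. \<nu> (\<lambda>x. f (g \<otimes>\<^bsub>Aut L K\<^esub> x)) = \<nu> f"
    then obtain \<nu> where \<nu>: "\<nu> \<in> M" "\<And>f g. f \<in> UC L K \<Longrightarrow> g \<in> ?G \<Longrightarrow>
        \<nu> (\<lambda>x. f (g \<otimes>\<^bsub>Aut L K\<^esub> x)) = \<nu> f" unfolding G by blast
    have U: "f \<in> UC L K" if "f \<in> ?U" for f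
    proof -
      have "f \<in> extensional ?G" using that by (simp add: UCb_right_def G)
      then show ?thesis using that by (simp add: UC_def extensional_restrict)
    qed
    have restr: "\<nu> (restrict f ?G) = \<nu> f" if "f \<in> UC L K" for f
      using that by (intro mean_cong[OF \<nu>(1)]) (auto simp: G)
    have "(INF x\<in>?G. f x) \<le> \<nu> f \<and> \<nu> f \<le> (SUP x\<in>?G. f x)" if "f \<in> ?U" for f
    proof -
      have fU: "f \<in> UC L K" using that by (rule U)
      obtain c where c: "\<And>x. x \<in> ?G \<Longrightarrow> \<bar>f x\<bar> \<le> c" using UC_bounded[OF fU] by blast
      have b: "bdd_below (f ` ?G)" "bdd_above (f ` ?G)"
        using c by (intro bdd_belowI2[of _ "-c"] bdd_aboveI2[of _ _ c]; force simp: abs_le_iff)+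
      have "\<nu> (\<lambda>_. INF x\<in>?G. f x) \<le> \<nu> f" "\<nu> f \<le> \<nu> (\<lambda>_. SUP x\<in>?G. f x)"
        using b by (auto intro!: mean_mono[OF \<nu>(1)] fU cINF_lower cSUP_upper simp: G)
      then show ?thesis using mean_const[OF \<nu>(1)] by simp
    qed
    then show "amenable (Aut L K) (Aut_topology L K)"
      unfolding amenable_def G
      using mean_add[OF \<nu>(1) U U] mean_scale[OF \<nu>(1) U] \<nu>(2)[OF U]
      by (intro exI[of _ \<nu>])
        (simp add: restr U add_closed scale_closed translate[unfolded G])
  }
qed

section \<open>Matchings give amenability\<close>

lemma matching_number_attained:
  assumes "finite F"
  obtains D m where "D \<subseteq> F" "m \<in> D \<rightarrow> F" "inj_on m D"
    "\<And>\<gamma>. \<gamma> \<in> D \<Longrightarrow> \<exists>i\<in>{0..k}. {compose (univ A) (\<psi> \<gamma>) \<alpha>, compose (univ A) (\<psi> (m \<gamma>)) \<beta>}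
        \<subseteq> rho_nbhd L A C {\<eta> \<in> Mor L A C. \<phi> \<eta> = i} \<epsilon>"
    "matching_number L A C k F \<psi> \<alpha> \<beta> \<phi> \<epsilon> = card D"
proof -
  let ?good = "\<lambda>D. D \<subseteq> F \<and> (\<exists>m. m \<in> D \<rightarrow> F \<and> inj_on m D \<and>
    (\<forall>\<gamma>\<in>D. \<exists>i\<in>{0..k}. {compose (univ A) (\<psi> \<gamma>) \<alpha>, compose (univ A) (\<psi> (m \<gamma>)) \<beta>}
        \<subseteq> rho_nbhd L A C {\<eta> \<in> Mor L A C. \<phi> \<eta> = i} \<epsilon>))"
  have "{card D | D. ?good D} \<subseteq> card ` Pow F" by blast
  then have "finite {card D | D. ?good D}" using assms by (meson finite_Pow_iff finite_imageI finite_subset)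
  moreover have "card {} \<in> {card D | D. ?good D}" by (rule CollectI, rule exI[of _ "{}"]) auto
  ultimately have "Max {card D | D. ?good D} \<in> {card D | D. ?good D}" by (intro Max_in) auto
  then show ?thesis unfolding matching_number_def[symmetric] using that by blast
qed

lemma matching_number_ge:
  assumes "finite F" "D \<subseteq> F" "m \<in> D \<rightarrow> F" "inj_on m D"
    "\<And>\<gamma>. \<gamma> \<in> D \<Longrightarrow> \<exists>i\<in>{0..k}. {compose (univ A) (\<psi> \<gamma>) \<alpha>, compose (univ A) (\<psi> (m \<gamma>)) \<beta>}
        \<subseteq> rho_nbhd L A C {\<eta> \<in> Mor L A C. \<phi> \<eta> = i} \<epsilon>"
  shows "card D \<le> matching_number L A C k F \<psi> \<alpha> \<beta> \<phi> \<epsilon>"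
proof -
  let ?good = "\<lambda>D. D \<subseteq> F \<and> (\<exists>m. m \<in> D \<rightarrow> F \<and> inj_on m D \<and>
    (\<forall>\<gamma>\<in>D. \<exists>i\<in>{0..k}. {compose (univ A) (\<psi> \<gamma>) \<alpha>, compose (univ A) (\<psi> (m \<gamma>)) \<beta>}
        \<subseteq> rho_nbhd L A C {\<eta> \<in> Mor L A C. \<phi> \<eta> = i} \<epsilon>))"
  have "{card D | D. ?good D} \<subseteq> card ` Pow F" by blast
  then have "finite {card D | D. ?good D}" using assms(1) by (meson finite_Pow_iff finite_imageI finite_subset)
  moreover have "card D \<in> {card D | D. ?good D}" using assms(2-5) by blast
  ultimately show ?thesis unfolding matching_number_def by (rule Max_ge)
qed

text \<open>An embedding of \<open>A\<close> into \<open>C\<close> gets the colour \<open>1\<close> if some automorphism \<open>x\<close> with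
  \<open>f x > 1/2\<close> is such that \<open>x\<inverse>\<close> is close to it. Here \<open>A\<close> is a copy of a finite set that controls \<open>f\<close> up
  to \<open>1/10\<close>, and \<open>B\<close> is a copy of its translates by \<open>g\<inverse>\<close> for \<open>g \<in> S\<close>, so that every such \<open>g\<close> corresponds
  to an embedding of \<open>A\<close> into \<open>B\<close>. Homogeneity turns the copies \<open>\<psi> \<gamma>\<close> of \<open>B\<close> into automorphisms
  \<open>x \<gamma>\<close>. A partner of a sample with \<open>f > 13/20\<close> then has \<open>f \<ge> 7/20\<close>, because its colour is \<open>1\<close> up to
  the error \<open>\<epsilon>\<close> in \<open>\<rho>\<close>.\<close>

lemma samples_of_matchings:
  fixes K :: "('a, 'r) lstructure" and L :: "'r language"
  assumes inf: "infinite (UNIV :: 'b set)" and K: "is_structure L K" and hom: "homogeneous L K"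
    and k: "1 \<le> k"
    and matching: "\<And>\<epsilon> (A :: ('b, 'r) lstructure) (B :: ('b, 'r) lstructure).
      0 < \<epsilon> \<Longrightarrow> A \<in> age L K \<Longrightarrow> B \<in> age L K \<Longrightarrow>
      \<exists>C \<in> (age L K :: ('b, 'r) lstructure set). \<forall>\<phi> \<in> Mor L A C \<rightarrow> {0..k}.
        \<exists>(F::nat set) \<psi>. finite F \<and> F \<noteq> {} \<and> \<psi> \<in> F \<rightarrow> Mor L B C \<and>
          (\<forall>\<alpha>\<in>Mor L A B. \<forall>\<beta>\<in>Mor L A B.
             real (matching_number L A C k F \<psi> \<alpha> \<beta> \<phi> \<epsilon>) \<ge> (1 - \<epsilon>) * real (card F))"
    and f: "f \<in> UC L K" and S: "finite S" "S \<subseteq> automorphisms L K" and \<epsilon>: "0 < \<epsilon>"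
  shows "\<exists>(F::nat set) x. finite F \<and> F \<noteq> {} \<and> x \<in> F \<rightarrow> automorphisms L K \<and>
        (\<forall>g\<in>S. \<forall>h\<in>S. real (card {i\<in>F. 13/20 < f (g \<otimes>\<^bsub>Aut L K\<^esub> x i)}) \<le>
           real (card {i\<in>F. 7/20 \<le> f (h \<otimes>\<^bsub>Aut L K\<^esub> x i)}) + \<epsilon> * real (card F))"
proof -
  interpret group "Aut L K" by (rule group_Aut)
  let ?G = "automorphisms L K"
  let ?inv = "\<lambda>x. inv\<^bsub>Aut L K\<^esub> x"
  have inv_in: "?inv x a \<in> univ K" if "x \<in> ?G" "a \<in> univ K" for x a
    using Mor_in[OF automorphism_Mor[OF inv_Aut(1)[OF that(1)]] that(2)] .
  have "(0::real) < 1/10" by simp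
  then obtain P \<delta> where P: "finite P" "P \<subseteq> univ K" and \<delta>: "0 < \<delta>"
    and mod: "\<And>x y. x \<in> ?G \<Longrightarrow> y \<in> ?G \<Longrightarrow>
        \<forall>a\<in>P. ldist K (?inv x a) (?inv y a) < \<delta> \<Longrightarrow> \<bar>f x - f y\<bar> \<le> 1/10"
    using f unfolding UC_iff by meson
  obtain A :: "('b, 'r) lstructure" and u where
    A: "A \<in> age L K" "finite (univ A)" and u: "u \<in> Mor L A K" "u ` univ A = P"
    using age_copy[OF inf K P] by blast
  have u_in: "u a \<in> univ K" if "a \<in> univ A" for a using Mor_in[OF u(1) that] .
  define Q where "Q = (\<Union>g\<in>S. ?inv g ` P)"
  have Q: "finite Q" "Q \<subseteq> univ K"
    using P S inv_in by (auto simp: Q_def subset_eq)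
  obtain B :: "('b, 'r) lstructure" and v where
    B: "B \<in> age L K" "finite (univ B)" and v: "v \<in> Mor L B K" "v ` univ B = Q"
    using age_copy[OF inf K Q] by blast
  \<comment> \<open>An error \<open>\<delta>/8\<close> from homogeneity and an error \<open>\<delta>/8\<close> in \<open>\<rho>\<close> add up to the tolerance \<open>\<delta>/4\<close> of the
    colouring, and two embeddings within \<open>\<delta>/4\<close> of a third one are within \<open>\<delta>\<close> of each other.\<close>
  define e where "e = min \<epsilon> (\<delta>/8)"
  have e: "0 < e" "e \<le> \<epsilon>" "e \<le> \<delta>/8" using \<epsilon> \<delta> by (auto simp: e_def)
  obtain C :: "('b, 'r) lstructure" where C: "C \<in> age L K" and Ram: "\<And>\<phi>. \<phi> \<in> Mor L A C \<rightarrow> {0..k} \<Longrightarrow>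
        \<exists>(F::nat set) \<psi>. finite F \<and> F \<noteq> {} \<and> \<psi> \<in> F \<rightarrow> Mor L B C \<and>
          (\<forall>\<alpha>\<in>Mor L A B. \<forall>\<beta>\<in>Mor L A B.
             real (matching_number L A C k F \<psi> \<alpha> \<beta> \<phi> e) \<ge> (1 - e) * real (card F))"
    using matching[OF e(1) A(1) B(1)] by blast
  obtain j where j: "j \<in> Mor L C K" using C by (auto simp: age_def)
  define \<phi> where "\<phi> = (\<lambda>\<xi>. if \<exists>x\<in>?G. 1/2 < f x \<and>
      (\<forall>a\<in>univ A. ldist K (?inv x (u a)) (j (\<xi> a)) < \<delta>/4) then 1 else 0 :: nat)"
  have "\<phi> \<in> Mor L A C \<rightarrow> {0..k}" using k by (auto simp: \<phi>_def)
  from Ram[OF this] obtain F :: "nat set" and \<psi> where F: "finite F" "F \<noteq> {}"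
    and \<psi>: "\<psi> \<in> F \<rightarrow> Mor L B C"
    and large: "\<And>\<alpha> \<beta>. \<alpha> \<in> Mor L A B \<Longrightarrow> \<beta> \<in> Mor L A B \<Longrightarrow>
       (1 - e) * real (card F) \<le> real (matching_number L A C k F \<psi> \<alpha> \<beta> \<phi> e)" by blast
  have "\<exists>x. x \<in> ?G \<and> (\<forall>b\<in>univ B. ldist K (?inv x (v b)) (j (\<psi> \<gamma> b)) < \<delta>/8)" if "\<gamma> \<in> F" for \<gamma>
  proof -
    have \<psi>\<gamma>: "\<psi> \<gamma> \<in> Mor L B C" using \<psi> that by blast
    have "0 < \<delta>/8" using \<delta> by simp
    from homogeneous_extension[OF hom K v(1) Mor_compose[OF \<psi>\<gamma> j] B(2) this]
    obtain y where y: "y \<in> ?G"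
      "\<And>b. b \<in> univ B \<Longrightarrow> ldist K (y (v b)) (compose (univ B) j (\<psi> \<gamma>) b) < \<delta>/8" by blast
    have "?inv (?inv y) = y" using y(1) by (intro inv_inv) (simp add: carrier_Aut)
    then show ?thesis
      using y inv_Aut(1)[OF y(1)] by (intro exI[of _ "?inv y"]) (auto simp: compose_eq)
  qed
  then obtain x where x: "\<And>\<gamma>. \<gamma> \<in> F \<Longrightarrow> x \<gamma> \<in> ?G"
    "\<And>\<gamma> b. \<gamma> \<in> F \<Longrightarrow> b \<in> univ B \<Longrightarrow> ldist K (?inv (x \<gamma>) (v b)) (j (\<psi> \<gamma> b)) < \<delta>/8" by metis
  have "\<exists>\<alpha>. \<alpha> \<in> Mor L A B \<and> (\<forall>a\<in>univ A. v (\<alpha> a) = ?inv g (u a))" if g: "g \<in> S" for g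
  proof -
    have gG: "g \<in> ?G" using S(2) g by blast
    have "compose (univ A) (?inv g) u ` univ A \<subseteq> v ` univ B"
      using g u(2) unfolding v(2) Q_def by (auto simp: compose_eq)
    from Mor_factor[OF v(1) Mor_compose[OF u(1) automorphism_Mor[OF inv_Aut(1)[OF gG]]] this]
    show ?thesis by (metis compose_eq)
  qed
  then obtain \<alpha> where \<alpha>: "\<And>g. g \<in> S \<Longrightarrow> \<alpha> g \<in> Mor L A B"
    "\<And>g a. g \<in> S \<Longrightarrow> a \<in> univ A \<Longrightarrow> v (\<alpha> g a) = ?inv g (u a)" by metis
  let ?x = "\<lambda>g \<gamma>. g \<otimes>\<^bsub>Aut L K\<^esub> x \<gamma>"
  have x_in: "?x g \<gamma> \<in> ?G" if "g \<in> S" "\<gamma> \<in> F" for g \<gamma>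
    using m_closed[of g "x \<gamma>"] S(2) x(1) that by (auto simp: carrier_Aut)
  have near: "ldist K (?inv (?x g \<gamma>) (u a)) (j (\<psi> \<gamma> (\<alpha> g a))) < \<delta>/8"
    if "g \<in> S" "\<gamma> \<in> F" "a \<in> univ A" for g \<gamma> a
  proof -
    have "?inv (?x g \<gamma>) (u a) = ?inv (x \<gamma>) (v (\<alpha> g a))"
      using that S(2) x(1) \<alpha>(2) inv_mult_Aut_apply[of g L K "x \<gamma>" "u a"] u_in by auto
    then show ?thesis using x(2)[OF that(2) Mor_in[OF \<alpha>(1) that(3)]] that(1) by simp
  qed
  \<comment> \<open>Translated by \<open>g\<close>, the sample \<open>x \<gamma>\<close> inherits from \<open>\<psi> \<gamma> \<circ> \<alpha> g\<close> its proximity to a colour class.\<close>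
  have nbhd: "\<exists>\<eta>\<in>Mor L A C. \<phi> \<eta> = i \<and> (\<forall>a\<in>univ A. ldist K (?inv (?x g \<gamma>) (u a)) (j (\<eta> a)) < \<delta>/4)"
    if g: "g \<in> S" and \<gamma>: "\<gamma> \<in> F" and
      n: "compose (univ A) (\<psi> \<gamma>) (\<alpha> g) \<in> rho_nbhd L A C {\<eta> \<in> Mor L A C. \<phi> \<eta> = i} e" for g \<gamma> i
  proof -
    obtain \<eta> where \<eta>: "\<eta> \<in> Mor L A C" "\<phi> \<eta> = i"
      "rho A C (compose (univ A) (\<psi> \<gamma>) (\<alpha> g)) \<eta> < e"
      using n by (auto simp: rho_nbhd_def)
    have \<psi>\<gamma>: "\<psi> \<gamma> \<in> Mor L B C" using \<psi> \<gamma> by blast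
    have "ldist K (?inv (?x g \<gamma>) (u a)) (j (\<eta> a)) < \<delta>/4" if a: "a \<in> univ A" for a
    proof -
      have in': "\<psi> \<gamma> (\<alpha> g a) \<in> univ C" "\<eta> a \<in> univ C"
        using Mor_in[OF \<psi>\<gamma>] Mor_in[OF \<alpha>(1)[OF g] a] Mor_in[OF \<eta>(1) a] by auto
      have "ldist C (\<psi> \<gamma> (\<alpha> g a)) (\<eta> a) < e"
        using \<eta>(3) a unfolding rho_less_iff[OF A(2)] by (simp add: compose_eq)
      then have "ldist K (j (\<psi> \<gamma> (\<alpha> g a))) (j (\<eta> a)) < \<delta>/8"
        using Mor_dist[OF j in'] e(3) by simp
      moreover have "ldist K (?inv (?x g \<gamma>) (u a)) (j (\<eta> a)) \<le>
          ldist K (?inv (?x g \<gamma>) (u a)) (j (\<psi> \<gamma> (\<alpha> g a))) + ldist K (j (\<psi> \<gamma> (\<alpha> g a))) (j (\<eta> a))"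
        using inv_in[OF x_in[OF g \<gamma>] u_in[OF a]] Mor_in[OF j] in' by (intro mdist_triangle)
      ultimately show ?thesis using near[OF g \<gamma> a] by simp
    qed
    then show ?thesis using \<eta> by blast
  qed
  have high: "i = 1"
    if "g \<in> S" "\<gamma> \<in> F" "13/20 < f (?x g \<gamma>)"
      "compose (univ A) (\<psi> \<gamma>) (\<alpha> g) \<in> rho_nbhd L A C {\<eta> \<in> Mor L A C. \<phi> \<eta> = i} e" for g \<gamma> i
  proof -
    from nbhd[OF that(1,2,4)] obtain \<eta> where \<eta>: "\<phi> \<eta> = i" "\<forall>a\<in>univ A. ldist K (?inv (?x g \<gamma>) (u a)) (j (\<eta> a)) < \<delta>/4"
      by blast
    moreover have "1/2 < f (?x g \<gamma>)" using that(3) by simp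
    ultimately have "\<phi> \<eta> = 1" unfolding \<phi>_def using x_in[OF that(1,2)] by auto
    then show ?thesis using \<eta>(1) by simp
  qed
  have low: "7/20 \<le> f (?x g \<gamma>)"
    if g: "g \<in> S" and \<gamma>: "\<gamma> \<in> F" and
      n: "compose (univ A) (\<psi> \<gamma>) (\<alpha> g) \<in> rho_nbhd L A C {\<eta> \<in> Mor L A C. \<phi> \<eta> = 1} e" for g \<gamma>
  proof -
    obtain \<eta> where \<eta>: "\<eta> \<in> Mor L A C" "\<phi> \<eta> = 1"
      "\<And>a. a \<in> univ A \<Longrightarrow> ldist K (?inv (?x g \<gamma>) (u a)) (j (\<eta> a)) < \<delta>/4"
      using nbhd[OF g \<gamma> n] by blast
    obtain z where z: "z \<in> ?G" "1/2 < f z"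
      "\<And>a. a \<in> univ A \<Longrightarrow> ldist K (?inv z (u a)) (j (\<eta> a)) < \<delta>/4"
      using \<eta>(2) by (auto simp: \<phi>_def split: if_splits)
    have "ldist K (?inv (?x g \<gamma>) p) (?inv z p) < \<delta>" if "p \<in> P" for p
    proof -
      obtain a where a: "a \<in> univ A" "p = u a" using \<open>p \<in> P\<close> u(2) by blast
      have "ldist K (?inv (?x g \<gamma>) (u a)) (?inv z (u a)) \<le>
          ldist K (?inv (?x g \<gamma>) (u a)) (j (\<eta> a)) + ldist K (j (\<eta> a)) (?inv z (u a))"
        using inv_in[OF x_in[OF g \<gamma>] u_in[OF a(1)]] inv_in[OF z(1) u_in[OF a(1)]]
          Mor_in[OF j Mor_in[OF \<eta>(1) a(1)]] by (intro mdist_triangle)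
      then show ?thesis
        using \<eta>(3)[OF a(1)] z(3)[OF a(1)] \<delta> by (simp add: a(2) mdist_commute)
    qed
    then have "\<bar>f (?x g \<gamma>) - f z\<bar> \<le> 1/10" using mod[OF x_in[OF g \<gamma>] z(1)] by blast
    then show ?thesis using z(2) by linarith
  qed
  have "real (card {i\<in>F. 13/20 < f (?x g i)}) \<le> real (card {i\<in>F. 7/20 \<le> f (?x h i)}) + \<epsilon> * real (card F)"
    if g: "g \<in> S" and h: "h \<in> S" for g h
  proof -
    obtain D m where D: "D \<subseteq> F" "m \<in> D \<rightarrow> F" "inj_on m D"
      "\<And>\<gamma>. \<gamma> \<in> D \<Longrightarrow> \<exists>i\<in>{0..k}. {compose (univ A) (\<psi> \<gamma>) (\<alpha> g), compose (univ A) (\<psi> (m \<gamma>)) (\<alpha> h)}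
        \<subseteq> rho_nbhd L A C {\<eta> \<in> Mor L A C. \<phi> \<eta> = i} e"
      "matching_number L A C k F \<psi> (\<alpha> g) (\<alpha> h) \<phi> e = card D"
      by (rule matching_number_attained[OF F(1), of k A \<psi> "\<alpha> g" "\<alpha> h" L C \<phi> e])
        (rule that)
    let ?H = "{i\<in>F. 13/20 < f (?x g i)}" and ?W = "{i\<in>F. 7/20 \<le> f (?x h i)}"
    have "m \<gamma> \<in> ?W" if \<gamma>: "\<gamma> \<in> ?H \<inter> D" for \<gamma>
    proof -
      obtain i where i: "compose (univ A) (\<psi> \<gamma>) (\<alpha> g) \<in> rho_nbhd L A C {\<eta> \<in> Mor L A C. \<phi> \<eta> = i} e"
        "compose (univ A) (\<psi> (m \<gamma>)) (\<alpha> h) \<in> rho_nbhd L A C {\<eta> \<in> Mor L A C. \<phi> \<eta> = i} e"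
        using D(4)[of \<gamma>] \<gamma> by auto
      have "i = 1" using high[OF g _ _ i(1)] \<gamma> by blast
      moreover have "m \<gamma> \<in> F" using D(2) \<gamma> by blast
      ultimately show ?thesis using low[OF h _ i(2)[unfolded \<open>i = 1\<close>]] by blast
    qed
    then have "m ` (?H \<inter> D) \<subseteq> ?W" by blast
    then have "card (?H \<inter> D) \<le> card ?W"
      using F(1) D(3) by (intro card_inj_on_le[of m]) (auto intro: inj_on_subset)
    moreover have "card ?H \<le> card (?H \<inter> D) + card (F - D)"
    proof -
      have "card ?H \<le> card ((?H \<inter> D) \<union> (F - D))" using F(1) D(1) by (intro card_mono) (auto intro: finite_subset)
      also have "\<dots> \<le> card (?H \<inter> D) + card (F - D)" by (rule card_Un_le)
      finally show ?thesis .
    qed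
    moreover have "real (card (F - D)) \<le> \<epsilon> * real (card F)"
    proof -
      have "real (card (F - D)) = real (card F) - real (card D)"
        using F(1) D(1) by (simp add: card_Diff_subset finite_subset of_nat_diff card_mono)
      also have "\<dots> \<le> e * real (card F)"
        using large[OF \<alpha>(1)[OF g] \<alpha>(1)[OF h]] D(5) by (simp add: algebra_simps)
      also have "\<dots> \<le> \<epsilon> * real (card F)" using e(2) by (intro mult_right_mono) auto
      finally show ?thesis .
    qed
    ultimately show ?thesis by linarith
  qed
  then show ?thesis using F x(1) by (intro exI[of _ F] exI[of _ x]) auto
qed

section \<open>Amenability gives matchings\<close>

lemma rho_nonneg: "finite (univ A) \<Longrightarrow> 0 \<le> rho A B \<alpha> \<beta>"
  using rho_less_iff[of A B \<alpha> \<beta> 0] by simp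

lemma ldist_le_rho: "finite (univ A) \<Longrightarrow> a \<in> univ A \<Longrightarrow> ldist B (\<alpha> a) (\<beta> a) \<le> rho A B \<alpha> \<beta>"
  using rho_le_iff[of A "rho A B \<alpha> \<beta>" B \<alpha> \<beta>] rho_nonneg[of A B \<alpha> \<beta>] by simp

lemma rho_self:
  assumes "finite (univ A)" "\<alpha> \<in> Mor L A B" shows "rho A B \<alpha> \<alpha> = 0"
  using rho_le_iff[of A 0 B \<alpha> \<alpha>] rho_nonneg[of A B \<alpha> \<alpha>] Mor_in[OF assms(2)] assms(1) by simp

lemma rho_commute: "rho A B \<alpha> \<beta> = rho A B \<beta> \<alpha>"
  by (simp add: rho_def mdist_commute)

lemma rho_triangle:
  assumes "finite (univ A)" "\<alpha> \<in> Mor L A B" "\<beta> \<in> Mor L A B" "\<gamma> \<in> Mor L A B"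
  shows "rho A B \<alpha> \<gamma> \<le> rho A B \<alpha> \<beta> + rho A B \<beta> \<gamma>"
proof -
  have "ldist B (\<alpha> a) (\<gamma> a) \<le> rho A B \<alpha> \<beta> + rho A B \<beta> \<gamma>" if a: "a \<in> univ A" for a
  proof -
    have "ldist B (\<alpha> a) (\<gamma> a) \<le> ldist B (\<alpha> a) (\<beta> a) + ldist B (\<beta> a) (\<gamma> a)"
      using Mor_in[OF assms(2) a] Mor_in[OF assms(3) a] Mor_in[OF assms(4) a] by (intro mdist_triangle)
    then show ?thesis
      using ldist_le_rho[OF assms(1) a, of B \<alpha> \<beta>] ldist_le_rho[OF assms(1) a, of B \<beta> \<gamma>] by linarith
  qed
  then show ?thesis
    using assms(1) by (subst rho_le_iff) (auto intro!: add_nonneg_nonneg rho_nonneg)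
qed

text \<open>One function of embeddings of \<open>A\<close> for every set of colours. Points that are not embeddings
  are only constrained to have values in \<open>[0, 1]\<close>, which makes this a compact subset of the
  product space.\<close>

definition lipschitz_family ::
    "'r language \<Rightarrow> ('b, 'r) lstructure \<Rightarrow> ('a, 'r) lstructure \<Rightarrow> real \<Rightarrow>
      (nat set \<times> ('b \<Rightarrow> 'a) \<Rightarrow> real) set" where
  "lipschitz_family L A K \<epsilon> = {f. (\<forall>t. f t \<in> {0..1}) \<and>
     (\<forall>I. \<forall>\<xi>\<in>Mor L A K. \<forall>\<eta>\<in>Mor L A K. f (I, \<xi>) \<le> f (I, \<eta>) + rho A K \<xi> \<eta> / \<epsilon>)}"

lemma compact_lipschitz_family:
  fixes A :: "('b, 'r) lstructure" and K :: "('a, 'r) lstructure"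
  shows "compact (lipschitz_family L A K \<epsilon>)"
proof -
  let ?T = "(UNIV :: nat set set) \<times> Mor L A K \<times> Mor L A K"
  have eq: "lipschitz_family L A K \<epsilon> = {f. \<forall>t. f t \<in> {0..1}} \<inter>
      (\<Inter>(I, \<xi>, \<eta>)\<in>?T. {f. f (I, \<xi>) \<le> f (I, \<eta>) + rho A K \<xi> \<eta> / \<epsilon>})"
    unfolding lipschitz_family_def by blast
  have "closed {f. f s \<le> f t + c}" for s t :: "nat set \<times> ('b \<Rightarrow> 'a)" and c :: real
    by (intro closed_Collect_le continuous_on_product_coordinates continuous_on_add continuous_on_const)
  then have "closed (\<Inter>(I, \<xi>, \<eta>)\<in>?T. {f. f (I, \<xi>) \<le> f (I, \<eta>) + rho A K \<xi> \<eta> / \<epsilon>})"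
    by (intro closed_INT) auto
  then show ?thesis
    unfolding eq using compact_box[of "\<lambda>_. 0" "\<lambda>_. 1"] by (intro compact_Int_closed)
qed

text \<open>For an embedding \<open>\<alpha>\<close> of \<open>A\<close> into \<open>B\<close>, the value of \<open>f\<close> at \<open>x\<inverse> \<circ> e \<circ> \<alpha>\<close> is a uniformly
  continuous function of \<open>x\<close>. By homogeneity, changing \<open>\<alpha>\<close> amounts to a translation up to
  an arbitrarily small error, so its mean does not depend on \<open>\<alpha>\<close>.\<close>

lemma averaging_copies:
  fixes K :: "('a, 'r) lstructure" and A B :: "('b, 'r) lstructure"
  assumes K: "is_structure L K" and hom: "homogeneous L K"
    and amen: "amenable (Aut L K) (Aut_topology L K)"
    and A: "finite (univ A)" and B: "finite (univ B)" "e \<in> Mor L B K"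
    and \<epsilon>: "0 < \<epsilon>" and f: "f \<in> lipschitz_family L A K \<epsilon>"
  shows "\<exists>N y. 0 < N \<and> (\<forall>i<N. y i \<in> Mor L B K) \<and>
    (\<forall>I\<subseteq>{0..k}. \<forall>\<alpha>\<in>Mor L A B. \<forall>\<beta>\<in>Mor L A B.
      (\<Sum>i<N. f (I, compose (univ A) (y i) \<alpha>)) <
      (\<Sum>i<N. f (I, compose (univ A) (y i) \<beta>)) + \<epsilon> * real N)"
proof -
  let ?G = "automorphisms L K"
  let ?inv = "\<lambda>x. inv\<^bsub>Aut L K\<^esub> x"
  interpret translation_lattice "Aut L K" "UC L K" by (rule UC_translation_lattice)
  obtain \<nu> where \<nu>: "\<nu> \<in> M" and inv: "\<And>f g. f \<in> UC L K \<Longrightarrow> g \<in> ?G \<Longrightarrow>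
      \<nu> (\<lambda>x. f (g \<otimes>\<^bsub>Aut L K\<^esub> x)) = \<nu> f"
    using amen unfolding amenable_iff carrier_Aut by blast
  have "f t \<in> {0..1}" for t
    using f unfolding lipschitz_family_def by blast
  then have f_range: "0 \<le> f t" "f t \<le> 1" for t
    by simp_all
  have f_lip: "\<bar>f (I, \<xi>) - f (I, \<eta>)\<bar> \<le> rho A K \<xi> \<eta> / \<epsilon>" if "\<xi> \<in> Mor L A K" "\<eta> \<in> Mor L A K" for I \<xi> \<eta>
  proof -
    have "f (I, \<xi>) \<le> f (I, \<eta>) + rho A K \<xi> \<eta> / \<epsilon>" "f (I, \<eta>) \<le> f (I, \<xi>) + rho A K \<eta> \<xi> / \<epsilon>"
      using f that by (auto simp: lipschitz_family_def)
    then show ?thesis using rho_commute[of A K \<xi> \<eta>] by (simp add: abs_le_iff)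
  qed
  have close: "\<bar>f (I, \<xi>) - f (I, \<eta>)\<bar> \<le> \<tau>"
    if "\<xi> \<in> Mor L A K" "\<eta> \<in> Mor L A K" "0 < \<tau>" "\<And>a. a \<in> univ A \<Longrightarrow> ldist K (\<xi> a) (\<eta> a) < \<epsilon> * \<tau>" for I \<xi> \<eta> \<tau>
  proof -
    have "rho A K \<xi> \<eta> \<le> \<epsilon> * \<tau>"
      using that \<epsilon> by (subst rho_le_iff[OF A]) (auto intro: less_imp_le)
    then have "rho A K \<xi> \<eta> / \<epsilon> \<le> \<tau>" using \<epsilon> by (simp add: pos_divide_le_eq mult.commute)
    then show ?thesis using f_lip[OF that(1,2), of I] by linarith
  qed
  define Y where "Y x = compose (univ B) (?inv x) e" for x
  have Y: "Y x \<in> Mor L B K" if "x \<in> ?G" for x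
    unfolding Y_def by (rule Mor_compose[OF B(2) automorphism_Mor[OF inv_Aut(1)[OF that]]])
  have Y_apply: "compose (univ A) (Y x) \<alpha> a = ?inv x (e (\<alpha> a))"
    if "\<alpha> \<in> Mor L A B" "a \<in> univ A" for x \<alpha> a
    using Mor_in[OF that] that(2) by (simp add: Y_def compose_eq)
  define h where "h = (\<lambda>(I, \<alpha>) x. f (I, compose (univ A) (Y x) \<alpha>))"
  have hU: "h (I, \<alpha>) \<in> UC L K" if \<alpha>: "\<alpha> \<in> Mor L A B" for I \<alpha>
    unfolding UC_iff
  proof (intro conjI allI impI)
    show "\<exists>c. \<forall>x\<in>?G. \<bar>h (I, \<alpha>) x\<bar> \<le> c"
      using f_range by (intro exI[of _ 1]) (auto simp: h_def)
    fix \<tau> :: real assume \<tau>: "0 < \<tau>"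
    have "\<bar>h (I, \<alpha>) x - h (I, \<alpha>) y\<bar> \<le> \<tau>"
      if xy: "x \<in> ?G" "y \<in> ?G" "\<forall>a\<in>e ` univ B. ldist K (?inv x a) (?inv y a) < \<epsilon> * \<tau>" for x y
      using Mor_compose[OF \<alpha> Y[OF xy(1)]] Mor_compose[OF \<alpha> Y[OF xy(2)]] \<tau> xy(3) Mor_in[OF \<alpha>]
      unfolding h_def by (auto intro!: close simp: Y_apply[OF \<alpha>])
    then show "\<exists>P \<delta>. finite P \<and> P \<subseteq> univ K \<and> 0 < \<delta> \<and> (\<forall>x\<in>?G. \<forall>y\<in>?G.
        (\<forall>a\<in>P. ldist K (?inv x a) (?inv y a) < \<delta>) \<longrightarrow> \<bar>h (I, \<alpha>) x - h (I, \<alpha>) y\<bar> \<le> \<tau>)"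
      using B Mor_in[OF B(2)] \<epsilon> \<tau> by (intro exI[of _ "e ` univ B"] exI[of _ "\<epsilon> * \<tau>"]) auto
  qed
  have same: "\<nu> (h (I, \<alpha>)) \<le> \<nu> (h (I, \<beta>))" if \<alpha>: "\<alpha> \<in> Mor L A B" and \<beta>: "\<beta> \<in> Mor L A B" for I \<alpha> \<beta>
  proof (rule field_le_epsilon)
    fix \<tau> :: real assume \<tau>: "0 < \<tau>"
    then have "0 < \<epsilon> * \<tau>" using \<epsilon> by simp
    from homogeneous_extension[OF hom K Mor_compose[OF \<alpha> B(2)] Mor_compose[OF \<beta> B(2)] A this]
    obtain g where g: "g \<in> ?G"
      and ge: "\<And>a. a \<in> univ A \<Longrightarrow> ldist K (g (e (\<alpha> a))) (e (\<beta> a)) < \<epsilon> * \<tau>"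
      by (metis compose_eq)
    let ?g = "?inv g"
    have g': "?g \<in> ?G" using g by (rule inv_Aut(1))
    have gg: "?inv ?g = g" using g by (intro inv_inv) (simp add: carrier_Aut)
    have "h (I, \<alpha>) (?g \<otimes>\<^bsub>Aut L K\<^esub> x) \<le> h (I, \<beta>) x + \<tau>" if x: "x \<in> ?G" for x
    proof -
      have gx: "?g \<otimes>\<^bsub>Aut L K\<^esub> x \<in> ?G" using m_closed[of ?g x] g' x by (simp add: carrier_Aut)
      have "ldist K (compose (univ A) (Y (?g \<otimes>\<^bsub>Aut L K\<^esub> x)) \<alpha> a) (compose (univ A) (Y x) \<beta> a) < \<epsilon> * \<tau>"
        if a: "a \<in> univ A" for a
      proof -
        have in': "e (\<alpha> a) \<in> univ K" "e (\<beta> a) \<in> univ K"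
          using Mor_in[OF B(2)] Mor_in[OF \<alpha> a] Mor_in[OF \<beta> a] by auto
        have "ldist K (?inv x (g (e (\<alpha> a)))) (?inv x (e (\<beta> a))) = ldist K (g (e (\<alpha> a))) (e (\<beta> a))"
          using Mor_in[OF automorphism_Mor[OF g] in'(1)] in'(2)
          by (intro Mor_dist[OF automorphism_Mor[OF inv_Aut(1)[OF x]]])
        then show ?thesis
          using ge[OF a] inv_mult_Aut_apply[OF g' x in'(1)] gg a by (simp add: Y_apply \<alpha> \<beta>)
      qed
      from close[OF Mor_compose[OF \<alpha> Y[OF gx]] Mor_compose[OF \<beta> Y[OF x]] \<tau> this, of I]
      show ?thesis by (simp add: h_def)
    qed
    then have "\<nu> (\<lambda>x. h (I, \<alpha>) (?g \<otimes>\<^bsub>Aut L K\<^esub> x)) \<le> \<nu> (\<lambda>x. h (I, \<beta>) x + \<tau>)"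
      using g'
      by (intro mean_mono[OF \<nu> translate[OF hU[OF \<alpha>]] add_closed[OF hU[OF \<beta>] const_closed]])
        (auto simp: carrier_Aut)
    then show "\<nu> (h (I, \<alpha>)) \<le> \<nu> (h (I, \<beta>)) + \<tau>"
      using inv[OF hU[OF \<alpha>] g'] mean_add[OF \<nu> hU[OF \<beta>] const_closed] mean_const[OF \<nu>] by simp
  qed
  have fin: "finite (Pow {0..k} \<times> Mor L A B)" using finite_Mor[OF A B(1)] by simp
  have h_in: "h t \<in> UC L K" if "t \<in> Pow {0..k} \<times> Mor L A B" for t
    using that hU by auto
  have "0 < \<epsilon>/3" using \<epsilon> by simp
  then have "\<exists>N x. 0 < N \<and> (\<forall>i<N. x i \<in> carrier (Aut L K)) \<and>
      (\<forall>t\<in>Pow {0..k} \<times> Mor L A B. \<bar>(\<Sum>i<N. h t (x i)) / real N - \<nu> (h t)\<bar> \<le> \<epsilon>/3)"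
    by (intro finite_average_approximation[OF \<nu> fin] h_in)
  then obtain N x where Nx: "0 < N \<and> (\<forall>i<N. x i \<in> ?G) \<and> (\<forall>t\<in>Pow {0..k} \<times> Mor L A B.
      \<bar>(\<Sum>i<N. h t (x i)) / real N - \<nu> (h t)\<bar> \<le> \<epsilon>/3)"
    unfolding carrier_Aut by (elim exE)
  then have N: "0 < N" "\<And>i. i < N \<Longrightarrow> x i \<in> ?G" by simp_all
  have approx: "\<bar>(\<Sum>i<N. h (I, \<alpha>) (x i)) / real N - \<nu> (h (I, \<alpha>))\<bar> \<le> \<epsilon>/3"
    if "I \<subseteq> {0..k}" "\<alpha> \<in> Mor L A B" for I \<alpha>
    using Nx that by simp
  have "(\<Sum>i<N. f (I, compose (univ A) (Y (x i)) \<alpha>)) <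
      (\<Sum>i<N. f (I, compose (univ A) (Y (x i)) \<beta>)) + \<epsilon> * real N"
    if "I \<subseteq> {0..k}" "\<alpha> \<in> Mor L A B" "\<beta> \<in> Mor L A B" for I \<alpha> \<beta>
  proof -
    have "(\<Sum>i<N. h (I, \<alpha>) (x i)) / real N < (\<Sum>i<N. h (I, \<beta>) (x i)) / real N + \<epsilon>"
      using approx[OF that(1,2)] approx[OF that(1,3)] same[OF that(2,3), of I] \<epsilon> by linarith
    then show ?thesis using N(1) by (simp add: h_def field_simps)
  qed
  then show ?thesis
    using N Y by (intro exI[of _ N] exI[of _ "\<lambda>i. Y (x i)"]) auto
qed

text \<open>Hall's condition is checked as follows. Let \<open>S\<close> be a set of indices and \<open>I\<close> the set of colours of
  \<open>\<psi> \<gamma> \<circ> \<alpha>\<close> for \<open>\<gamma> \<in> S\<close>. The function attached to \<open>I\<close> is \<open>1\<close> at these copies, and where it is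
  positive at \<open>\<psi> \<gamma>' \<circ> \<beta>\<close> the index \<open>\<gamma>'\<close> is a possible partner of an element of \<open>S\<close>.
  Comparing the two averages bounds the size of \<open>S\<close> by the number of partners, up to \<open>\<epsilon> N\<close>.\<close>

lemma matchings_of_amenable:
  fixes K :: "('a, 'r) lstructure" and A B :: "('b, 'r) lstructure"
  assumes inf: "infinite (UNIV :: 'b set)" and K: "is_structure L K" and hom: "homogeneous L K"
    and amen: "amenable (Aut L K) (Aut_topology L K)"
    and A: "A \<in> age L K" and B: "B \<in> age L K" and \<epsilon>: "0 < \<epsilon>"
  shows "\<exists>C \<in> (age L K :: ('b, 'r) lstructure set). \<forall>\<phi> \<in> Mor L A C \<rightarrow> {0..k}.
        \<exists>(F::nat set) \<psi>. finite F \<and> F \<noteq> {} \<and> \<psi> \<in> F \<rightarrow> Mor L B C \<and>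
          (\<forall>\<alpha>\<in>Mor L A B. \<forall>\<beta>\<in>Mor L A B.
             real (matching_number L A C k F \<psi> \<alpha> \<beta> \<phi> \<epsilon>) \<ge> (1 - \<epsilon>) * real (card F))"
proof -
  have finA: "finite (univ A)" and finB: "finite (univ B)"
    using A B by (auto simp: age_def finite_structure_def)
  obtain e where e: "e \<in> Mor L B K" using B by (auto simp: age_def)
  define \<Y> where "\<Y> = {(N::nat, y). 0 < N \<and> (\<forall>i<N. y i \<in> Mor L B K)}"
  define good where "good = (\<lambda>(N::nat, y :: nat \<Rightarrow> 'b \<Rightarrow> 'a). {f. \<forall>I\<subseteq>{0..k}. \<forall>\<alpha>\<in>Mor L A B. \<forall>\<beta>\<in>Mor L A B.
      (\<Sum>i<N. f (I, compose (univ A) (y i) \<alpha>)) <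
      (\<Sum>i<N. f (I, compose (univ A) (y i) \<beta>)) + \<epsilon> * real N})"
  have "lipschitz_family L A K \<epsilon> \<subseteq> (\<Union>t\<in>\<Y>. good t)"
  proof
    fix f assume "f \<in> lipschitz_family L A K \<epsilon>"
    from averaging_copies[OF K hom amen finA finB e \<epsilon> this, of k]
    obtain N y where "(N, y) \<in> \<Y>" "f \<in> good (N, y)" unfolding \<Y>_def good_def by auto
    then show "f \<in> (\<Union>t\<in>\<Y>. good t)" by blast
  qed
  moreover have "open (good t)" for t
  proof -
    obtain N y where t: "t = (N, y)" by fastforce
    let ?T = "Pow {0..k} \<times> Mor L A B \<times> Mor L A B"
    have "good t = (\<Inter>(I, \<alpha>, \<beta>)\<in>?T. {f. (\<Sum>i<N. f (I, compose (univ A) (y i) \<alpha>)) <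
      (\<Sum>i<N. f (I, compose (univ A) (y i) \<beta>)) + \<epsilon> * real N})"
      unfolding t good_def by auto
    moreover have "open {f. (\<Sum>i<N. f (u i)) < (\<Sum>i<N. f (v i)) + c}"
      for u v :: "nat \<Rightarrow> nat set \<times> ('b \<Rightarrow> 'a)" and c :: real
      by (intro open_Collect_less continuous_on_sum continuous_on_product_coordinates
          continuous_on_add continuous_on_const)
    moreover have "finite ?T" using finite_Mor[OF finA finB] by simp
    ultimately show ?thesis by (auto intro!: open_INT)
  qed
  ultimately obtain \<Y>' where Y': "\<Y>' \<subseteq> \<Y>" "finite \<Y>'" "lipschitz_family L A K \<epsilon> \<subseteq> (\<Union>t\<in>\<Y>'. good t)"
    using compactE_image[OF compact_lipschitz_family, of \<Y> good] by metis
  \<comment> \<open>The substructure spanned by the finitely many maps that serve all Lipschitz families.\<close>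
  define P where "P = (\<Union>(N, y)\<in>\<Y>'. \<Union>i<N. y i ` univ B)"
  have P: "finite P" "P \<subseteq> univ K"
  proof -
    show "finite P" using Y'(2) finB unfolding P_def by auto
    show "P \<subseteq> univ K"
    proof
      fix p assume "p \<in> P"
      then obtain N y i b where p: "(N, y) \<in> \<Y>'" "i < N" "b \<in> univ B" "p = y i b"
        unfolding P_def by auto
      then have "y i \<in> Mor L B K" using Y'(1) unfolding \<Y>_def by auto
      then show "p \<in> univ K" using Mor_in p(3,4) by metis
    qed
  qed
  obtain C :: "('b, 'r) lstructure" and c where
    C: "C \<in> age L K" "finite (univ C)" and c: "c \<in> Mor L C K" "c ` univ C = P"
    using age_copy[OF inf K P] by blast
  have "\<exists>(F::nat set) \<psi>. finite F \<and> F \<noteq> {} \<and> \<psi> \<in> F \<rightarrow> Mor L B C \<and>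
          (\<forall>\<alpha>\<in>Mor L A B. \<forall>\<beta>\<in>Mor L A B.
             real (matching_number L A C k F \<psi> \<alpha> \<beta> \<phi> \<epsilon>) \<ge> (1 - \<epsilon>) * real (card F))"
    if \<phi>: "\<phi> \<in> Mor L A C \<rightarrow> {0..k}" for \<phi>
  proof -
    let ?c = "\<lambda>\<eta>. compose (univ A) c \<eta>"
    have c_Mor: "?c \<eta> \<in> Mor L A K" if "\<eta> \<in> Mor L A C" for \<eta>
      by (rule Mor_compose[OF that c(1)])
    define V where "V I \<xi> = insert 0 ((\<lambda>\<eta>. 1 - rho A K \<xi> (?c \<eta>) / \<epsilon>) ` {\<eta> \<in> Mor L A C. \<phi> \<eta> \<in> I})" for I \<xi>
    define f where "f = (\<lambda>(I, \<xi>). Max (V I \<xi>))"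
    have finV: "finite (V I \<xi>)" "V I \<xi> \<noteq> {}" for I \<xi>
      using finite_Mor[OF finA C(2)] by (auto simp: V_def)
    have f_range: "0 \<le> f t" "f t \<le> 1" for t
    proof -
      obtain I \<xi> where t: "t = (I, \<xi>)" by fastforce
      show "0 \<le> f t" unfolding t f_def using finV by (auto simp: V_def intro!: Max_ge)
      show "f t \<le> 1" unfolding t f_def using finV \<epsilon> rho_nonneg[OF finA]
        by (auto simp: V_def intro!: Max.boundedI divide_nonneg_pos)
    qed
    have "f (I, \<xi>) \<le> f (I, \<zeta>) + rho A K \<xi> \<zeta> / \<epsilon>" if \<xi>: "\<xi> \<in> Mor L A K" and \<zeta>: "\<zeta> \<in> Mor L A K" for I \<xi> \<zeta>
    proof -
      have "v \<le> f (I, \<zeta>) + rho A K \<xi> \<zeta> / \<epsilon>" if v: "v \<in> V I \<xi>" for v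
      proof (cases "v = 0")
        case True
        then show ?thesis using f_range(1)[of "(I, \<zeta>)"] \<epsilon> rho_nonneg[OF finA, of K \<xi> \<zeta>] by simp
      next
        case False
        then obtain \<eta> where \<eta>: "\<eta> \<in> Mor L A C" "\<phi> \<eta> \<in> I" "v = 1 - rho A K \<xi> (?c \<eta>) / \<epsilon>"
          using v by (auto simp: V_def)
        have "rho A K \<zeta> (?c \<eta>) \<le> rho A K \<zeta> \<xi> + rho A K \<xi> (?c \<eta>)"
          by (rule rho_triangle[OF finA \<zeta> \<xi> c_Mor[OF \<eta>(1)]])
        then have "rho A K \<zeta> (?c \<eta>) / \<epsilon> \<le> (rho A K \<xi> \<zeta> + rho A K \<xi> (?c \<eta>)) / \<epsilon>"
          using \<epsilon> by (intro divide_right_mono) (auto simp: rho_commute)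
        then have "v \<le> 1 - rho A K \<zeta> (?c \<eta>) / \<epsilon> + rho A K \<xi> \<zeta> / \<epsilon>"
          by (simp add: \<eta>(3) add_divide_distrib)
        moreover have "1 - rho A K \<zeta> (?c \<eta>) / \<epsilon> \<le> f (I, \<zeta>)"
          unfolding f_def using finV \<eta>(1,2) by (auto simp: V_def intro!: Max_ge)
        ultimately show ?thesis by linarith
      qed
      then show ?thesis unfolding f_def using finV by (simp add: Max_le_iff)
    qed
    then have "f \<in> lipschitz_family L A K \<epsilon>"
      using f_range by (auto simp: lipschitz_family_def)
    then obtain N y where Ny: "(N, y) \<in> \<Y>'" "f \<in> good (N, y)" using Y'(3) by fastforce
    then have N: "0 < N" and y: "\<And>i. i < N \<Longrightarrow> y i \<in> Mor L B K"
      using Y'(1) by (auto simp: \<Y>_def)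
    have "\<exists>\<psi>. \<psi> \<in> Mor L B C \<and> (\<forall>b\<in>univ B. c (\<psi> b) = y i b)" if "i < N" for i
    proof -
      have "y i ` univ B \<subseteq> c ` univ C" using Ny(1) that unfolding c(2) P_def by auto
      from Mor_factor[OF c(1) y[OF that] this] show ?thesis by metis
    qed
    then obtain \<psi> where \<psi>: "\<And>i. i < N \<Longrightarrow> \<psi> i \<in> Mor L B C"
      "\<And>i b. i < N \<Longrightarrow> b \<in> univ B \<Longrightarrow> c (\<psi> i b) = y i b" by metis
    let ?F = "{..<N}"
    have "(1 - \<epsilon>) * real (card ?F) \<le> real (matching_number L A C k ?F \<psi> \<alpha> \<beta> \<phi> \<epsilon>)"
      if \<alpha>: "\<alpha> \<in> Mor L A B" and \<beta>: "\<beta> \<in> Mor L A B" for \<alpha> \<beta>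
    proof -
      let ?p = "\<lambda>i \<alpha>. compose (univ A) (\<psi> i) \<alpha>"
      have p_Mor: "?p i \<gamma> \<in> Mor L A C" if "i < N" "\<gamma> \<in> Mor L A B" for i \<gamma>
        by (rule Mor_compose[OF that(2) \<psi>(1)[OF that(1)]])
      have p_y: "compose (univ A) (y i) \<gamma> = ?c (?p i \<gamma>)" if "i < N" "\<gamma> \<in> Mor L A B" for i \<gamma>
        using \<psi>(2)[OF that(1)] Mor_in[OF that(2)] by (auto simp: compose_def)
      define r where "r = (\<lambda>\<gamma> \<gamma>'. \<exists>i\<in>{0..k}. {?p \<gamma> \<alpha>, ?p \<gamma>' \<beta>} \<subseteq>
          rho_nbhd L A C {\<eta> \<in> Mor L A C. \<phi> \<eta> = i} \<epsilon>)"
      define d where "d = nat \<lfloor>\<epsilon> * real N\<rfloor>"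
      have "card S \<le> card {\<gamma>'\<in>?F. \<exists>\<gamma>\<in>S. r \<gamma> \<gamma>'} + d" if S: "S \<subseteq> ?F" for S
      proof -
        define I where "I = (\<lambda>\<gamma>. \<phi> (?p \<gamma> \<alpha>)) ` S"
        have I: "I \<subseteq> {0..k}" using \<phi> p_Mor \<alpha> S unfolding I_def by fastforce
        define W where "W = {\<gamma>'\<in>?F. \<exists>\<gamma>\<in>S. r \<gamma> \<gamma>'}"
        have "1 \<le> f (I, compose (univ A) (y \<gamma>) \<alpha>)" if "\<gamma> \<in> S" for \<gamma>
        proof -
          have \<gamma>: "\<gamma> < N" using that S by blast
          have "1 - rho A K (?c (?p \<gamma> \<alpha>)) (?c (?p \<gamma> \<alpha>)) / \<epsilon> \<le> f (I, ?c (?p \<gamma> \<alpha>))"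
            unfolding f_def using finV p_Mor[OF \<gamma> \<alpha>] that by (auto simp: V_def I_def intro!: Max_ge)
          then show ?thesis
            using rho_self[OF finA c_Mor[OF p_Mor[OF \<gamma> \<alpha>]]] by (simp add: p_y[OF \<gamma> \<alpha>])
        qed
        then have "(\<Sum>\<gamma>\<in>S. 1) \<le> (\<Sum>\<gamma>\<in>S. f (I, compose (univ A) (y \<gamma>) \<alpha>))" by (rule sum_mono)
        also have "\<dots> \<le> (\<Sum>\<gamma><N. f (I, compose (univ A) (y \<gamma>) \<alpha>))"
          using S f_range by (intro sum_mono2) auto
        also have "\<dots> \<le> (\<Sum>\<gamma><N. f (I, compose (univ A) (y \<gamma>) \<beta>)) + \<epsilon> * real N"
          using Ny(2) I \<alpha> \<beta> by (auto simp: good_def intro: less_imp_le)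
        also have "(\<Sum>\<gamma><N. f (I, compose (univ A) (y \<gamma>) \<beta>)) \<le> (\<Sum>\<gamma><N. if \<gamma> \<in> W then 1 else 0)"
        proof (rule sum_mono)
          fix \<gamma>' assume \<gamma>'F: "\<gamma>' \<in> ?F"
          then have \<gamma>': "\<gamma>' < N" by simp
          show "f (I, compose (univ A) (y \<gamma>') \<beta>) \<le> (if \<gamma>' \<in> W then 1 else 0)"
          proof (cases "0 < f (I, compose (univ A) (y \<gamma>') \<beta>)")
            case True
            have "f (I, ?c (?p \<gamma>' \<beta>)) \<in> V I (?c (?p \<gamma>' \<beta>))"
              unfolding f_def using finV by (auto intro!: Max_in)
            then obtain \<eta> where \<eta>: "\<eta> \<in> Mor L A C" "\<phi> \<eta> \<in> I" "0 < 1 - rho A K (?c (?p \<gamma>' \<beta>)) (?c \<eta>) / \<epsilon>"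
              using True by (auto simp: V_def p_y[OF \<gamma>' \<beta>])
            have "rho A K (?c (?p \<gamma>' \<beta>)) (?c \<eta>) < \<epsilon>" using \<eta>(3) \<epsilon> by (simp add: field_simps)
            moreover have "ldist K (?c (?p \<gamma>' \<beta>) a) (?c \<eta> a) = ldist C (?p \<gamma>' \<beta> a) (\<eta> a)" if "a \<in> univ A" for a
              using that Mor_dist[OF c(1) Mor_in[OF p_Mor[OF \<gamma>' \<beta>] that] Mor_in[OF \<eta>(1) that]]
              by (simp add: compose_eq)
            ultimately have "rho A C (?p \<gamma>' \<beta>) \<eta> < \<epsilon>" by (simp add: rho_less_iff[OF finA])
            then have "?p \<gamma>' \<beta> \<in> rho_nbhd L A C {\<zeta> \<in> Mor L A C. \<phi> \<zeta> = \<phi> \<eta>} \<epsilon>"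
              using \<eta>(1) p_Mor[OF \<gamma>' \<beta>] by (auto simp: rho_nbhd_def)
            moreover obtain \<gamma> where \<gamma>: "\<gamma> \<in> S" "\<phi> (?p \<gamma> \<alpha>) = \<phi> \<eta>" using \<eta>(2) by (auto simp: I_def)
            moreover have "\<gamma> < N" using \<gamma>(1) S by blast
            then have "?p \<gamma> \<alpha> \<in> rho_nbhd L A C {\<zeta> \<in> Mor L A C. \<phi> \<zeta> = \<phi> \<eta>} \<epsilon>"
              using p_Mor[OF _ \<alpha>] \<gamma>(2) rho_self[OF finA p_Mor[OF _ \<alpha>]] \<epsilon>
              unfolding rho_nbhd_def by (intro CollectI conjI bexI[of _ "?p \<gamma> \<alpha>"]) simp_all
            moreover have "\<phi> \<eta> \<in> {0..k}" using \<eta>(2) I by blast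
            ultimately have "\<gamma>' \<in> W" using \<gamma>'F unfolding W_def r_def by blast
            then show ?thesis using f_range(2) by simp
          next
            case False
            then show ?thesis by simp
          qed
        qed
        also have "\<dots> = real (card W)"
        proof -
          have "?F \<inter> W = W" by (auto simp: W_def)
          then show ?thesis using sum.inter_restrict[of ?F "\<lambda>_. 1::real" W] by simp
        qed
        finally have "real (card S) \<le> real (card W) + \<epsilon> * real N" by simp
        then have "int (card S) - int (card W) \<le> \<lfloor>\<epsilon> * real N\<rfloor>"
          by (subst le_floor_iff) simp
        then show ?thesis unfolding d_def W_def by linarith
      qed
      from partial_matching[OF finite_lessThan this]
      obtain D m where D: "D \<subseteq> ?F" "m \<in> D \<rightarrow> ?F" "inj_on m D" "\<forall>x\<in>D. r x (m x)"
        "card ?F \<le> card D + d" by blast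
      have "card D \<le> matching_number L A C k ?F \<psi> \<alpha> \<beta> \<phi> \<epsilon>"
        using D unfolding r_def by (intro matching_number_ge[of _ D m]) auto
      moreover have "real d \<le> \<epsilon> * real N" unfolding d_def using \<epsilon> by simp
      ultimately show ?thesis using D(5) by (simp add: algebra_simps)
    qed
    then show ?thesis
      using N \<psi>(1) by (intro exI[of _ ?F] exI[of _ \<psi>]) auto
  qed
  then show ?thesis using C(1) by blast
qed

theorem theorem9p3:
  fixes L :: "'r language"
    and \<K> :: "('b, 'r) lstructure set"
    and K :: "('a, 'r) lstructure"
    and k :: nat
  assumes "infinite (UNIV :: 'b set)"
    and "language L"
    and "fraisse_limit L \<K> K"
    and "1 \<le> k"
  shows "amenable (Aut L K) (Aut_topology L K) \<longleftrightarrow>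
    (\<forall>\<epsilon>::real. \<epsilon> > 0 \<longrightarrow> (\<forall>A\<in>\<K>. \<forall>B\<in>\<K>. \<exists>C\<in>\<K>.
      \<forall>\<phi> \<in> Mor L A C \<rightarrow> {0..k}.
        \<exists>(F::nat set) \<psi>. finite F \<and> F \<noteq> {} \<and> \<psi> \<in> F \<rightarrow> Mor L B C \<and>
          (\<forall>\<alpha>\<in>Mor L A B. \<forall>\<beta>\<in>Mor L A B.
             real (matching_number L A C k F \<psi> \<alpha> \<beta> \<phi> \<epsilon>) \<ge> (1 - \<epsilon>) * real (card F))))"
    (is "?amen \<longleftrightarrow> ?ramsey")
proof
  have K: "is_structure L K" "homogeneous L K" and age: "age L K = \<K>"
    using assms(3) by (auto simp: fraisse_limit_def polish_structure_def)
  show ?ramsey if ?amen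
    using matchings_of_amenable[OF assms(1) K that, of _ _ _ k] unfolding age by blast
  show ?amen if ramsey: ?ramsey
  proof -
    interpret translation_lattice "Aut L K" "UC L K" by (rule UC_translation_lattice)
    have "\<exists>(F::nat set) x. finite F \<and> F \<noteq> {} \<and> x \<in> F \<rightarrow> carrier (Aut L K) \<and>
        (\<forall>g\<in>S. \<forall>h\<in>S. real (card {i\<in>F. 13/20 < f (g \<otimes>\<^bsub>Aut L K\<^esub> x i)}) \<le>
           real (card {i\<in>F. 7/20 \<le> f (h \<otimes>\<^bsub>Aut L K\<^esub> x i)}) + \<epsilon> * real (card F))"
      if "f \<in> unit_valued" "finite S" "S \<subseteq> carrier (Aut L K)" "0 < \<epsilon>" for f S \<epsilon>
    proof -
      have "f \<in> UC L K" "S \<subseteq> automorphisms L K"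
        using that by (auto simp: unit_valued_def carrier_Aut)
      from samples_of_matchings[OF assms(1) K assms(4) ramsey[folded age, rule_format] this(1) that(2)
          this(2) that(4)]
      show ?thesis unfolding carrier_Aut .
    qed
    from invariant_mean_of_samples[OF this] show ?thesis
      unfolding amenable_iff carrier_Aut by blast
  qed
qed

end
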